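(* Let $f,t_0,g$ be as in the context, suppose $f$ has generalized exponential growth of type $(q,p)$ with $q\in[1,2)$, and assume $f\in C^2([0,\infty))$ and $f>0$ on $(0,\infty)$. If $q=1$, suppose in addition $\inf_{t>0}f(t)/t>0$. Moreover, assume that there exists a solution $(\lambda,U)=(\lambda^*,U^* )\in(0,\infty)\times C^2((0,1])$ of $$-U''-\tfrac1rU'=\lambda f(U),\ U>0\ \text{in }(0,1),\qquad \lim_{r\to0^+}U(r)=\infty,\ U(1)=0,$$ such that $U^*$ satisfies the asymptotic condition (C) defined in the context. For $\lambda>0$ consider the problem of finding $u\in C^2([0,1])$ with $$-u''-\tfrac1ru'=\lambda f(u),\ u>0\ \text{in }(0,1),\qquad u'(0)=0=u(1).\tag{P$_\lambda$}$$ Then for any $N\in\mathbb N$ there exists $\varepsilon>0$ such that (P$_\lambda$) has at least $N$ distinct solutions $u$ for all $\lambda^*-\varepsilon<\lambda<\lambda^*+\varepsilon$, and there exists an infinite sequence $(u_n)$ of solutions of (P$_{\lambda}$) with $\lambda=\lambda^*$ such that $u_n(0)\to\infty$ as $n\to\infty$.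
   Context: **Nonlinearity.** Put $\exp_1(t)=e^t$ and $\exp_k(t)=\exp(\exp_{k-1}(t))$ for $k\ge2$, $t\ge 0$. $f:[0,\infty)\to[0,\infty)$ is continuously differentiable, $t_0\ge0$ is such that $f(t)>0$ for all $t\ge t_0$ and $f\in C^2([t_0,\infty))$, and $g(t)=\log f(t)$ for $t\ge t_0$. We say that $f$ has generalized exponential growth of type $(q,p)$, where $(q,p)\in\{1\}\times(0,\infty]\,\cup\,(1,\infty)\times(0,\infty)$, if (a) $g'(t)>0$, $g''(t)>0$ for all $t\ge t_0$, $\lim_{t\to\infty}\frac{g'(t)^2}{g(t)g''(t)}=q$ and $\lim_{t\to\infty}\frac{tg'(t)}{g(t)}=p$; (b) if $q=1$: $tg'(t)/g(t)$ is nondecreasing for $t\ge t_0$, and there exist $m\in\mathbb N$ and $\hat g\in C^2([t_0,\infty))$ such that $f(t)=\exp_m(\hat g(t))$ and $\hat g'(t)/\hat g(t)$ is nonincreasing for all $t\ge t_0$. **Condition (C).** A continuous function $U(r)$ defined for all small $r>0$ satisfies (C) if for any $\alpha\in(0,2)$ and $\beta\in\mathbb R$ there exists $\bar r>0$ such that $$\alpha\log\tfrac1r\le g(U(r))\quad\text{and}\quad g(U(r))+\log g'(U(r))\le 2\log\tfrac1r+\beta\qquad\text{for all }r\in(0,\bar r).$$ *)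

theory Defs
  imports "HOL-Analysis.Analysis"
begin

text \<open>
  Functions on an interval are total functions of type \<open>real \<Rightarrow> real\<close> whose values outside the
  interval carry no meaning. Derivatives are taken within the interval, so that they are
  one-sided at an endpoint belonging to it and ordinary ones in its interior.
\<close>

definition deriv_on :: "real set \<Rightarrow> (real \<Rightarrow> real) \<Rightarrow> real \<Rightarrow> real" where
  "deriv_on I h t = vector_derivative h (at t within I)"

primrec Ck_on :: "nat \<Rightarrow> real set \<Rightarrow> (real \<Rightarrow> real) \<Rightarrow> bool" where
  "Ck_on 0 I h \<longleftrightarrow> continuous_on I h"
| "Ck_on (Suc k) I h \<longleftrightarrow>
     (\<forall>t\<in>I. h differentiable (at t within I)) \<and> Ck_on k I (deriv_on I h)"

definition nonlinearity :: "(real \<Rightarrow> real) \<Rightarrow> real \<Rightarrow> bool" where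
  "nonlinearity f t0 \<longleftrightarrow>
     (\<forall>t\<ge>0. f t \<ge> 0) \<and> Ck_on 1 {0..} f \<and>
     t0 \<ge> 0 \<and> (\<forall>t\<ge>t0. f t > 0) \<and> Ck_on 2 {t0..} f"

definition log_nl :: "(real \<Rightarrow> real) \<Rightarrow> real \<Rightarrow> real" where
  "log_nl f t = ln (f t)"

text \<open>
  The exponent \<open>p\<close> may be infinite when \<open>q = 1\<close>, hence its type. The iterated exponential
  \<open>exp\<^sub>m\<close> is \<open>exp ^^ m\<close> with \<open>m \<ge> 1\<close>. It is considered on \<open>[0, \<infinity>)\<close> only, and \<open>ghat\<close> occurs as a
  denominator; this is why \<open>ghat\<close> is required to be positive. Then \<open>g = (exp ^^ (m - 1)) \<circ> ghat\<close> is
  positive on \<open>[t0, \<infinity>)\<close> as well, so no quotient in the case \<open>q = 1\<close> has a zero denominator.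
\<close>

definition gen_exp_growth :: "(real \<Rightarrow> real) \<Rightarrow> real \<Rightarrow> real \<Rightarrow> ereal \<Rightarrow> bool" where
  "gen_exp_growth f t0 q p \<longleftrightarrow>
     (let g = log_nl f; g' = deriv_on {t0..} g; g'' = deriv_on {t0..} g' in
       (q, p) \<in> {1} \<times> {0<..\<infinity>} \<union> {1<..} \<times> {0<..<\<infinity>} \<and>
       (\<forall>t\<ge>t0. g' t > 0 \<and> g'' t > 0) \<and>
       ((\<lambda>t. (g' t)\<^sup>2 / (g t * g'' t)) \<longlongrightarrow> q) at_top \<and>
       ((\<lambda>t. ereal (t * g' t / g t)) \<longlongrightarrow> p) at_top \<and>
       (q = 1 \<longrightarrow>
          mono_on {t0..} (\<lambda>t. t * g' t / g t) \<and>
          (\<exists>m ghat. m \<ge> 1 \<and> Ck_on 2 {t0..} ghat \<and>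
             (\<forall>t\<ge>t0. ghat t > 0 \<and> f t = (exp ^^ m) (ghat t)) \<and>
             antimono_on {t0..} (\<lambda>t. deriv_on {t0..} ghat t / ghat t))))"

text \<open>
  Asymptotic condition (C). The conjunct \<open>t0 \<le> U r\<close> says that \<open>g (U r)\<close> and \<open>g' (U r)\<close> are
  defined.
\<close>

definition condition_C :: "(real \<Rightarrow> real) \<Rightarrow> real \<Rightarrow> (real \<Rightarrow> real) \<Rightarrow> bool" where
  "condition_C f t0 U \<longleftrightarrow>
     (let g = log_nl f; g' = deriv_on {t0..} g in
       (\<exists>\<delta>>0. continuous_on {0<..<\<delta>} U) \<and>
       (\<forall>\<alpha>\<in>{0<..<2}. \<forall>\<beta>::real. \<exists>rbar>0. \<forall>r\<in>{0<..<rbar}.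
          t0 \<le> U r \<and>
          \<alpha> * ln (1 / r) \<le> g (U r) \<and>
          g (U r) + ln (g' (U r)) \<le> 2 * ln (1 / r) + \<beta>))"

definition radial_eq ::
  "real set \<Rightarrow> (real \<Rightarrow> real) \<Rightarrow> real \<Rightarrow> (real \<Rightarrow> real) \<Rightarrow> bool" where
  "radial_eq I f lam u \<longleftrightarrow>
     (\<forall>r\<in>{0<..<1}. - deriv_on I (deriv_on I u) r - 1 / r * deriv_on I u r = lam * f (u r))"

definition singular_solution :: "(real \<Rightarrow> real) \<Rightarrow> real \<Rightarrow> (real \<Rightarrow> real) \<Rightarrow> bool" where
  "singular_solution f lam U \<longleftrightarrow>
     Ck_on 2 {0<..1} U \<and> radial_eq {0<..1} f lam U \<and> (\<forall>r\<in>{0<..<1}. U r > 0) \<and>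
     filterlim U at_top (at_right 0) \<and> U 1 = 0"

definition regular_solution :: "(real \<Rightarrow> real) \<Rightarrow> real \<Rightarrow> (real \<Rightarrow> real) \<Rightarrow> bool" where
  "regular_solution f lam u \<longleftrightarrow>
     Ck_on 2 {0..1} u \<and> radial_eq {0..1} f lam u \<and> (\<forall>r\<in>{0<..<1}. u r > 0) \<and>
     deriv_on {0..1} u 0 = 0 \<and> u 1 = 0"

text \<open>Solutions count as distinct only if they differ at some point of \<open>[0, 1]\<close>.\<close>

definition at_least_regular_solutions :: "nat \<Rightarrow> (real \<Rightarrow> real) \<Rightarrow> real \<Rightarrow> bool" where
  "at_least_regular_solutions N f lam \<longleftrightarrow>
     (\<exists>u :: nat \<Rightarrow> real \<Rightarrow> real.
        (\<forall>i<N. regular_solution f lam (u i)) \<and>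
        (\<forall>i<N. \<forall>j<N. i \<noteq> j \<longrightarrow> (\<exists>r\<in>{0..1}. u i r \<noteq> u j r)))"

end

theory Submission
  imports Defs "HOL-Real_Asymp.Real_Asymp"
begin

text \<open>
  In the variable \<open>t = ln (1/r)\<close> the radial equation, after rescaling \<open>\<lambda>\<close> to \<open>1\<close>, is
  \<open>- y'' = exp (-2t) f(y)\<close>. Let \<open>U\<close> be the transformed singular solution and \<open>y\<^sub>\<gamma>\<close> the solution with
  \<open>y\<^sub>\<gamma> \<rightarrow> \<gamma>\<close>, \<open>y\<^sub>\<gamma>' \<rightarrow> 0\<close> as \<open>t \<rightarrow> \<infinity>\<close>. The core of the proof is that the number of zeros of \<open>y\<^sub>\<gamma> - U\<close>
  on any half-line tends to infinity with \<open>\<gamma>\<close>. A long interval between two zeros is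
  impossible: on it the lower one of the two functions, call it \<open>w\<close>, cannot satisfy
  \<open>k t \<le> g(w) \<le> 3 t\<close>, because then the linearisation \<open>- z'' = exp (-2t) f'(w) z\<close> oscillates; for
  \<open>w = U\<close> these bounds come from condition (C). If \<open>w = y\<^sub>\<gamma>\<close>, a Pohozaev identity bounds the slope by
  \<open>(4 + c) / g'(y\<^sub>\<gamma>)\<close>, and as \<open>(g/g')' \<rightarrow> 1 - 1/q < 1/2\<close> a line of this slope cannot leave the region
  \<open>g \<ge> k t\<close> before it meets \<open>U\<close>; this is where \<open>q < 2\<close> is needed.

  All zeros of \<open>y\<^sub>\<gamma> - U\<close> are simple, so their number changes only when one passes through the
  boundary point \<open>r = 1\<close>. Since it is unbounded, the boundary value of \<open>y\<^sub>\<gamma>\<close> changes sign for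
  arbitrarily large \<open>\<gamma>\<close>, and the intermediate value theorem in \<open>\<gamma>\<close> yields the solutions.
\<close>

section \<open>Oscillation about the singular solution\<close>

text \<open>Condition (C) makes the potential \<open>exp (-2t) f'(U)\<close> tend to 0 and bounds it
  from below only very weakly, so oscillation cannot be read off it pointwise. It is used instead
  that the potential equals \<open>g''(w) w'^2 - G''\<close> with \<open>G = g(w)\<close>. Here
  \<open>G'\<close> is bounded, and the first term is at least \<open>G'^2 / (2 G)\<close>, which on
  average is of order \<open>1/t\<close> when \<open>G\<close> is comparable to \<open>t\<close>,
  far above the critical size \<open>1 / (4 t^2)\<close>. The number 1/2 has this origin: with slope
  \<open>4/g'\<close>, over a time \<open>t\<close> of about \<open>g/2\<close>, the function
  \<open>y\<close> drops by about \<open>2 g/g'\<close>. If \<open>g/g'\<close> were linear with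
  slope \<theta>, a value \<open>v\<close> would fall to \<open>(1 - 2 \<theta>) v\<close>, which is
  a fixed positive fraction of \<open>v\<close> only for \<theta> < 1/2. A solution with large
  \<gamma> may reach 0 before the boundary radius. The nonlinearity is therefore continued by the
  constant \<open>f 0\<close> to negative arguments, which makes all solutions global and gives the
  boundary value a sign for every \<gamma>.\<close>

lemma DERIV_nonneg_imp_le_open:
  fixes f f' :: "real \<Rightarrow> real"
  assumes "a \<le> b" "continuous_on {a..b} f"
    and "\<And>x. a < x \<Longrightarrow> x < b \<Longrightarrow> (f has_real_derivative f' x) (at x)"
    and "\<And>x. a < x \<Longrightarrow> x < b \<Longrightarrow> 0 \<le> f' x"
  shows "f a \<le> f b"
proof (cases "a = b")
  case False
  then have ab: "a < b" using assms(1) by simp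
  obtain l z where z: "a < z" "z < b" "(f has_real_derivative l) (at z)" "f b - f a = (b - a) * l"
    using MVT[OF ab assms(2)] assms(3) real_differentiable_def by blast
  then have "l = f' z" using assms(3) DERIV_unique by blast
  then have "0 \<le> (b - a) * l" using assms(4) z ab by auto
  then show ?thesis using z(4) by simp
qed simp

lemma DERIV_nonneg_imp_le:
  fixes f f' :: "real \<Rightarrow> real"
  assumes "a \<le> b"
    and "\<And>x. a \<le> x \<Longrightarrow> x \<le> b \<Longrightarrow> (f has_real_derivative f' x) (at x)"
    and "\<And>x. a \<le> x \<Longrightarrow> x \<le> b \<Longrightarrow> 0 \<le> f' x"
  shows "f a \<le> f b"
  using DERIV_nonneg_imp_nondecreasing[OF assms(1)] assms(2,3) by meson

lemma DERIV_nonpos_imp_ge: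
  fixes f f' :: "real \<Rightarrow> real"
  assumes "a \<le> b"
    and "\<And>x. a \<le> x \<Longrightarrow> x \<le> b \<Longrightarrow> (f has_real_derivative f' x) (at x)"
    and "\<And>x. a \<le> x \<Longrightarrow> x \<le> b \<Longrightarrow> f' x \<le> 0"
  shows "f b \<le> f a"
  using DERIV_nonpos_imp_nonincreasing[OF assms(1)] assms(2,3) by meson

lemma nondecreasing_tendsto_le:
  fixes F :: "real \<Rightarrow> real"
  assumes "(F \<longlongrightarrow> l) at_top" "\<And>s. t \<le> s \<Longrightarrow> F t \<le> F s"
  shows "F t \<le> l"
  by (rule tendsto_lowerbound[OF assms(1)])
     (use assms(2) in \<open>auto intro: eventually_at_top_linorderI\<close>)

lemma nonincreasing_tendsto_ge:
  fixes F :: "real \<Rightarrow> real"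
  assumes "(F \<longlongrightarrow> l) at_top" "\<And>s. t \<le> s \<Longrightarrow> F s \<le> F t"
  shows "l \<le> F t"
  by (rule tendsto_upperbound[OF assms(1)])
     (use assms(2) in \<open>auto intro: eventually_at_top_linorderI\<close>)

text \<open>The equation for \<open>y t = u (exp (- t))\<close>, so that \<open>y1\<close> stands
  for \<open>- r u'(r)\<close> and \<open>0 < y1 t\<close> says that \<open>u\<close> decreases in
  \<open>r\<close>. The half-line is open because \<open>T\<close> will be the image of a boundary
  radius.\<close>

definition solves :: "(real \<Rightarrow> real) \<Rightarrow> real \<Rightarrow> (real \<Rightarrow> real) \<Rightarrow> (real \<Rightarrow> real) \<Rightarrow> bool" where
  "solves f T y y1 \<longleftrightarrow> (\<forall>t>T. (y has_real_derivative y1 t) (at t) \<and>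
      (y1 has_real_derivative - exp (- 2 * t) * f (y t)) (at t) \<and> 0 < y1 t)"

text \<open>
  \<open>\<theta>\<close> bounds \<open>(g/g')' = 1 - g g''/g'\<^sup>2\<close>, whose limit is \<open>1 - 1/q\<close>; \<open>x > 2\<close> with \<open>\<theta> x < 1\<close> exists since
  \<open>\<theta> < 1/2\<close>, and \<open>c\<close> is the resulting margin.
\<close>

locale growth =
  fixes f g g1 g2 :: "real \<Rightarrow> real" and M \<theta> x c :: real
  assumes f_nonneg: "0 \<le> f u"
    and f_bdd: "\<exists>B. \<forall>u\<le>m. f u \<le> B"
    and f_cont: "continuous_on UNIV f"
    and f_exp: "M \<le> s \<Longrightarrow> f s = exp (g s)"
    and g_deriv: "M \<le> s \<Longrightarrow> (g has_real_derivative g1 s) (at s)"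
    and g1_deriv: "M \<le> s \<Longrightarrow> (g1 has_real_derivative g2 s) (at s)"
    and g1_pos: "M \<le> s \<Longrightarrow> 0 < g1 s"
    and g_ge1: "M \<le> s \<Longrightarrow> 1 \<le> g s"
    and g2_lower: "M \<le> s \<Longrightarrow> (1 - \<theta>) * (g1 s)\<^sup>2 \<le> g s * g2 s"
    and g2_upper: "M \<le> s \<Longrightarrow> g s * g2 s \<le> 2 * (g1 s)\<^sup>2"
    and g2_small: "M \<le> s \<Longrightarrow> g2 s \<le> c / (4 + c) * (g1 s)\<^sup>2"
    and theta: "0 < \<theta>" "\<theta> < 1/2" and x: "2 < x" "\<theta> * x < 1"
    and c: "0 < c" "c \<le> 1/2" "4 + 2 * c \<le> x * (2 - c)"
begin

section \<open>Convexity and growth of the nonlinearity\<close>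

lemma g_pos: "M \<le> s \<Longrightarrow> 0 < g s"
  using g_ge1[of s] by simp

lemma g2_pos:
  assumes "M \<le> s" shows "0 < g2 s"
proof -
  have "0 < (1 - \<theta>) * (g1 s)\<^sup>2" using theta g1_pos[OF assms] by simp
  then show ?thesis using g2_lower[OF assms] g_pos[OF assms]
    by (metis less_le_trans zero_less_mult_pos)
qed

lemma g1_mono: "M \<le> a \<Longrightarrow> a \<le> b \<Longrightarrow> g1 a \<le> g1 b"
  by (rule DERIV_nonneg_imp_le[where f' = g2]) (auto intro: g1_deriv less_imp_le[OF g2_pos])

lemma g_mono: "M \<le> a \<Longrightarrow> a \<le> b \<Longrightarrow> g a \<le> g b"
  by (rule DERIV_nonneg_imp_le[where f' = g1]) (auto intro: g_deriv less_imp_le[OF g1_pos])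

lemma f_deriv: "M < s \<Longrightarrow> (f has_real_derivative f s * g1 s) (at s)"
proof -
  assume s: "M < s"
  have "((\<lambda>s. exp (g s)) has_real_derivative exp (g s) * g1 s) (at s)"
    using s g_deriv[of s] by (auto intro!: derivative_eq_intros)
  then show ?thesis
    by (rule has_field_derivative_transform_within_open[where S = "{M<..}", THEN DERIV_cong])
       (use s f_exp in auto)
qed

lemma f_pos: "M \<le> s \<Longrightarrow> 0 < f s"
  using f_exp by simp

lemma f_mono: "M \<le> a \<Longrightarrow> a \<le> b \<Longrightarrow> f a \<le> f b"
  using f_exp g_mono by simp

lemma exp_g_deriv: "M \<le> s \<Longrightarrow> ((\<lambda>s. exp (g s)) has_real_derivative exp (g s) * g1 s) (at s)"
  using g_deriv[of s] by (auto intro!: derivative_eq_intros)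

text \<open>\<open>f' = f * g1\<close> is a product of positive nondecreasing factors.\<close>

lemma f_convex:
  assumes "M \<le> a" "a \<le> b" shows "f a * g1 a * (b - a) \<le> f b - f a"
proof (cases "a = b")
  case False
  then have "a < b" using assms by simp
  \<comment> \<open>The mean value theorem is applied to \<open>exp (g s)\<close>, which is
    differentiable at \<open>M\<close> itself, whereas \<open>f\<close> is known to agree with it
    only from \<open>M\<close> onwards.\<close>
  obtain z where z: "a < z" "z < b" "exp (g b) - exp (g a) = (b - a) * (exp (g z) * g1 z)"
    using MVT2[OF \<open>a < b\<close>, of "\<lambda>s. exp (g s)" "\<lambda>s. exp (g s) * g1 s"] exp_g_deriv assms by auto
  have "f a * g1 a \<le> exp (g z) * g1 z"
    using f_exp f_mono[of a z] g1_mono[of a z] z assms g1_pos[of a]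
    by (intro mult_mono) auto
  then have "f a * g1 a * (b - a) \<le> (exp (g z) * g1 z) * (b - a)"
    using \<open>a < b\<close> by (intro mult_right_mono) auto
  then show ?thesis using z(3) f_exp assms by (simp add: mult.commute)
qed simp

lemma g_tangent:
  assumes "M \<le> a" "a \<le> b" shows "g b - g a \<le> g1 b * (b - a)" "g1 a * (b - a) \<le> g b - g a"
proof -
  have "g b - g a \<le> g1 b * (b - a) \<and> g1 a * (b - a) \<le> g b - g a"
  proof (cases "a = b")
    case False
    then have "a < b" using assms by simp
    obtain z where z: "a < z" "z < b" "g b - g a = (b - a) * g1 z"
      using MVT2[OF \<open>a < b\<close>, of g g1] g_deriv assms by auto
    have "g1 z \<le> g1 b" "g1 a \<le> g1 z" using g1_mono z assms by auto
    then show ?thesis using z(3) \<open>a < b\<close> by (simp add: mult.commute)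
  qed simp
  then show "g b - g a \<le> g1 b * (b - a)" "g1 a * (b - a) \<le> g b - g a" by auto
qed

lemma g_at_top: "filterlim g at_top at_top"
proof (rule filterlim_at_top_mono)
  show "filterlim (\<lambda>s. g M + g1 M * (s - M)) at_top at_top"
    using g1_pos[of M] by real_asymp
  show "\<forall>\<^sub>F s in at_top. g M + g1 M * (s - M) \<le> g s"
    by (rule eventually_at_top_linorderI[of M]) (use g_tangent(2)[of M] in \<open>simp add: algebra_simps\<close>)
qed

text \<open>As \<theta> < 1/2, \<open>g2_lower\<close> makes \<open>g1 / sqrt g\<close>
  nondecreasing, so \<open>g1\<close> grows at least like \<open>sqrt g\<close>.\<close>

lemma g1_at_top: "filterlim g1 at_top at_top"
proof (rule filterlim_at_top_mono)
  have "filterlim (\<lambda>s. sqrt (g s)) at_top at_top"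
    by (rule filterlim_compose[OF sqrt_at_top g_at_top])
  then show "filterlim (\<lambda>s. g1 M / sqrt (g M) * sqrt (g s)) at_top at_top"
    by (intro filterlim_tendsto_pos_mult_at_top[OF tendsto_const])
       (use g1_pos[of M] g_pos[of M] in auto)
  show "\<forall>\<^sub>F s in at_top. g1 M / sqrt (g M) * sqrt (g s) \<le> g1 s"
  proof (rule eventually_at_top_linorderI[of M])
    fix s assume s: "M \<le> s"
    have "g1 M / sqrt (g M) \<le> g1 s / sqrt (g s)"
    proof (rule DERIV_nonneg_imp_le[OF s, where f' =
        "\<lambda>u. (g2 u * sqrt (g u) - g1 u * (g1 u / (2 * sqrt (g u)))) / (sqrt (g u) * sqrt (g u))"])
      fix u assume u: "M \<le> u" "u \<le> s"
      have gu: "0 < g u" using g_pos u by simp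
      show "((\<lambda>s. g1 s / sqrt (g s)) has_real_derivative
         (g2 u * sqrt (g u) - g1 u * (g1 u / (2 * sqrt (g u)))) / (sqrt (g u) * sqrt (g u))) (at u)"
        using gu g_deriv[OF u(1)] g1_deriv[OF u(1)]
        by (auto intro!: derivative_eq_intros simp: field_simps)
      have "1 / 2 * (g1 u)\<^sup>2 \<le> (1 - \<theta>) * (g1 u)\<^sup>2"
        using theta by (intro mult_right_mono) auto
      then have "(g1 u)\<^sup>2 / 2 \<le> g u * g2 u" using g2_lower[OF u(1)] by linarith
      then have "(g1 u * g1 u / 2) / sqrt (g u) \<le> (g u * g2 u) / sqrt (g u)"
        using gu by (intro divide_right_mono) (auto simp: power2_eq_square)
      also have "\<dots> = g2 u * sqrt (g u)" using gu
        by (simp add: field_simps)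
      finally have "g1 u * (g1 u / (2 * sqrt (g u))) \<le> g2 u * sqrt (g u)" by simp
      then show "0 \<le> (g2 u * sqrt (g u) - g1 u * (g1 u / (2 * sqrt (g u)))) / (sqrt (g u) * sqrt (g u))"
        using gu by simp
    qed
    then show "g1 M / sqrt (g M) * sqrt (g s) \<le> g1 s"
      using g_pos[OF s] by (simp add: pos_le_divide_eq)
  qed
qed

text \<open>\<open>g2_upper\<close> makes \<open>g1 / g^2\<close> nonincreasing. The purpose: where
  \<open>g\<close> is at most \<open>3 * t\<close>, \<open>g1\<close> is at most quadratic in
  \<open>t\<close>, hence negligible against any exponential in \<open>t\<close>.\<close>

lemma g1_le_square:
  obtains C where "0 < C" "\<And>s. M \<le> s \<Longrightarrow> g1 s \<le> C * (g s)\<^sup>2"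
proof
  show "0 < g1 M / (g M)\<^sup>2" using g1_pos[of M] g_pos[of M] by simp
  fix s assume s: "M \<le> s"
  have "g1 s / (g s)\<^sup>2 \<le> g1 M / (g M)\<^sup>2"
  proof (rule DERIV_nonpos_imp_ge[OF s, where f' =
      "\<lambda>u. (g2 u * (g u)\<^sup>2 - g1 u * (2 * g u * g1 u)) / ((g u)\<^sup>2 * (g u)\<^sup>2)"])
    fix u assume u: "M \<le> u" "u \<le> s"
    have gu: "0 < g u" using g_pos u by simp
    show "((\<lambda>s. g1 s / (g s)\<^sup>2) has_real_derivative
        (g2 u * (g u)\<^sup>2 - g1 u * (2 * g u * g1 u)) / ((g u)\<^sup>2 * (g u)\<^sup>2)) (at u)"
      using gu g_deriv[OF u(1)] g1_deriv[OF u(1)]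
      by (auto intro!: derivative_eq_intros simp: field_simps)
    have "g u * (g u * g2 u) \<le> g u * (2 * (g1 u)\<^sup>2)"
      using g2_upper[OF u(1)] gu by (intro mult_left_mono) auto
    then show "(g2 u * (g u)\<^sup>2 - g1 u * (2 * g u * g1 u)) / ((g u)\<^sup>2 * (g u)\<^sup>2) \<le> 0"
      using gu by (intro divide_nonpos_pos) (auto simp: power2_eq_square algebra_simps)
  qed
  then show "g1 s \<le> g1 M / (g M)\<^sup>2 * (g s)\<^sup>2"
    using g_pos[OF s] by (simp add: pos_divide_le_eq)
qed

text \<open>The length scale of \<open>g\<close> at \<open>s\<close>: the tangent to
  \<open>g\<close> at \<open>s\<close> vanishes at \<open>s - h s\<close>.\<close>

definition h where "h s = g s / g1 s"

lemma h_pos: "M \<le> s \<Longrightarrow> 0 < h s"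
  unfolding h_def using g_pos g1_pos by simp

lemma h_diff:
  assumes "M \<le> a" "a \<le> b" shows "h b - h a \<le> \<theta> * (b - a)"
proof -
  have "h b - \<theta> * b \<le> h a - \<theta> * a"
  proof (rule DERIV_nonpos_imp_ge[OF assms(2), where f' =
      "\<lambda>u. (g1 u * g1 u - g u * g2 u) / (g1 u * g1 u) - \<theta>"])
    fix u assume u: "a \<le> u" "u \<le> b"
    then have Mu: "M \<le> u" using assms by simp
    have pos: "0 < g1 u" using g1_pos[OF Mu] .
    show "((\<lambda>u. h u - \<theta> * u) has_real_derivative (g1 u * g1 u - g u * g2 u) / (g1 u * g1 u) - \<theta>) (at u)"
      unfolding h_def using pos g_deriv[OF Mu] g1_deriv[OF Mu]
      by (auto intro!: derivative_eq_intros simp: field_simps)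
    have "g1 u * g1 u - g u * g2 u \<le> \<theta> * (g1 u * g1 u)"
      using g2_lower[OF Mu] by (simp add: power2_eq_square algebra_simps)
    then show "(g1 u * g1 u - g u * g2 u) / (g1 u * g1 u) - \<theta> \<le> 0"
      using pos by (simp add: pos_divide_le_eq)
  qed
  then show ?thesis by (simp add: algebra_simps)
qed

text \<open>Obtained by integrating \<open>(ln g)' = 1 / h\<close> over a length
  \<open>x * h v\<close> on which \<open>h\<close> is at least
  \<open>(1 - \<theta> * x) * h v\<close>.\<close>

definition E where "E = exp (- (x / (1 - \<theta> * x)))"

lemma E_pos: "0 < E" and E_le1: "E \<le> 1"
  unfolding E_def using x theta by (auto simp: field_simps)

text \<open>\<open>h\<close> has slope at most \<theta>, so moving left from \<open>v\<close> by at
  most \<open>x * h v\<close> leaves at least the fraction \<open>1 - \<theta> * x\<close> of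
  \<open>h v\<close>. This fraction is positive because \<open>\<theta> * x < 1\<close>, and it
  bounds the logarithmic derivative of \<open>g\<close>.\<close>

lemma g_lower:
  assumes "M \<le> u" "u \<le> v" "v - x * h v \<le> u"
  shows "E * g v \<le> g u"
proof (cases "u = v")
  case True
  then show ?thesis using E_le1 g_pos[of u] assms by (simp add: mult_left_le_one_le E_pos less_imp_le)
next
  case False
  then have "u < v" using assms by simp
  have "((\<lambda>s. ln (g s)) has_real_derivative g1 s / g s) (at s)" if "u \<le> s" for s
    using g_pos[of s] g_deriv[of s] that assms by (auto intro!: derivative_eq_intros)
  then obtain z where z: "u < z" "z < v" "ln (g v) - ln (g u) = (v - u) * (g1 z / g z)"
    using MVT2[OF \<open>u < v\<close>, of "\<lambda>s. ln (g s)" "\<lambda>s. g1 s / g s"] by auto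
  have hz: "h v * (1 - \<theta> * x) \<le> h z"
  proof -
    have "h v - h z \<le> \<theta> * (v - z)" using h_diff[of z v] z assms by simp
    also have "\<dots> \<le> \<theta> * (x * h v)" using z assms theta by (intro mult_left_mono) auto
    finally show ?thesis by (simp add: algebra_simps)
  qed
  have hv: "0 < h v" using h_pos[of v] assms by simp
  have "g1 z / g z = 1 / h z" unfolding h_def by simp
  also have "\<dots> \<le> 1 / (h v * (1 - \<theta> * x))" using hz hv x by (intro frac_le) auto
  finally have "(v - u) * (g1 z / g z) \<le> (x * h v) * (1 / (h v * (1 - \<theta> * x)))"
    using assms hv x h_pos[of z] z \<open>u < v\<close> g_pos[of z] g1_pos[of z] by (intro mult_mono) auto
  also have "\<dots> = x / (1 - \<theta> * x)" using hv x by (simp add: field_simps)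
  finally have "ln (g v) - x / (1 - \<theta> * x) \<le> ln (g u)" using z(3) by simp
  then have "exp (ln (g v) - x / (1 - \<theta> * x)) \<le> exp (ln (g u))" by simp
  then show ?thesis unfolding E_def using g_pos[of u] g_pos[of v] assms
    by (simp add: exp_diff exp_minus field_simps)
qed

lemma solves_mono: "solves f T y y1 \<Longrightarrow> T < a \<Longrightarrow> a \<le> b \<Longrightarrow> y a \<le> y b"
  unfolding solves_def by (rule DERIV_nonneg_imp_le[of a b y y1]) (auto intro: less_imp_le)

text \<open>
  A Pohozaev identity in which \<open>f / g'\<close> replaces the primitive of \<open>f\<close>.
\<close>

lemma slope_bound:
  assumes sol: "solves f T0 y y1" and t: "T0 < t" "M < y t"
    and lim1: "(y1 \<longlongrightarrow> 0) at_top"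
    and lim2: "((\<lambda>s. exp (- 2 * s) * f (y s) / g1 (y s)) \<longlongrightarrow> 0) at_top"
  shows "y1 t \<le> (4 + c) / g1 (y t)"
proof -
  define G where "G = g1 (y t)"
  \<comment> \<open>A coefficient below 1 leaves \<open>1 - e = c / (4 + c)\<close> of the term
    \<open>exp (-2s) f(y) y1\<close>, exactly what \<open>g2_small\<close> needs to absorb the error
    \<open>g2 / g1^2\<close> of replacing the primitive of \<open>f\<close> by
    \<open>f / g1\<close>. At the end \<open>4 / e = 4 + c\<close>.\<close>
  define e where "e = 4 / (4 + c)"
  have G: "0 < G" unfolding G_def using g1_pos t by simp
  have e: "0 < e" "e < 1" unfolding e_def using c by auto
  \<comment> \<open>The last term, with \<open>G\<close> frozen at time \<open>t\<close>,
    compensates the negative contribution \<open>- 2 * exp (- 2 * s) * f (y s) / g1 (y s)\<close> to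
    the derivative, since \<open>g1 (y s)\<close> is at least \<open>G\<close> for \<open>s\<close>
    beyond \<open>t\<close>. As \<open>F\<close> increases to 0, it is nonpositive at
    \<open>t\<close>.\<close>
  define F where "F s = e / 2 * (y1 s)\<^sup>2 + exp (- 2 * s) * f (y s) / g1 (y s) - 2 / G * y1 s" for s
  define F' where "F' s = e * y1 s * (- exp (- 2 * s) * f (y s)) +
      ((- 2 * exp (- 2 * s) * f (y s) + exp (- 2 * s) * (f (y s) * g1 (y s) * y1 s)) * g1 (y s)
        - exp (- 2 * s) * f (y s) * (g2 (y s) * y1 s)) / (g1 (y s) * g1 (y s))
      - 2 / G * (- exp (- 2 * s) * f (y s))" for s
  have "F t \<le> F b" if "t \<le> b" for b
  proof (rule DERIV_nonneg_imp_le[OF that, where f' = F'])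
    fix s assume s: "t \<le> s" "s \<le> b"
    have T0s: "T0 < s" using s t by simp
    have My: "M < y s" using solves_mono[OF sol, of t s] s t by simp
    have d: "(y has_real_derivative y1 s) (at s)"
        "(y1 has_real_derivative - exp (- 2 * s) * f (y s)) (at s)" "0 < y1 s"
      using sol T0s unfolding solves_def by auto
    have pos: "0 < g1 (y s)" using g1_pos My by simp
    have df: "((\<lambda>s. f (y s)) has_real_derivative f (y s) * g1 (y s) * y1 s) (at s)"
      using DERIV_chain2[OF f_deriv[OF My] d(1)] by simp
    have dg: "((\<lambda>s. g1 (y s)) has_real_derivative g2 (y s) * y1 s) (at s)"
      using DERIV_chain2[OF g1_deriv[of "y s"] d(1)] My by simp
    show "(F has_real_derivative F' s) (at s)"
      unfolding F_def F'_def
      by (rule derivative_eq_intros df dg d refl | use pos in \<open>simp; fail\<close>)+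
         (simp add: algebra_simps)
    define k where "k = exp (- 2 * s) * f (y s)"
    have k: "0 < k" unfolding k_def using f_pos My by simp
    have Gle: "G \<le> g1 (y s)" unfolding G_def
      using g1_mono solves_mono[OF sol, of t s] s t by simp
    have "F' s = - e * y1 s * k + k * y1 s - 2 * k / g1 (y s) - k * y1 s * (g2 (y s) / (g1 (y s))\<^sup>2)
        + 2 * k / G"
      unfolding F'_def k_def[symmetric] using pos G
      by (simp add: k_def field_simps power2_eq_square)
    also have "\<dots> = k * y1 s * ((1 - e) - g2 (y s) / (g1 (y s))\<^sup>2) + 2 * k * (1 / G - 1 / g1 (y s))"
      by (simp add: algebra_simps)
    also have "\<dots> \<ge> 0"
    proof -
      have "g2 (y s) / (g1 (y s))\<^sup>2 \<le> c / (4 + c)" using g2_small[of "y s"] My pos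
        by (simp add: pos_divide_le_eq)
      moreover have "1 - e = c / (4 + c)" unfolding e_def using c by (simp add: field_simps)
      moreover have "1 / g1 (y s) \<le> 1 / G" using Gle G by (simp add: frac_le)
      ultimately show ?thesis using k d(3) by simp
    qed
    finally show "0 \<le> F' s" .
  qed
  moreover have "(F \<longlongrightarrow> e / 2 * 0\<^sup>2 + 0 - 2 / G * 0) at_top"
    unfolding F_def by (intro tendsto_intros lim1 lim2)
  ultimately have "F t \<le> 0" using nondecreasing_tendsto_le[of F 0 t] by simp
  moreover have "0 \<le> exp (- 2 * t) * f (y t) / g1 (y t)"
    using G f_nonneg unfolding G_def by (simp add: less_imp_le)
  ultimately have le: "e / 2 * (y1 t)\<^sup>2 \<le> 2 / G * y1 t" unfolding F_def by linarith
  have y1: "0 < y1 t" using sol t unfolding solves_def by auto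
  have "(e / 2 * y1 t) * y1 t \<le> (2 / G) * y1 t" using le by (simp add: power2_eq_square algebra_simps)
  then have "e / 2 * y1 t \<le> 2 / G" using y1 by (rule mult_right_le_imp_le)
  then show ?thesis unfolding e_def G_def[symmetric] using c G by (simp add: field_simps)
qed

end

section \<open>Comparison of two ordered solutions\<close>

context growth
begin

text \<open>
  With \<open>w = Y - y\<close> and \<open>G = g \<circ> y\<close>, the convexity of \<open>f\<close> gives \<open>(w'/w)' \<le> - exp (-2t) f'(y)\<close>, while
  \<open>G''\<close> contains the same term; hence \<open>w'/w - G' + k/2 (2 ln G - ln t)\<close> is nonincreasing. Its first
  two terms are bounded, whereas the last one grows like \<open>ln t\<close>.
\<close>

lemma sturm_bound:
  assumes y: "solves f T0 y y1" and Y: "solves f T0 Y Y1"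
    and T: "T0 < T" "0 < T" "T + 2 \<le> b"
    and My: "\<And>t. T \<le> t \<Longrightarrow> t \<le> b \<Longrightarrow> M < y t"
    and yY: "\<And>t. T \<le> t \<Longrightarrow> t \<le> b \<Longrightarrow> y t < Y t"
    and slope: "\<And>t. T \<le> t \<Longrightarrow> t \<le> b \<Longrightarrow> g1 (y t) * y1 t \<le> 5"
    and k: "0 < k" "\<And>t. T \<le> t \<Longrightarrow> t \<le> b \<Longrightarrow> k * t \<le> g (y t)"
    and g3: "\<And>t. T \<le> t \<Longrightarrow> t \<le> b \<Longrightarrow> g (y t) \<le> 3 * t"
  shows "ln (b - 1) \<le> 14 / k - 2 * ln k + 2 * ln 3 + ln (T + 1)"
proof -
  define w where "w t = Y t - y t" for t
  define w1 where "w1 t = Y1 t - y1 t" for t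
  define w2 where "w2 t = - exp (- 2 * t) * f (Y t) + exp (- 2 * t) * f (y t)" for t
  define a where "a t = exp (- 2 * t) * f (y t) * g1 (y t)" for t
  have wd: "(w has_real_derivative w1 t) (at t)" "(w1 has_real_derivative w2 t) (at t)" if "T \<le> t" for t
  proof -
    have "(y has_real_derivative y1 t) (at t)" "(Y has_real_derivative Y1 t) (at t)"
      "(y1 has_real_derivative - exp (- 2 * t) * f (y t)) (at t)"
      "(Y1 has_real_derivative - exp (- 2 * t) * f (Y t)) (at t)"
      using y Y T that unfolding solves_def by auto
    then show "(w has_real_derivative w1 t) (at t)" "(w1 has_real_derivative w2 t) (at t)"
      unfolding w_def w1_def w2_def using DERIV_diff by fastforce+
  qed
  have wpos: "0 < w t" if "T \<le> t" "t \<le> b" for t using yY that unfolding w_def by simp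
  have w2le: "w2 t \<le> - a t * w t" if t: "T \<le> t" "t \<le> b" for t
  proof -
    have "exp (- 2 * t) * (f (y t) * g1 (y t) * (Y t - y t)) \<le> exp (- 2 * t) * (f (Y t) - f (y t))"
      using f_convex[of "y t" "Y t"] My yY t by (intro mult_left_mono) (auto simp: less_imp_le)
    then show ?thesis unfolding w2_def a_def w_def by (simp add: algebra_simps)
  qed
  have apos: "0 \<le> a t" if "T \<le> t" "t \<le> b" for t
    unfolding a_def using g1_pos[of "y t"] My[OF that] f_nonneg by simp
  have w2neg: "w2 t \<le> 0" if "T \<le> t" "t \<le> b" for t
  proof -
    have "0 \<le> a t * w t" using apos[OF that] wpos[OF that] by simp
    then show ?thesis using w2le[OF that] by linarith
  qed
  have w1mono: "w1 t \<le> w1 s" if "T \<le> s" "s \<le> t" "t \<le> b" for s t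
    by (rule DERIV_nonpos_imp_ge[OF that(2), where f' = w2]) (use wd w2neg that in auto)
  define z where "z t = w1 t / w t" for t
  \<comment> \<open>\<open>w\<close> is positive and concave, so at distance 1 from either end of
    the interval \<open>w1 / w\<close> is confined: at most 1 at \<open>T + 1\<close> and at least
    -1 at \<open>b - 1\<close>. Hence the unit margins at which \<open>F\<close> is
    compared.\<close>
  have z_upper: "z (T + 1) \<le> 1"
  proof -
    have "w T - w1 (T + 1) * T \<le> w (T + 1) - w1 (T + 1) * (T + 1)"
      by (rule DERIV_nonneg_imp_le[where f = "\<lambda>t. w t - w1 (T + 1) * t"
             and f' = "\<lambda>t. w1 t - w1 (T + 1)"])
         (use T w1mono in \<open>auto intro!: derivative_eq_intros wd\<close>)
    then have "w1 (T + 1) \<le> w (T + 1)" using wpos[of T] T by (simp add: algebra_simps)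
    then show ?thesis unfolding z_def using wpos[of "T + 1"] T by simp
  qed
  have z_lower: "- 1 \<le> z (b - 1)"
  proof -
    have "w b - w1 (b - 1) * b \<le> w (b - 1) - w1 (b - 1) * (b - 1)"
      by (rule DERIV_nonpos_imp_ge[where f = "\<lambda>t. w t - w1 (b - 1) * t"
             and f' = "\<lambda>t. w1 t - w1 (b - 1)"])
         (use T w1mono in \<open>auto intro!: derivative_eq_intros wd\<close>)
    then have "- w (b - 1) \<le> w1 (b - 1)" using wpos[of b] T by (simp add: algebra_simps)
    then show ?thesis unfolding z_def using wpos[of "b - 1"] T by (simp add: pos_le_divide_eq)
  qed
  define F where "F t = z t - g1 (y t) * y1 t + k / 2 * (2 * ln (g (y t)) - ln t)" for t
  define F' where "F' t = (w2 t * w t - w1 t * w1 t) / (w t * w t)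
      - (g2 (y t) * y1 t * y1 t + g1 (y t) * (- exp (- 2 * t) * f (y t)))
      + k / 2 * (2 * (g1 (y t) * y1 t / g (y t)) - 1 / t)" for t
  have "F (b - 1) \<le> F (T + 1)"
  proof (rule DERIV_nonpos_imp_ge[where f = F and f' = F'])
    show "T + 1 \<le> b - 1" using T by simp
    fix t assume "T + 1 \<le> t" "t \<le> b - 1"
    then have t: "T \<le> t" "t \<le> b" "0 < t" using T by auto
    have d: "(y has_real_derivative y1 t) (at t)"
        "(y1 has_real_derivative - exp (- 2 * t) * f (y t)) (at t)"
      using y T t unfolding solves_def by auto
    have My': "M < y t" using My t by simp
    have gp: "0 < g (y t)" "0 < g1 (y t)" using g_pos g1_pos My' by auto
    have dg: "((\<lambda>s. g (y s)) has_real_derivative g1 (y t) * y1 t) (at t)"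
      using DERIV_chain2[OF g_deriv[of "y t"] d(1)] My' by simp
    have dg1: "((\<lambda>s. g1 (y s)) has_real_derivative g2 (y t) * y1 t) (at t)"
      using DERIV_chain2[OF g1_deriv[of "y t"] d(1)] My' by simp
    show "(F has_real_derivative F' t) (at t)"
      unfolding F_def F'_def z_def
      by (rule derivative_eq_intros dg dg1 d wd refl | (use t gp wpos[of t] in \<open>simp; fail\<close>))+
    define p where "p = g1 (y t) * y1 t"
    have 1: "(w2 t * w t - w1 t * w1 t) / (w t * w t) \<le> - a t"
    proof -
      have "w2 t * w t \<le> (- a t * w t) * w t"
        using w2le[of t] wpos[of t] t by (intro mult_right_mono) auto
      then have "w2 t * w t - w1 t * w1 t \<le> - a t * (w t * w t)"
        using zero_le_square[of "w1 t"] unfolding mult.assoc by linarith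
      then show ?thesis using wpos[of t] t by (simp add: pos_divide_le_eq)
    qed
    have 2: "p\<^sup>2 / (2 * g (y t)) \<le> g2 (y t) * y1 t * y1 t"
    proof -
      have "1 / 2 * (g1 (y t))\<^sup>2 \<le> (1 - \<theta>) * (g1 (y t))\<^sup>2"
        using theta by (intro mult_right_mono) auto
      then have "1 / 2 * (g1 (y t))\<^sup>2 \<le> g (y t) * g2 (y t)" using g2_lower[of "y t"] My' by simp
      then have "(1 / 2 * (g1 (y t))\<^sup>2) * (y1 t)\<^sup>2 \<le> (g (y t) * g2 (y t)) * (y1 t)\<^sup>2"
        by (intro mult_right_mono) auto
      then show ?thesis unfolding p_def using gp
        by (simp add: pos_divide_le_eq power2_eq_square algebra_simps)
    qed
    \<comment> \<open>\<open>p\<close> may be small, so \<open>p^2\<close> is replaced by its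
      tangent \<open>2 * k * p - k^2\<close> at \<open>k\<close>. The resulting lower bound is a
      logarithmic derivative, which is why \<open>F\<close> carries the terms \<open>ln g\<close>
      and \<open>ln t\<close> with these coefficients.\<close>
    have 3: "k * p / g (y t) - k / (2 * t) \<le> p\<^sup>2 / (2 * g (y t))"
    proof -
      have "k * (k * t) \<le> k * g (y t)" using k t by (intro mult_left_mono) auto
      then have "k\<^sup>2 / (2 * g (y t)) \<le> k / (2 * t)"
        using gp t by (simp add: field_simps power2_eq_square)
      moreover have "0 \<le> (p - k)\<^sup>2 / (2 * g (y t))" using gp by simp
      moreover have "(p - k)\<^sup>2 / (2 * g (y t))
          = p\<^sup>2 / (2 * g (y t)) + k\<^sup>2 / (2 * g (y t)) - k * p / g (y t)"
        using gp by (simp add: field_simps power2_eq_square)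
      ultimately show ?thesis by linarith
    qed
    have "F' t = (w2 t * w t - w1 t * w1 t) / (w t * w t) - g2 (y t) * y1 t * y1 t + a t
      + (k * p / g (y t) - k / (2 * t))"
      unfolding F'_def a_def p_def by (simp add: algebra_simps)
    then show "F' t \<le> 0" using 1 2 3 by linarith
  qed
  then have "z (b - 1) - g1 (y (b - 1)) * y1 (b - 1) + k / 2 * (2 * ln (g (y (b - 1))) - ln (b - 1))
    \<le> z (T + 1) - g1 (y (T + 1)) * y1 (T + 1) + k / 2 * (2 * ln (g (y (T + 1))) - ln (T + 1))"
    unfolding F_def .
  moreover have "0 \<le> g1 (y (T + 1)) * y1 (T + 1)"
    using g1_pos[of "y (T + 1)"] My[of "T + 1"] T y unfolding solves_def by (simp add: less_imp_le)
  moreover have "g1 (y (b - 1)) * y1 (b - 1) \<le> 5" using slope T by simp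
  \<comment> \<open>The constant 7 is 1 + 1 from the two bounds on \<open>z\<close> plus 5 from the
    slope bound at \<open>b - 1\<close>.\<close>
  ultimately have "k / 2 * (2 * ln (g (y (b - 1))) - ln (b - 1))
      \<le> 7 + k / 2 * (2 * ln (g (y (T + 1))) - ln (T + 1))"
    using z_upper z_lower by linarith
  moreover have "k / 2 * (2 * (ln k + ln (b - 1)) - ln (b - 1)) \<le> k / 2 * (2 * ln (g (y (b - 1))) - ln (b - 1))"
  proof -
    have "ln (k * (b - 1)) \<le> ln (g (y (b - 1)))" using k(1) k(2)[of "b - 1"] T by (intro ln_mono) auto
    then have "ln k + ln (b - 1) \<le> ln (g (y (b - 1)))" using k T by (simp add: ln_mult)
    then show ?thesis using k by (intro mult_left_mono) auto
  qed
  moreover have "k / 2 * (2 * ln (g (y (T + 1))) - ln (T + 1)) \<le> k / 2 * (2 * (ln 3 + ln (T + 1)) - ln (T + 1))"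
  proof -
    have "ln (g (y (T + 1))) \<le> ln (3 * (T + 1))"
      using g3[of "T + 1"] T g_pos[of "y (T + 1)"] My[of "T + 1"] by (intro ln_mono) auto
    then have "ln (g (y (T + 1))) \<le> ln 3 + ln (T + 1)" using T by (subst (asm) ln_mult) auto
    then show ?thesis using k by (intro mult_left_mono) auto
  qed
  ultimately have "k / 2 * (2 * (ln k + ln (b - 1)) - ln (b - 1)) \<le> 7 + k / 2 * (2 * (ln 3 + ln (T + 1)) - ln (T + 1))"
    by linarith
  then have "k / 2 * (2 * ln k + ln (b - 1)) \<le> k / 2 * (14 / k + 2 * ln 3 + ln (T + 1))"
    using k by (simp add: algebra_simps)
  then have "2 * ln k + ln (b - 1) \<le> 14 / k + 2 * ln 3 + ln (T + 1)"
    using k mult_le_cancel_left_pos[of "k / 2"] by auto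
  then show ?thesis by simp
qed

text \<open>Says that the boundary terms at infinity in \<open>slope_bound\<close> vanish. Both the
  regular and the singular solutions have this property.\<close>

definition tail :: "(real \<Rightarrow> real) \<Rightarrow> (real \<Rightarrow> real) \<Rightarrow> bool" where
  "tail y y1 \<longleftrightarrow> (y1 \<longlongrightarrow> 0) at_top \<and> ((\<lambda>s. exp (- 2 * s) * f (y s) / g1 (y s)) \<longlongrightarrow> 0) at_top"

text \<open>
  Let \<open>t1\<close> be the first point of \<open>{s..b}\<close> with \<open>exp ((2-c)t) \<le> f(y)\<close>. Between \<open>s\<close> and \<open>t1\<close> the slope of
  \<open>y\<close> is nearly constant, so that \<open>y\<close> stays above \<open>y(t1) - x (g/g')(y(t1))\<close>. If \<open>s\<close> were below
  \<open>E/4 \<cdot> t1\<close>, then \<open>y\<close> would exceed \<open>U\<close> at that point.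
\<close>

lemma lower_growth:
  "\<exists>T1. \<forall>T y y1 U b. T1 \<le> T \<longrightarrow> solves f T0 y y1 \<longrightarrow> T0 < T \<longrightarrow> T \<le> b \<longrightarrow> tail y y1 \<longrightarrow>
     (\<forall>t\<in>{T..b}. y t \<le> U t \<and> M < U t \<and> g (U t) \<le> 3 * t) \<longrightarrow> exp ((2 - c) * b) \<le> f (y b) \<longrightarrow>
     (\<forall>s\<in>{T..b}. M < y s \<and> E * s \<le> g (y s))"
proof -
  obtain C where C: "0 < C" "\<And>s. M \<le> s \<Longrightarrow> g1 s \<le> C * (g s)\<^sup>2" using g1_le_square by blast
  \<comment> \<open>A height above which \<open>v - x * h v\<close> is still above \<open>M\<close>.
    It exists because \<open>h v\<close> is at most \<open>h M + \<theta> * (v - M)\<close> and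
    \<open>\<theta> * x < 1\<close>.\<close>
  define M2 where "M2 = \<bar>M\<bar> + (M + x * h M - x * \<theta> * M) / (1 - \<theta> * x)"
  have M2: "M < v \<and> M < v - x * h v" if "M2 < v" "M < v" for v
  proof -
    have "h v \<le> h M + \<theta> * (v - M)" using h_diff[of M v] that by simp
    then have "x * h v \<le> x * (h M + \<theta> * (v - M))" using x by (intro mult_left_mono) auto
    moreover have "(M + x * h M - x * \<theta> * M) / (1 - \<theta> * x) < v" using that unfolding M2_def by linarith
    then have "M + x * h M - x * \<theta> * M < v * (1 - \<theta> * x)" using x by (simp add: pos_divide_less_eq)
    ultimately show ?thesis using that by (simp add: algebra_simps)
  qed
  obtain B where B: "\<And>u. u \<le> max M M2 \<Longrightarrow> f u \<le> B" using f_bdd by blast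
  \<comment> \<open>Small enough for the final contradiction: at time \<open>e * t1\<close> one
    would get \<open>E * t1\<close> at most \<open>3 * e * t1\<close>, that is, three quarters of
    itself.\<close>
  define e where "e = E / 4"
  have e: "0 < e" "e < 1" unfolding e_def using E_pos E_le1 by auto
  \<comment> \<open>For large \<open>t\<close> this makes the tail
    \<open>exp (- c * \<tau>) / c\<close> smaller than \<open>c / g1 v\<close> for all \<tau> beyond
    \<open>e * t\<close>. The factor \<open>9 * C * t^2\<close> is the bound
    \<open>C * (3 * t)^2\<close> for \<open>g1\<close>.\<close>
  have "((\<lambda>t. exp (- c * (e * t)) * (9 * C * t\<^sup>2)) \<longlongrightarrow> 0) at_top"
    using c e C by real_asymp
  then have "\<forall>\<^sub>F t in at_top. exp (- c * (e * t)) * (9 * C * t\<^sup>2) < c\<^sup>2"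
    using c by (intro order_tendstoD) auto
  moreover have "filterlim (\<lambda>t. exp ((2 - c) * t)) at_top at_top" using c by real_asymp
  then have "\<forall>\<^sub>F t in at_top. B < exp ((2 - c) * t)" by (simp add: filterlim_at_top_dense)
  ultimately obtain T2 where T2: "\<And>t. T2 \<le> t \<Longrightarrow> exp (- c * (e * t)) * (9 * C * t\<^sup>2) < c\<^sup>2"
      "\<And>t. T2 \<le> t \<Longrightarrow> B < exp ((2 - c) * t)"
    unfolding eventually_at_top_linorder by (meson order_trans linear)
  show ?thesis
  proof (intro exI allI impI ballI)
    fix T y y1 U b s
    assume T: "max 1 T2 \<le> T" and sol: "solves f T0 y y1" and "T0 < T" "T \<le> b" and tl: "tail y y1"
      and U: "\<forall>t\<in>{T..b}. y t \<le> U t \<and> M < U t \<and> g (U t) \<le> 3 * t"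
      and bA: "exp ((2 - c) * b) \<le> f (y b)" and s: "s \<in> {T..b}"
    have yd: "(y has_real_derivative y1 t) (at t)"
        "(y1 has_real_derivative - exp (- 2 * t) * f (y t)) (at t)" if "T \<le> t" for t
      using sol \<open>T0 < T\<close> that unfolding solves_def by auto
    define A where "A = {t \<in> {s..b}. exp ((2 - c) * t) \<le> f (y t)}"
    have ycont: "continuous_on {s..b} y"
      using DERIV_isCont[OF yd(1)] s by (intro continuous_at_imp_continuous_on) auto
    have fyc: "continuous_on {s..b} (\<lambda>t. f (y t))"
      by (rule continuous_on_compose2[OF f_cont ycont]) auto
    have "closed A" unfolding A_def
      by (rule continuous_on_closed_Collect_le) (auto intro!: continuous_intros fyc)
    moreover have "b \<in> A" unfolding A_def using bA s by simp
    moreover have "bdd_below A" unfolding A_def by (rule bdd_belowI[of _ s]) auto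
    ultimately have "Inf A \<in> A" using closed_contains_Inf[of A] by blast
    define t1 where "t1 = Inf A"
    have t1: "s \<le> t1" "t1 \<le> b" "exp ((2 - c) * t1) \<le> f (y t1)"
      using \<open>Inf A \<in> A\<close> unfolding t1_def A_def by auto
    have below: "f (y t) < exp ((2 - c) * t)" if "s \<le> t" "t < t1" for t
      using cInf_lower[of t A] \<open>bdd_below A\<close> that t1 unfolding t1_def A_def by force
    define v where "v = y t1"
    have t1T: "T \<le> t1" "0 < t1" using t1 s T by auto
    \<comment> \<open>As \<open>f\<close> is at most \<open>B\<close> up to \<open>max M M2\<close>,
      a larger value of \<open>f\<close> forces \<open>v\<close> beyond both thresholds.\<close>
    have "B < f v" unfolding v_def using t1(3) T2(2)[of t1] t1T T by linarith
    then have v: "M < v" "M2 < v" using B[of v] by force+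
    have tv: "(2 - c) * t1 \<le> g v" using t1(3) f_exp[of v] v unfolding v_def[symmetric] by simp
    have g3: "g v \<le> 3 * t1"
    proof -
      have "y t1 \<le> U t1" "g (U t1) \<le> 3 * t1" using U t1 t1T by auto
      then show ?thesis using g_mono[of v "U t1"] v unfolding v_def by simp
    qed
    have slope: "y1 t1 \<le> (4 + c) / g1 v"
      unfolding v_def using slope_bound[OF sol] tl v t1T \<open>T0 < T\<close> unfolding tail_def v_def by auto
    have g1v: "0 < g1 v" using g1_pos v by simp
    have claim: "M < y r \<and> E * g v \<le> g (y r)" if r: "s \<le> r" "e * t1 \<le> r" "r \<le> t1" for r
    proof -
      have small: "exp (- c * \<tau>) / c \<le> c / g1 v" if "r \<le> \<tau>" for \<tau>
      proof -
        have "g1 v \<le> C * (g v)\<^sup>2" using C v by simp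
        also have "\<dots> \<le> C * (3 * t1)\<^sup>2" using C g3 g_pos[of v] v by (intro mult_left_mono power_mono) auto
        finally have "g1 v \<le> 9 * C * t1\<^sup>2" by (simp add: power2_eq_square algebra_simps)
        moreover have "exp (- c * \<tau>) \<le> exp (- c * (e * t1))" using c that r by simp
        ultimately have "exp (- c * \<tau>) * g1 v \<le> exp (- c * (e * t1)) * (9 * C * t1\<^sup>2)"
          using g1v by (intro mult_mono) auto
        also have "\<dots> < c\<^sup>2" using T2(1)[of t1] t1T T by simp
        finally show ?thesis using c g1v by (simp add: field_simps power2_eq_square)
      qed
      have sl: "y1 \<tau> \<le> (4 + 2 * c) / g1 v" if \<tau>: "r \<le> \<tau>" "\<tau> \<le> t1" for \<tau>
      proof -
        \<comment> \<open>Before \<open>t1\<close> the force \<open>exp (-2t) f(y)\<close> is below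
          \<open>exp (-c t)\<close>, so the slope can exceed its value at \<open>t1\<close> only by
          the integral of this exponential.\<close>
        have "y1 \<tau> - exp (- c * \<tau>) / c \<le> y1 t1 - exp (- c * t1) / c"
        proof (rule DERIV_nonneg_imp_le_open[OF \<tau>(2), where f = "\<lambda>t. y1 t - exp (- c * t) / c" and f' =
              "\<lambda>t. - exp (- 2 * t) * f (y t) + exp (- c * t)"])
          have d: "((\<lambda>t. y1 t - exp (- c * t) / c) has_real_derivative
              - exp (- 2 * t) * f (y t) + exp (- c * t)) (at t)" if "T \<le> t" for t
            using c yd(2)[OF that] by (auto intro!: derivative_eq_intros)
          show "continuous_on {\<tau>..t1} (\<lambda>t. y1 t - exp (- c * t) / c)"
            using DERIV_isCont[OF d] \<tau> r s by (intro continuous_at_imp_continuous_on) auto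
          fix t assume t: "\<tau> < t" "t < t1"
          show "((\<lambda>t. y1 t - exp (- c * t) / c) has_real_derivative
              - exp (- 2 * t) * f (y t) + exp (- c * t)) (at t)" using d t \<tau> r s by simp
          have "exp (- 2 * t) * f (y t) \<le> exp (- 2 * t) * exp ((2 - c) * t)"
            using below[of t] t \<tau> r by (intro mult_left_mono) auto
          also have "\<dots> = exp (- c * t)" by (simp add: exp_add[symmetric] algebra_simps)
          finally show "0 \<le> - exp (- 2 * t) * f (y t) + exp (- c * t)" by simp
        qed
        moreover have "0 \<le> exp (- c * t1) / c" using c by simp
        ultimately have "y1 \<tau> \<le> y1 t1 + exp (- c * \<tau>) / c" by linarith
        also have "\<dots> \<le> (4 + c) / g1 v + c / g1 v" using slope small[OF \<tau>(1)] by linarith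
        also have "\<dots> = (4 + 2 * c) / g1 v" by (simp add: add_divide_distrib)
        finally show ?thesis .
      qed
      define K where "K = (4 + 2 * c) / g1 v"
      have "y t1 - K * t1 \<le> y r - K * r"
        by (rule DERIV_nonpos_imp_ge[OF r(3), where f' = "\<lambda>t. y1 t - K"])
           (use sl[folded K_def] yd(1) r s in \<open>auto intro!: derivative_eq_intros\<close>)
      then have "v - K * (t1 - r) \<le> y r" unfolding v_def by (simp add: algebra_simps)
      \<comment> \<open>The elapsed time is at most \<open>t1\<close>, hence at most
        \<open>g v / (2 - c)\<close>. With slope \<open>(4 + 2 * c) / g1 v\<close> the drop is a
        multiple of \<open>h v\<close> with factor close to 4/2 = 2, and \<open>c\<close> was chosen
        to keep this factor below \<open>x\<close>.\<close>
      moreover have "K * (t1 - r) \<le> x * h v"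
      proof -
        have "0 \<le> r" using r s T by auto
        have "K * (t1 - r) \<le> K * (g v / (2 - c))"
        proof (rule mult_left_mono)
          have "t1 \<le> g v / (2 - c)" using tv c by (simp add: pos_le_divide_eq mult.commute)
          then show "t1 - r \<le> g v / (2 - c)" using \<open>0 \<le> r\<close> by simp
          show "0 \<le> K" unfolding K_def using c g1v by simp
        qed
        also have "\<dots> = (4 + 2 * c) / (2 - c) * h v" unfolding K_def h_def by simp
        also have "\<dots> \<le> x * h v" using c h_pos[of v] v
          by (intro mult_right_mono) (auto simp: pos_divide_le_eq)
        finally show ?thesis .
      qed
      ultimately have yr: "v - x * h v \<le> y r" by linarith
      then have "M < y r" using M2 v by fastforce
      moreover have "y r \<le> v" unfolding v_def using solves_mono[OF sol] r s \<open>T0 < T\<close> by auto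
      ultimately show ?thesis using g_lower[of "y r" v] yr by simp
    qed
    have Et: "E * t1 \<le> E * g v"
    proof -
      have "1 * t1 \<le> (2 - c) * t1" using c t1T by (intro mult_right_mono) auto
      then show ?thesis using tv E_pos by simp
    qed
    \<comment> \<open>\<open>claim\<close> is available only to the right of \<open>e * t1\<close>.
      If \<open>s\<close> were not, the claim at \<open>e * t1\<close> itself would give a
      \<open>y\<close> too high to lie below \<open>U\<close>, whose \<open>g\<close> is at most
      \<open>3 * e * t1\<close> there.\<close>
    have "e * t1 < s"
    proof (rule ccontr)
      assume n: "\<not> e * t1 < s"
      have e1: "e * t1 \<le> t1" using e t1T by simp
      have "M < y (e * t1)" "E * g v \<le> g (y (e * t1))" using claim[of "e * t1"] n e1 by auto
      moreover have "y (e * t1) \<le> U (e * t1)" "g (U (e * t1)) \<le> 3 * (e * t1)"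
        using U n e1 t1 s by auto
      ultimately have "E * t1 \<le> 3 * (e * t1)" using Et g_mono[of "y (e * t1)" "U (e * t1)"] by linarith
      then show False using E_pos t1T unfolding e_def by simp
    qed
    then have "M < y s \<and> E * g v \<le> g (y s)" using claim[of s] t1 by simp
    moreover have "E * s \<le> E * t1" using E_pos t1 by simp
    ultimately show "M < y s \<and> E * s \<le> g (y s)" using Et by linarith
  qed
qed

text \<open>Otherwise \<open>exp (-2t) f(y)\<close> stays below \<open>exp (-c t)\<close> from
  \<open>g \<gamma> / 2\<close> on. Integrating twice from infinity keeps \<open>y\<close> so close
  to \<gamma> that \<open>g (y)\<close> is at least \<open>g \<gamma> - 1\<close> at that time,
  which exceeds \<open>(2 - c) * g \<gamma> / 2\<close> for large \<gamma>. The point found is where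
  the search for zeros starts.\<close>

lemma first_height:
  "\<exists>G. \<forall>\<gamma>\<ge>G. \<forall>y y1. solves f T0 y y1 \<longrightarrow> (y \<longlongrightarrow> \<gamma>) at_top \<longrightarrow> (y1 \<longlongrightarrow> 0) at_top \<longrightarrow>
     (\<exists>t\<ge>g \<gamma> / 2. exp ((2 - c) * t) \<le> f (y t))"
proof -
  obtain C where C: "0 < C" "\<And>s. M \<le> s \<Longrightarrow> g1 s \<le> C * (g s)\<^sup>2" using g1_le_square by blast
  have "((\<lambda>s. C * s\<^sup>2 * (exp (- c * (s / 2)) / c\<^sup>2)) \<longlongrightarrow> 0) at_top" using c C by real_asymp
  then have "\<forall>\<^sub>F s in at_top. C * s\<^sup>2 * (exp (- c * (s / 2)) / c\<^sup>2) < 1"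
    by (intro order_tendstoD) auto
  then have ev1: "\<forall>\<^sub>F \<gamma> in at_top. C * (g \<gamma>)\<^sup>2 * (exp (- c * (g \<gamma> / 2)) / c\<^sup>2) < 1"
    using g_at_top by (rule eventually_compose_filterlim)
  have ev2: "\<forall>\<^sub>F \<gamma> in at_top. max (2 / c) (2 * \<bar>T0\<bar> + 2) < g \<gamma>"
    using g_at_top unfolding filterlim_at_top_dense by blast
  have ev3: "\<forall>\<^sub>F \<gamma> in at_top. M + 1 + 1 / c\<^sup>2 < \<gamma>" by (rule eventually_gt_at_top)
  obtain G where G: "\<And>\<gamma>. G \<le> \<gamma> \<Longrightarrow> C * (g \<gamma>)\<^sup>2 * (exp (- c * (g \<gamma> / 2)) / c\<^sup>2) < 1 \<and>
      max (2 / c) (2 * \<bar>T0\<bar> + 2) < g \<gamma> \<and> M + 1 + 1 / c\<^sup>2 < \<gamma>"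
    using eventually_conj[OF ev1 eventually_conj[OF ev2 ev3]]
    unfolding eventually_at_top_linorder by blast
  show ?thesis
  proof (rule exI[of _ G], intro allI impI, rule ccontr)
    fix \<gamma> y y1
    assume "G \<le> \<gamma>" and sol: "solves f T0 y y1" and lim: "(y \<longlongrightarrow> \<gamma>) at_top" "(y1 \<longlongrightarrow> 0) at_top"
      and no: "\<not> (\<exists>t\<ge>g \<gamma> / 2. exp ((2 - c) * t) \<le> f (y t))"
    note G = G[OF \<open>G \<le> \<gamma>\<close>]
    \<comment> \<open>The time with \<open>exp (2 * \<tau>) = f \<gamma>\<close>.\<close>
    define \<tau> where "\<tau> = g \<gamma> / 2"
    have \<tau>: "T0 < \<tau>" "0 < \<tau>" using G unfolding \<tau>_def by auto
    have yd: "(y has_real_derivative y1 t) (at t)"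
        "(y1 has_real_derivative - exp (- 2 * t) * f (y t)) (at t)" if "\<tau> \<le> t" for t
      using sol \<tau> that unfolding solves_def by auto
    have y1le: "y1 t - exp (- c * t) / c \<le> 0" if t: "\<tau> \<le> t" for t
    proof (rule nondecreasing_tendsto_le[where F = "\<lambda>t. y1 t - exp (- c * t) / c"])
      have "((\<lambda>t. exp (- c * t) / c) \<longlongrightarrow> 0) at_top" using c by real_asymp
      from tendsto_diff[OF lim(2) this] show "((\<lambda>t. y1 t - exp (- c * t) / c) \<longlongrightarrow> 0) at_top" by simp
      fix s assume s: "t \<le> s"
      show "y1 t - exp (- c * t) / c \<le> y1 s - exp (- c * s) / c"
      proof (rule DERIV_nonneg_imp_le[OF s, where f = "\<lambda>t. y1 t - exp (- c * t) / c" and f' = "\<lambda>t. - exp (- 2 * t) * f (y t) + exp (- c * t)"])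
        fix r assume r: "t \<le> r"
        show "((\<lambda>t. y1 t - exp (- c * t) / c) has_real_derivative
              - exp (- 2 * r) * f (y r) + exp (- c * r)) (at r)"
          using c yd(2)[of r] r t by (auto intro!: derivative_eq_intros)
        have "g \<gamma> / 2 \<le> r" using r t unfolding \<tau>_def by simp
        then have "f (y r) < exp ((2 - c) * r)" using no by (meson not_le)
        then have "exp (- 2 * r) * f (y r) \<le> exp (- 2 * r) * exp ((2 - c) * r)"
          by (intro mult_left_mono) auto
        also have "\<dots> = exp (- c * r)" by (simp add: exp_add[symmetric] algebra_simps)
        finally show "0 \<le> - exp (- 2 * r) * f (y r) + exp (- c * r)" by simp
      qed
    qed
    have yt: "\<gamma> \<le> y \<tau> + exp (- c * \<tau>) / c\<^sup>2"
    proof (rule nonincreasing_tendsto_ge[where F = "\<lambda>t. y t + exp (- c * t) / c\<^sup>2"])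
      have "((\<lambda>t. exp (- c * t) / c\<^sup>2) \<longlongrightarrow> 0) at_top" using c by real_asymp
      from tendsto_add[OF lim(1) this] show "((\<lambda>t. y t + exp (- c * t) / c\<^sup>2) \<longlongrightarrow> \<gamma>) at_top" by simp
      fix s assume s: "\<tau> \<le> s"
      show "y s + exp (- c * s) / c\<^sup>2 \<le> y \<tau> + exp (- c * \<tau>) / c\<^sup>2"
        by (rule DERIV_nonpos_imp_ge[OF s, where f = "\<lambda>t. y t + exp (- c * t) / c\<^sup>2"
              and f' = "\<lambda>t. y1 t - exp (- c * t) / c"])
           (use c yd(1) y1le in \<open>auto intro!: derivative_eq_intros simp: power2_eq_square\<close>)
    qed
    have "exp (- c * \<tau>) \<le> 1" using c \<tau> by simp
    then have d1: "exp (- c * \<tau>) / c\<^sup>2 \<le> 1 / c\<^sup>2" by (intro divide_right_mono) auto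
    define u where "u = \<gamma> - exp (- c * \<tau>) / c\<^sup>2"
    have u: "M < u" "u \<le> \<gamma>" unfolding u_def using d1 G c by auto
    have uy: "u \<le> y \<tau>" using yt unfolding u_def by simp
    \<comment> \<open>A small change of the argument could be a large change of \<open>g\<close>.
      The quadratic bound on \<open>g1\<close> makes the exponentially small distance
      \<open>\<gamma> - u\<close> win.\<close>
    have "g \<gamma> - g u \<le> g1 \<gamma> * (\<gamma> - u)" using g_tangent[of u \<gamma>] u by simp
    also have "\<dots> \<le> C * (g \<gamma>)\<^sup>2 * (exp (- c * (g \<gamma> / 2)) / c\<^sup>2)"
      unfolding u_def \<tau>_def using C(2)[of \<gamma>] u c
      by (simp only: diff_diff_eq2 diff_add_cancel add_diff_cancel_left') (auto intro!: divide_right_mono mult_right_mono)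
    also have "\<dots> < 1" using G by simp
    finally have "g \<gamma> - 1 < g u" by simp
    moreover have "g u \<le> g (y \<tau>)" using g_mono u uy by simp
    moreover have "(2 - c) * \<tau> \<le> g \<gamma> - 1"
    proof -
      have "2 < c * g \<gamma>" using G c by (simp add: pos_divide_less_eq mult.commute)
      moreover have "(2 - c) * \<tau> = g \<gamma> - c * g \<gamma> / 2" unfolding \<tau>_def by (simp add: field_simps)
      ultimately show ?thesis by linarith
    qed
    ultimately have "(2 - c) * \<tau> \<le> g (y \<tau>)" by linarith
    then have "exp ((2 - c) * \<tau>) \<le> f (y \<tau>)" using f_exp[of "y \<tau>"] u uy by simp
    then show False using no unfolding \<tau>_def by blast
  qed
qed

end

section \<open>Zeros of the difference between regular and singular solutions\<close>

definition regular :: "(real \<Rightarrow> real) \<Rightarrow> real \<Rightarrow> real \<Rightarrow> (real \<Rightarrow> real) \<Rightarrow> (real \<Rightarrow> real) \<Rightarrow> bool" where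
  "regular f T0 \<gamma> y y1 \<longleftrightarrow> solves f T0 y y1 \<and> (y \<longlongrightarrow> \<gamma>) at_top \<and> (y1 \<longlongrightarrow> 0) at_top"

lemma IVT_nonzero_sign:
  fixes w :: "real \<Rightarrow> real"
  assumes "continuous_on {a..b} w" "\<And>t. a \<le> t \<Longrightarrow> t \<le> b \<Longrightarrow> w t \<noteq> 0"
    and "a \<le> s" "s \<le> t" "t \<le> b"
  shows "0 < w s \<longleftrightarrow> 0 < w t"
proof -
  have c: "continuous_on {s..t} w" using assms by (auto intro: continuous_on_subset)
  show ?thesis
    using IVT'[of w s 0 t] IVT2'[of w t 0 s] c assms by force
qed

text \<open>The last two assumptions are the halves of condition (C). As \<beta> is arbitrary there,
  \<open>g (U) + ln (g1 (U)) - 2 * t\<close> tends to minus infinity, which is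
  \<open>U_upper\<close> after exponentiation.\<close>

locale singular = growth +
  fixes U U1 :: "real \<Rightarrow> real" and T0 :: real
  assumes U_sol: "solves f T0 U U1"
    and U_top: "filterlim U at_top at_top"
    and U_lower: "\<And>\<alpha>. 0 < \<alpha> \<Longrightarrow> \<alpha> < 2 \<Longrightarrow> \<forall>\<^sub>F t in at_top. \<alpha> * t \<le> g (U t)"
    and U_upper: "((\<lambda>t. exp (- 2 * t) * f (U t) * g1 (U t)) \<longlongrightarrow> 0) at_top"
begin

lemma U_eventually: "\<forall>\<^sub>F t in at_top. M < U t \<and> t \<le> g (U t) \<and> (2 - c) * t \<le> g (U t) \<and> g (U t) \<le> 3 * t"
proof -
  have 1: "\<forall>\<^sub>F t in at_top. M < U t" using U_top unfolding filterlim_at_top_dense by blast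
  have 2: "\<forall>\<^sub>F t in at_top. exp (- 2 * t) * f (U t) * g1 (U t) < 1"
    using U_upper by (rule order_tendstoD) simp
  have 3: "\<forall>\<^sub>F t in at_top. \<bar>ln (g1 M)\<bar> < t" by (rule eventually_gt_at_top)
  have 4: "\<forall>\<^sub>F t in at_top. g (U t) \<le> 3 * t"
    using 1 2 3
  proof eventually_elim
    case (elim t)
    \<comment> \<open>The factor \<open>g1 (U t)\<close> is bounded below by \<open>g1 M\<close>;
      the room between 2 and 3 takes up the constant \<open>ln (g1 M)\<close> for large
      \<open>t\<close>.\<close>
    have "exp (- 2 * t + g (U t)) * exp (ln (g1 M)) \<le> exp (- 2 * t) * f (U t) * g1 (U t)"
      unfolding exp_add using elim f_exp[of "U t"] g1_mono[of M "U t"] g1_pos[of M]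
      by (auto intro!: mult_left_mono)
    then have "exp (- 2 * t + g (U t) + ln (g1 M)) < exp 0" using elim by (simp add: exp_add)
    then have "- 2 * t + g (U t) + ln (g1 M) < 0" unfolding exp_less_cancel_iff .
    then show ?case using elim by linarith
  qed
  show ?thesis
    using 1 4 U_lower[of 1] U_lower[of "2 - c"] c by (simp add: eventually_conj_iff)
qed

text \<open>\<open>U1\<close> is positive and nonincreasing. If it stayed above some
  \<open>e > 0\<close>, then, since \<open>g1 (U)\<close> tends to infinity, \<open>g (U)\<close>
  would eventually grow with slope at least 4, contradicting the bound \<open>3 * t\<close>.\<close>

lemma U1_tendsto: "(U1 \<longlongrightarrow> 0) at_top"
proof -
  have Ud: "(U has_real_derivative U1 t) (at t)" "0 < U1 t"
     "(U1 has_real_derivative - exp (- 2 * t) * f (U t)) (at t)" if "T0 < t" for t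
    using U_sol that unfolding solves_def by auto
  have mono: "U1 t \<le> U1 s" if "T0 < s" "s \<le> t" for s t
    by (rule DERIV_nonpos_imp_ge[OF that(2), where f' = "\<lambda>t. - exp (- 2 * t) * f (U t)"])
       (use Ud that f_nonneg in auto)
  have ex: "\<exists>a>T0. U1 a < e" if e: "0 < e" for e
  proof (rule ccontr)
    assume "\<not> (\<exists>a>T0. U1 a < e)"
    then have ge: "e \<le> U1 t" if "T0 < t" for t using that by force
    have ev1: "\<forall>\<^sub>F t in at_top. 4 / e < g1 (U t)"
      using filterlim_compose[OF g1_at_top U_top] unfolding filterlim_at_top_dense by blast
    obtain a where a: "\<And>t. a \<le> t \<Longrightarrow> T0 < t \<and> M < U t \<and> g (U t) \<le> 3 * t \<and> 4 / e < g1 (U t)"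
      using eventually_conj[OF eventually_gt_at_top[of T0] eventually_conj[OF U_eventually ev1]]
      unfolding eventually_at_top_linorder by blast
    have le: "4 * t + (g (U a) - 4 * a) \<le> 3 * t" if t: "a \<le> t" for t
    proof -
      have "g (U a) - 4 * a \<le> g (U t) - 4 * t"
      proof (rule DERIV_nonneg_imp_le[OF t, where f = "\<lambda>t. g (U t) - 4 * t"
            and f' = "\<lambda>t. g1 (U t) * U1 t - 4"])
        fix s assume s: "a \<le> s"
        show "((\<lambda>t. g (U t) - 4 * t) has_real_derivative g1 (U s) * U1 s - 4) (at s)"
          using DERIV_chain2[OF g_deriv Ud(1), of s] a[OF s] by (auto intro!: derivative_eq_intros)
        have "4 / e * e \<le> g1 (U s) * U1 s" using a[OF s] ge[of s] e g1_pos[of "U s"] by (intro mult_mono) (auto simp: less_imp_le)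
        then show "0 \<le> g1 (U s) * U1 s - 4" using e by simp
      qed
      then show ?thesis using a[OF t] by linarith
    qed
    define t where "t = max a (\<bar>g (U a) - 4 * a\<bar> + 1)"
    have "a \<le> t" "\<bar>g (U a) - 4 * a\<bar> < t" unfolding t_def by auto
    moreover have "4 * t + (g (U a) - 4 * a) \<le> 3 * t" by (rule le) fact
    ultimately show False by linarith
  qed
  show ?thesis
  proof (rule tendstoI)
    fix e :: real assume "0 < e"
    then obtain a where a: "T0 < a" "U1 a < e" using ex by blast
    show "\<forall>\<^sub>F t in at_top. dist (U1 t) 0 < e"
    proof (rule eventually_at_top_linorderI[of a])
      fix t assume "a \<le> t"
      then show "dist (U1 t) 0 < e" using a mono[of a t] Ud(2)[of t] by simp
    qed
  qed
qed

text \<open>Since \<open>g1 (U)\<close> is bounded away from 0, dividing by it is, up to a constant,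
  no larger than multiplying by it, and \<open>U_upper\<close> applies.\<close>

lemma tail_U: "tail U U1"
proof -
  have "((\<lambda>s. exp (- 2 * s) * f (U s) / g1 (U s)) \<longlongrightarrow> 0) at_top"
  proof (rule tendsto_sandwich[OF _ _ tendsto_const])
    have ev: "\<forall>\<^sub>F t in at_top. M < U t" using U_top unfolding filterlim_at_top_dense by blast
    show "\<forall>\<^sub>F t in at_top. 0 \<le> exp (- 2 * t) * f (U t) / g1 (U t)"
      using ev by eventually_elim (use f_nonneg g1_pos in \<open>simp add: less_imp_le\<close>)
    have "((\<lambda>t. exp (- 2 * t) * f (U t) * g1 (U t) / (g1 M)\<^sup>2) \<longlongrightarrow> 0 / (g1 M)\<^sup>2) at_top"
      by (intro tendsto_intros U_upper) (use g1_pos[of M] in auto)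
    then show "((\<lambda>t. exp (- 2 * t) * f (U t) * g1 (U t) / (g1 M)\<^sup>2) \<longlongrightarrow> 0) at_top" by simp
    show "\<forall>\<^sub>F t in at_top. exp (- 2 * t) * f (U t) / g1 (U t)
        \<le> exp (- 2 * t) * f (U t) * g1 (U t) / (g1 M)\<^sup>2"
      using ev
    proof eventually_elim
      case (elim t)
      have g: "0 < g1 M" "g1 M \<le> g1 (U t)" using g1_pos g1_mono elim by auto
      have "exp (- 2 * t) * f (U t) * (1 / g1 (U t)) \<le> exp (- 2 * t) * f (U t) * (g1 (U t) / (g1 M)\<^sup>2)"
      proof (rule mult_left_mono)
        have "(g1 M)\<^sup>2 \<le> g1 (U t) * g1 (U t)" unfolding power2_eq_square using g by (intro mult_mono) auto
        then show "1 / g1 (U t) \<le> g1 (U t) / (g1 M)\<^sup>2" using g by (simp add: field_simps)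
      qed (use f_nonneg in auto)
      then show ?case by simp
    qed
  qed
  then show ?thesis unfolding tail_def using U1_tendsto by simp
qed

lemma tail_regular:
  assumes "regular f T0 \<gamma> y y1" "M < \<gamma>"
  shows "tail y y1"
proof -
  have y: "(y \<longlongrightarrow> \<gamma>) at_top" "(y1 \<longlongrightarrow> 0) at_top" using assms unfolding regular_def by auto
  have "isCont f \<gamma>" "isCont g1 \<gamma>"
    using DERIV_isCont[OF f_deriv] DERIV_isCont[OF g1_deriv] assms(2) by auto
  then have "((\<lambda>s. exp (- 2 * s) * f (y s) / g1 (y s)) \<longlongrightarrow> 0 * f \<gamma> / g1 \<gamma>) at_top"
    using g1_pos[of \<gamma>] assms(2)
    by (intro tendsto_intros isCont_tendsto_compose[OF _ y(1)]) (auto, real_asymp)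
  then show ?thesis unfolding tail_def using y by simp
qed

lemma slope_bound_tail:
  assumes "solves f T0 y y1" "tail y y1" "T0 < t" "M < y t"
  shows "g1 (y t) * y1 t \<le> 5"
proof -
  have "y1 t \<le> (4 + c) / g1 (y t)" using slope_bound assms unfolding tail_def by blast
  then have "y1 t * g1 (y t) \<le> 4 + c" using g1_pos[of "y t"] assms by (simp add: pos_le_divide_eq)
  then show ?thesis using c by (simp add: mult.commute)
qed

text \<open>The height condition at \<open>b\<close> is what \<open>lower_growth\<close> requires
  when \<open>y\<close> is the lower function. It holds at a late zero of \<open>y - U\<close> and
  at the point supplied by \<open>first_height\<close>. That \<open>T'\<close> does not depend on
  \<gamma> or \<open>y\<close> is what makes the induction on the number of zeros possible.\<close>

lemma no_long_gap:
  "\<exists>T2. \<forall>T\<ge>T2. \<exists>T'\<ge>T. \<forall>\<gamma> y y1 b. regular f T0 \<gamma> y y1 \<longrightarrow> M < \<gamma> \<longrightarrow> T' \<le> b \<longrightarrow>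
     exp ((2 - c) * b) \<le> f (y b) \<longrightarrow> (\<exists>t. T < t \<and> t < b \<and> y t = U t)"
proof -
  obtain T1 where T1: "\<forall>T y y1 U b. T1 \<le> T \<longrightarrow> solves f T0 y y1 \<longrightarrow> T0 < T \<longrightarrow> T \<le> b \<longrightarrow> tail y y1 \<longrightarrow>
     (\<forall>t\<in>{T..b}. y t \<le> U t \<and> M < U t \<and> g (U t) \<le> 3 * t) \<longrightarrow> exp ((2 - c) * b) \<le> f (y b) \<longrightarrow>
     (\<forall>s\<in>{T..b}. M < y s \<and> E * s \<le> g (y s))" by (rule exE[OF lower_growth])
  obtain a where a: "\<And>t. a \<le> t \<Longrightarrow> M < U t \<and> t \<le> g (U t) \<and> (2 - c) * t \<le> g (U t) \<and> g (U t) \<le> 3 * t"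
    using U_eventually unfolding eventually_at_top_linorder by blast
  define T2 where "T2 = max (max T1 a) (max (T0 + 1) 1)"
  show ?thesis
  proof (rule exI[of _ T2], intro allI impI)
    fix T assume "T2 \<le> T"
    then have T: "T1 \<le> T" "a \<le> T" "T0 < T" "1 \<le> T" unfolding T2_def by auto
    \<comment> \<open>The bounds of \<open>sturm_bound\<close> for the two orders:
      \<open>k = E\<close> when \<open>y\<close> is below \<open>U\<close>, \<open>k = 1\<close>
      when \<open>U\<close> is below \<open>y\<close>. The left end is \<open>T + 1\<close>.\<close>
    define K where "K = max (14 / E - 2 * ln E) 14 + 2 * ln 3 + ln (T + 1 + 1)"
    show "\<exists>T'\<ge>T. \<forall>\<gamma> y y1 b. regular f T0 \<gamma> y y1 \<longrightarrow> M < \<gamma> \<longrightarrow> T' \<le> b \<longrightarrow>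
     exp ((2 - c) * b) \<le> f (y b) \<longrightarrow> (\<exists>t. T < t \<and> t < b \<and> y t = U t)"
    \<comment> \<open>The comparison takes place on \<open>{T + 1..b - 1}\<close>, which must have
      length at least 2; the other term ensures \<open>K < ln (b - 2)\<close>.\<close>
    proof (rule exI[of _ "max (T + 4) (exp K + 3)"], intro conjI allI impI, simp, rule ccontr)
      fix \<gamma> y y1 b
      assume reg: "regular f T0 \<gamma> y y1" and \<gamma>: "M < \<gamma>" and b: "max (T + 4) (exp K + 3) \<le> b"
        and bA: "exp ((2 - c) * b) \<le> f (y b)" and no: "\<not> (\<exists>t. T < t \<and> t < b \<and> y t = U t)"
      have sol: "solves f T0 y y1" and tl: "tail y y1"
        using reg tail_regular[OF reg \<gamma>] unfolding regular_def by auto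
      define w where "w t = U t - y t" for t
      have "isCont w t" if "T < t" for t
      proof -
        have "isCont U t" "isCont y t"
          using sol U_sol T that DERIV_isCont unfolding solves_def by (meson less_trans)+
        then show ?thesis unfolding w_def by simp
      qed
      then have wc: "continuous_on {T + 1..b} w"
        by (intro continuous_at_imp_continuous_on) auto
      have wnz: "w t \<noteq> 0" if "T < t" "t < b" for t using no that unfolding w_def by auto
      have sgn: "0 < w s \<longleftrightarrow> 0 < w (T + 1)" if "T + 1 \<le> s" "s < b" for s
        using IVT_nonzero_sign[of "T + 1" s w "T + 1" s] wnz that wc
        by (force intro: continuous_on_subset)
      have big: "K < ln (b - 1 - 1)"
      proof -
        have "exp K < b - 1 - 1" using b by simp
        moreover have "0 < b - 1 - 1" using b T by simp
        ultimately show ?thesis by (metis ln_exp ln_less_cancel_iff exp_gt_zero)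
      qed
      show False
      proof (cases "0 < w (T + 1)")
        case True
        have yU: "y t < U t" if "T + 1 \<le> t" "t < b" for t
          using sgn[OF that] True unfolding w_def by simp
        \<comment> \<open>\<open>b\<close> may itself be a zero, so only the weak inequality holds
          there. It suffices for \<open>lower_growth\<close>; the strict comparison is later made up
          to \<open>b - 1\<close>.\<close>
        have yb: "y b \<le> U b"
        proof (rule ccontr)
          assume "\<not> y b \<le> U b"
          then have "w b < 0" unfolding w_def by simp
          then obtain t where "T + 1 \<le> t" "t \<le> b" "w t = 0"
            using IVT2'[of w b 0 "T + 1"] True wc b by auto
          then show False using wnz[of t] \<open>w b < 0\<close> by (cases "t = b") auto
        qed
        have "\<forall>s\<in>{T + 1..b}. M < y s \<and> E * s \<le> g (y s)"
        proof -
          have "\<forall>t\<in>{T + 1..b}. y t \<le> U t \<and> M < U t \<and> g (U t) \<le> 3 * t"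
          proof
            fix t assume "t \<in> {T + 1..b}"
            then show "y t \<le> U t \<and> M < U t \<and> g (U t) \<le> 3 * t"
              using yU[of t] yb a[of t] T by (cases "t = b") auto
          qed
          then show ?thesis using T1[THEN spec, of "T + 1", THEN spec, of y, THEN spec, of y1,
                THEN spec, of U, THEN spec, of b] sol tl bA T b by auto
        qed
        then have low: "M < y s" "E * s \<le> g (y s)" if "T + 1 \<le> s" "s \<le> b" for s using that by auto
        have "ln (b - 1 - 1) \<le> 14 / E - 2 * ln E + 2 * ln 3 + ln (T + 1 + 1)"
        proof (rule sturm_bound[OF sol U_sol])
          fix t assume t: "T + 1 \<le> t" "t \<le> b - 1"
          show "M < y t" "E * t \<le> g (y t)" using low t by auto
          show "y t < U t" using yU t by simp
          then show "g (y t) \<le> 3 * t" using g_mono[of "y t" "U t"] low(1)[of t] a[of t] T t by auto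
          show "g1 (y t) * y1 t \<le> 5" using slope_bound_tail[OF sol tl, of t] low(1)[of t] t T by simp
        qed (use T b E_pos in auto)
        then show False using big unfolding K_def by linarith
      next
        case False
        have yU: "U t < y t" if "T + 1 \<le> t" "t < b" for t
          using sgn[OF that] False wnz[of t] that unfolding w_def by fastforce
        have "ln (b - 1 - 1) \<le> 14 / 1 - 2 * ln 1 + 2 * ln 3 + ln (T + 1 + 1)"
        proof (rule sturm_bound[OF U_sol sol])
          fix t assume t: "T + 1 \<le> t" "t \<le> b - 1"
          show "M < U t" "1 * t \<le> g (U t)" "g (U t) \<le> 3 * t" using a[of t] T t by auto
          show "U t < y t" using yU t by simp
          show "g1 (U t) * U1 t \<le> 5" using slope_bound_tail[OF U_sol tail_U, of t] a[of t] t T by simp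
        qed (use T b in auto)
        then show False using big unfolding K_def by simp
      qed
    qed
  qed
qed

text \<open>Zeros are collected from right to left. The induction hypothesis is used with a larger
  threshold, so that the \<open>n\<close> zeros found lie so far out that \<open>no_long_gap\<close>
  produces another one between \<open>T\<close> and the leftmost of them.\<close>

theorem many_zeros:
  "\<exists>G. \<forall>\<gamma>\<ge>G. \<forall>y y1. regular f T0 \<gamma> y y1 \<longrightarrow>
     (\<exists>Z. finite Z \<and> card Z = n \<and> Z \<subseteq> {T<..} \<and> (\<forall>t\<in>Z. y t = U t))"
proof (induction n arbitrary: T)
  case 0
  show ?case by (intro exI[of _ 0] allI impI exI[of _ "{}"]) auto
next
  case (Suc n)
  obtain T2 where T2: "\<And>T. T2 \<le> T \<Longrightarrow> \<exists>T'\<ge>T. \<forall>\<gamma> y y1 b. regular f T0 \<gamma> y y1 \<longrightarrow> M < \<gamma> \<longrightarrow> T' \<le> b \<longrightarrow>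
     exp ((2 - c) * b) \<le> f (y b) \<longrightarrow> (\<exists>t. T < t \<and> t < b \<and> y t = U t)" using no_long_gap by blast
  obtain a where a: "\<And>t. a \<le> t \<Longrightarrow> M < U t \<and> t \<le> g (U t) \<and> (2 - c) * t \<le> g (U t) \<and> g (U t) \<le> 3 * t"
    using U_eventually unfolding eventually_at_top_linorder by blast
  obtain T' where T': "max T T2 \<le> T'" "\<And>\<gamma> y y1 b. regular f T0 \<gamma> y y1 \<Longrightarrow> M < \<gamma> \<Longrightarrow> T' \<le> b \<Longrightarrow>
     exp ((2 - c) * b) \<le> f (y b) \<Longrightarrow> (\<exists>t. max T T2 < t \<and> t < b \<and> y t = U t)"
    using T2[of "max T T2"] by (metis max.cobounded2)
  obtain G1 where G1: "\<And>\<gamma> y y1. G1 \<le> \<gamma> \<Longrightarrow> regular f T0 \<gamma> y y1 \<Longrightarrow>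
     (\<exists>Z. finite Z \<and> card Z = n \<and> Z \<subseteq> {max T' a<..} \<and> (\<forall>t\<in>Z. y t = U t))"
    using Suc.IH[of "max T' a"] by blast
  obtain G2 where G2: "\<And>\<gamma> y y1. G2 \<le> \<gamma> \<Longrightarrow> solves f T0 y y1 \<Longrightarrow> (y \<longlongrightarrow> \<gamma>) at_top \<Longrightarrow>
     (y1 \<longlongrightarrow> 0) at_top \<Longrightarrow> (\<exists>t\<ge>g \<gamma> / 2. exp ((2 - c) * t) \<le> f (y t))"
    using first_height by blast
  have "\<forall>\<^sub>F \<gamma> in at_top. 2 * T' < g \<gamma>" using g_at_top unfolding filterlim_at_top_dense by blast
  then obtain G3 where G3: "\<And>\<gamma>. G3 \<le> \<gamma> \<Longrightarrow> 2 * T' < g \<gamma>" unfolding eventually_at_top_linorder by blast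
  show ?case
  proof (rule exI[of _ "max (max G1 G2) (max G3 (M + 1))"], intro allI impI)
    fix \<gamma> y y1
    assume "max (max G1 G2) (max G3 (M + 1)) \<le> \<gamma>" and reg: "regular f T0 \<gamma> y y1"
    then have \<gamma>: "G1 \<le> \<gamma>" "G2 \<le> \<gamma>" "G3 \<le> \<gamma>" "M < \<gamma>" by auto
    obtain Z where Z: "finite Z" "card Z = n" "Z \<subseteq> {max T' a<..}" "\<forall>t\<in>Z. y t = U t"
      using G1[OF \<gamma>(1) reg] by blast
    \<comment> \<open>The leftmost zero qualifies because there \<open>y b = U b\<close>, and (C)
      gives \<open>g (U b)\<close> at least \<open>(2 - c) * b\<close>.\<close>
    have "\<exists>b. T' \<le> b \<and> exp ((2 - c) * b) \<le> f (y b) \<and> (\<forall>t\<in>Z. b \<le> t)"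
    proof (cases "Z = {}")
      case True
      obtain t where "g \<gamma> / 2 \<le> t" "exp ((2 - c) * t) \<le> f (y t)"
        using G2[OF \<gamma>(2)] reg unfolding regular_def by blast
      then show ?thesis using True G3[OF \<gamma>(3)] by (intro exI[of _ t]) auto
    next
      case False
      define b where "b = Min Z"
      have b: "b \<in> Z" "\<forall>t\<in>Z. b \<le> t" unfolding b_def using Z(1) False by auto
      then have "T' \<le> b" "a \<le> b" "y b = U b" using Z by auto
      then show ?thesis using b a[of b] f_exp[of "U b"] by auto
    qed
    then obtain b where b: "T' \<le> b" "exp ((2 - c) * b) \<le> f (y b)" "\<forall>t\<in>Z. b \<le> t" by blast
    then obtain t where t: "max T T2 < t" "t < b" "y t = U t" using T'(2)[OF reg \<gamma>(4)] by blast
    then have "t \<notin> Z" using b by auto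
    then show "\<exists>Z. finite Z \<and> card Z = Suc n \<and> Z \<subseteq> {T<..} \<and> (\<forall>t\<in>Z. y t = U t)"
      using Z t T'(1) by (intro exI[of _ "insert t Z"]) auto
  qed
qed

end

section \<open>Families of functions with simple zeros\<close>

lemma continuous_nonzero_nhd:
  fixes F :: "real \<Rightarrow> real \<Rightarrow> real"
  assumes "continuous_on (S \<times> T) (\<lambda>(\<gamma>, t). F \<gamma> t)" "\<gamma>0 \<in> S" "t0 \<in> T" "F \<gamma>0 t0 \<noteq> 0"
  obtains e where "0 < e"
    "\<And>\<gamma> t. \<gamma> \<in> S \<Longrightarrow> t \<in> T \<Longrightarrow> dist \<gamma> \<gamma>0 < e \<Longrightarrow> dist t t0 < e \<Longrightarrow> 0 < F \<gamma> t * F \<gamma>0 t0"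
proof -
  obtain d where d: "0 < d" "\<And>p. p \<in> S \<times> T \<Longrightarrow> dist p (\<gamma>0, t0) < d \<Longrightarrow>
      dist ((\<lambda>(\<gamma>, t). F \<gamma> t) p) ((\<lambda>(\<gamma>, t). F \<gamma> t) (\<gamma>0, t0)) < \<bar>F \<gamma>0 t0\<bar>"
    using assms unfolding continuous_on_iff by (metis mem_Sigma_iff zero_less_abs_iff)
  show ?thesis
  proof (rule that[of "d / 2"])
    fix \<gamma> t assume *: "\<gamma> \<in> S" "t \<in> T" "dist \<gamma> \<gamma>0 < d / 2" "dist t t0 < d / 2"
    have "dist (\<gamma>, t) (\<gamma>0, t0) \<le> dist \<gamma> \<gamma>0 + dist t t0"
      unfolding dist_Pair_Pair by (rule sqrt_sum_squares_le_sum) auto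
    then have "\<bar>F \<gamma> t - F \<gamma>0 t0\<bar> < \<bar>F \<gamma>0 t0\<bar>" using d(2)[of "(\<gamma>, t)"] * by (simp add: dist_real_def)
    then show "0 < F \<gamma> t * F \<gamma>0 t0" by (auto simp: zero_less_mult_iff abs_if split: if_splits)
  qed (use d in simp)
qed

lemma simple_zero_sign_change:
  fixes F :: "real \<Rightarrow> real"
  assumes "(F has_real_derivative d) (at z)" "d \<noteq> 0" "F z = 0" "0 < r"
  obtains s t where "z - r < s" "s < z" "z < t" "t < z + r" "F s * d < 0" "0 < F t * d"
proof -
  have "((\<lambda>x. F x * d) has_real_derivative d * d) (at z)"
    using assms(1) by (auto intro!: derivative_eq_intros)
  moreover have "0 < d * d" using assms(2) by (metis not_real_square_gt_zero)
  ultimately obtain e1 e2 where e: "0 < e1" "\<And>h. 0 < h \<Longrightarrow> h < e1 \<Longrightarrow> F z * d < F (z + h) * d"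
    "0 < e2" "\<And>h. 0 < h \<Longrightarrow> h < e2 \<Longrightarrow> F (z - h) * d < F z * d"
    using DERIV_pos_inc_left[of "\<lambda>x. F x * d"] DERIV_pos_inc_right[of "\<lambda>x. F x * d"] by metis
  define h where "h = min r (min e1 e2) / 2"
  have h: "0 < h" "h < r" "h < e1" "h < e2" unfolding h_def using e assms(4) by auto
  show ?thesis
    by (rule that[of "z - h" "z + h"]) (use h e assms in auto)
qed

lemma no_zero_same_sign:
  fixes F :: "real \<Rightarrow> real"
  assumes "continuous_on {a..b} F" "a \<le> b" "\<And>t. a \<le> t \<Longrightarrow> t \<le> b \<Longrightarrow> F t \<noteq> 0"
  shows "F a < 0 \<longleftrightarrow> F b < 0"
  using IVT'[of F a 0 b] IVT2'[of F b 0 a] assms by force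

text \<open>The sign changes at each simple zero. Starting from the negative value at
  \<open>b\<close>, the parity of the number of changes determines the sign at \<open>a\<close>; the
  induction removes the smallest zero.\<close>

lemma even_card_zeros:
  fixes F :: "real \<Rightarrow> real"
  assumes "a \<le> b" "continuous_on {a..b} F" "F a \<noteq> 0" "F b < 0" "finite {t \<in> {a..b}. F t = 0}"
    and "\<And>t. a < t \<Longrightarrow> t < b \<Longrightarrow> F t = 0 \<Longrightarrow> \<exists>d. d \<noteq> 0 \<and> (F has_real_derivative d) (at t)"
  shows "even (card {t \<in> {a..b}. F t = 0}) \<longleftrightarrow> F a < 0"
  using assms
proof (induction "card {t \<in> {a..b}. F t = 0}" arbitrary: a)
  case 0
  then have "{t \<in> {a..b}. F t = 0} = {}" by simp
  then have "F t \<noteq> 0" if "a \<le> t" "t \<le> b" for t using that by auto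
  then have "F a < 0 \<longleftrightarrow> F b < 0" using no_zero_same_sign 0 by blast
  then show ?case unfolding 0(1)[symmetric] using 0(5) by simp
next
  case (Suc n)
  define Z where "Z = {t \<in> {a..b}. F t = 0}"
  have Z: "finite Z" "card Z = Suc n" using Suc unfolding Z_def by auto
  then have "Z \<noteq> {}" by auto
  define z where "z = Min Z"
  have z: "z \<in> Z" "\<And>t. t \<in> Z \<Longrightarrow> z \<le> t" unfolding z_def using Z \<open>Z \<noteq> {}\<close> by auto
  then have zab: "a < z" "z < b" "F z = 0"
    using Suc.prems unfolding Z_def by (auto simp: less_le)
  obtain d where d: "d \<noteq> 0" "(F has_real_derivative d) (at z)" using Suc.prems zab by blast
  \<comment> \<open>Half-width of an interval around \<open>z\<close> free of other zeros and of
    \<open>b\<close>, so that \<open>c\<close> lies strictly between \<open>z\<close> and the next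
    zero.\<close>
  define r where "r = Min (insert (b - z) ((\<lambda>t. t - z) ` (Z - {z})))"
  have "0 < r" unfolding r_def using Z z zab by (subst Min_gr_iff) (auto simp: less_le)
  have rle: "r \<le> b - z" "\<And>t. t \<in> Z - {z} \<Longrightarrow> r \<le> t - z" unfolding r_def using Z by auto
  obtain s c where sc: "z - min r (z - a) < s" "s < z" "z < c" "c < z + min r (z - a)" "F s * d < 0" "0 < F c * d"
    using simple_zero_sign_change[OF d(2,1) zab(3), of "min r (z - a)"] \<open>0 < r\<close> zab by auto
  have eq: "{t \<in> {c..b}. F t = 0} = Z - {z}"
  proof
    show "{t \<in> {c..b}. F t = 0} \<subseteq> Z - {z}" using sc zab unfolding Z_def by auto
    show "Z - {z} \<subseteq> {t \<in> {c..b}. F t = 0}"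
    proof
      fix t assume t: "t \<in> Z - {z}"
      then have "c \<le> t" using rle(2)[OF t] sc by linarith
      then show "t \<in> {t \<in> {c..b}. F t = 0}" using t unfolding Z_def by auto
    qed
  qed
  have cardc: "card {t \<in> {c..b}. F t = 0} = n" unfolding eq using Z z by simp
  have "even (card {t \<in> {c..b}. F t = 0}) \<longleftrightarrow> F c < 0"
  proof (rule Suc.hyps(1))
    show "n = card {t \<in> {c..b}. F t = 0}" using cardc by simp
    show "c \<le> b" using sc rle by linarith
    show "continuous_on {c..b} F" using Suc.prems(2) sc zab by (auto intro: continuous_on_subset)
    show "F c \<noteq> 0" using sc by auto
    show "finite {t \<in> {c..b}. F t = 0}" unfolding eq using Z by simp
    show "F b < 0" by fact
    fix t assume "c < t" "t < b" "F t = 0"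
    then show "\<exists>d. d \<noteq> 0 \<and> (F has_real_derivative d) (at t)" using Suc.prems(6) sc zab by auto
  qed
  moreover have "F a < 0 \<longleftrightarrow> F s < 0"
  proof (rule no_zero_same_sign[where F = F and a = a and b = s])
    show as: "a \<le> s" using sc by linarith
    show "continuous_on {a..s} F" using Suc.prems(2) sc zab by (auto intro: continuous_on_subset)
    fix t assume "a \<le> t" "t \<le> s"
    then show "F t \<noteq> 0" using z(2)[of t] sc zab unfolding Z_def by auto
  qed
  moreover have "F s < 0 \<longleftrightarrow> \<not> F c < 0" using sc(5,6) by (auto simp: zero_less_mult_iff mult_less_0_iff)
  ultimately show ?case unfolding Z_def[symmetric] Z(2) cardc by simp
qed

text \<open>The model is \<open>D \<gamma> = y \<gamma> - U\<close>. \<open>D_b\<close> closes the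
  right end, beyond which \<open>U\<close> is larger than every \<gamma> considered; derivatives are
  required only in the interior because \<open>a\<close> will be the image of the boundary
  radius.\<close>

locale simple_zero_family =
  fixes D D1 :: "real \<Rightarrow> real \<Rightarrow> real" and S :: "real set" and a b :: real
  assumes ab: "a < b"
    and D_cont: "continuous_on (S \<times> {a..b}) (\<lambda>(\<gamma>, t). D \<gamma> t)"
    and D1_cont: "continuous_on (S \<times> {a..b}) (\<lambda>(\<gamma>, t). D1 \<gamma> t)"
    and D_deriv: "\<And>\<gamma> t. \<gamma> \<in> S \<Longrightarrow> a < t \<Longrightarrow> t < b \<Longrightarrow> (D \<gamma> has_real_derivative D1 \<gamma> t) (at t)"
    and D_simple: "\<And>\<gamma> t. \<gamma> \<in> S \<Longrightarrow> a \<le> t \<Longrightarrow> t \<le> b \<Longrightarrow> D \<gamma> t = 0 \<Longrightarrow> D1 \<gamma> t \<noteq> 0"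
    and D_b: "\<And>\<gamma>. \<gamma> \<in> S \<Longrightarrow> D \<gamma> b < 0"
begin

definition Z where "Z \<gamma> = {t \<in> {a..b}. D \<gamma> t = 0}"

lemma D_cont_t: "\<gamma> \<in> S \<Longrightarrow> continuous_on {a..b} (D \<gamma>)"
  by (rule continuous_on_compose2[OF D_cont, of _ "\<lambda>t. (\<gamma>, t)", simplified]) (auto intro!: continuous_intros)

text \<open>Every point of \<open>{a..b}\<close> has a neighbourhood on which, for nearby
  parameters, \<open>D\<close> or its derivative does not vanish. By compactness finitely many
  suffice. By Rolle each contains at most one zero if centred at a zero of
  \<open>D \<gamma>0\<close>, and none otherwise. The comparison is conditional because finiteness
  for \<open>\<gamma>0\<close> itself is deduced from this lemma.\<close>

lemma zeros_upper:
  assumes g0: "\<gamma>0 \<in> S"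
  obtains \<delta> where "0 < \<delta>"
    "\<And>\<gamma>. \<gamma> \<in> S \<Longrightarrow> dist \<gamma> \<gamma>0 < \<delta> \<Longrightarrow> finite (Z \<gamma>) \<and> (finite (Z \<gamma>0) \<longrightarrow> card (Z \<gamma>) \<le> card (Z \<gamma>0))"
proof -
  have "\<exists>e>0. \<forall>\<gamma>\<in>S. \<forall>t\<in>{a..b}. dist \<gamma> \<gamma>0 < e \<longrightarrow> dist t t0 < e \<longrightarrow>
      (if D \<gamma>0 t0 = 0 then D1 \<gamma> t \<noteq> 0 else D \<gamma> t \<noteq> 0)" if t0: "t0 \<in> {a..b}" for t0
  proof (cases "D \<gamma>0 t0 = 0")
    case True
    then have "D1 \<gamma>0 t0 \<noteq> 0" using D_simple g0 t0 by auto
    then obtain e where "0 < e"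
      "\<And>\<gamma> t. \<gamma> \<in> S \<Longrightarrow> t \<in> {a..b} \<Longrightarrow> dist \<gamma> \<gamma>0 < e \<Longrightarrow> dist t t0 < e \<Longrightarrow> 0 < D1 \<gamma> t * D1 \<gamma>0 t0"
      using continuous_nonzero_nhd[OF D1_cont g0 t0] by blast
    then show ?thesis using True by (intro exI[of _ e]) force
  next
    case False
    then obtain e where "0 < e"
      "\<And>\<gamma> t. \<gamma> \<in> S \<Longrightarrow> t \<in> {a..b} \<Longrightarrow> dist \<gamma> \<gamma>0 < e \<Longrightarrow> dist t t0 < e \<Longrightarrow> 0 < D \<gamma> t * D \<gamma>0 t0"
      using continuous_nonzero_nhd[OF D_cont g0 t0] by blast
    then show ?thesis using False by (intro exI[of _ e]) force
  qed
  then obtain e where e: "\<And>t0. t0 \<in> {a..b} \<Longrightarrow> 0 < e t0"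
    "\<And>t0 \<gamma> t. t0 \<in> {a..b} \<Longrightarrow> \<gamma> \<in> S \<Longrightarrow> t \<in> {a..b} \<Longrightarrow> dist \<gamma> \<gamma>0 < e t0 \<Longrightarrow> dist t t0 < e t0 \<Longrightarrow>
      (if D \<gamma>0 t0 = 0 then D1 \<gamma> t \<noteq> 0 else D \<gamma> t \<noteq> 0)"
    by metis
  have "{a..b} \<subseteq> (\<Union>t\<in>{a..b}. ball t (e t))" using e(1) by force
  then obtain F where F: "F \<subseteq> {a..b}" "finite F" "{a..b} \<subseteq> (\<Union>t\<in>F. ball t (e t))"
    using compactE_image[of "{a..b}" "{a..b}" "\<lambda>t. ball t (e t)"] by auto
  define \<delta> where "\<delta> = Min (insert 1 (e ` F))"
  have \<delta>: "0 < \<delta>" unfolding \<delta>_def using F e(1) by (subst Min_gr_iff) auto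
  have \<delta>e: "\<delta> \<le> e t" if "t \<in> F" for t unfolding \<delta>_def using F that by auto
  show ?thesis
  proof (rule that[OF \<delta>])
    fix \<gamma> assume \<gamma>: "\<gamma> \<in> S" "dist \<gamma> \<gamma>0 < \<delta>"
    define F0 where "F0 = {t \<in> F. D \<gamma>0 t = 0}"
    have fin: "finite F0" unfolding F0_def using F by simp
    have cover: "Z \<gamma> \<subseteq> (\<Union>t\<in>F0. Z \<gamma> \<inter> ball t (e t))"
    proof
      fix s assume s: "s \<in> Z \<gamma>"
      then have "s \<in> {a..b}" unfolding Z_def by auto
      then obtain t where t: "t \<in> F" "s \<in> ball t (e t)" using F(3) by blast
      have "D \<gamma>0 t = 0"
        using e(2)[of t \<gamma> s] t F(1) \<gamma> \<delta>e[OF t(1)] s unfolding Z_def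
        by (auto simp: dist_commute split: if_splits)
      then show "s \<in> (\<Union>t\<in>F0. Z \<gamma> \<inter> ball t (e t))" unfolding F0_def using t s by blast
    qed
    have one: "s1 = s2" if t: "t \<in> F0" and s: "s1 \<in> Z \<gamma> \<inter> ball t (e t)" "s2 \<in> Z \<gamma> \<inter> ball t (e t)"
      for t s1 s2
    proof -
      have False if s12: "u < v" "u \<in> Z \<gamma> \<inter> ball t (e t)" "v \<in> Z \<gamma> \<inter> ball t (e t)" for u v
      proof -
        have uv: "a \<le> u" "v \<le> b" "D \<gamma> u = 0" "D \<gamma> v = 0" using s12 unfolding Z_def by auto
        have "continuous_on {u..v} (D \<gamma>)" using D_cont_t[OF \<gamma>(1)] uv by (auto intro: continuous_on_subset)
        then obtain w where w: "u < w" "w < v" "(D \<gamma> has_real_derivative 0) (at w)"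
          using Rolle[OF \<open>u < v\<close>, of "D \<gamma>"] uv D_deriv[OF \<gamma>(1)]
          by (metis less_le_trans le_less_trans real_differentiable_def)
        have "D1 \<gamma> w = 0" using DERIV_unique[OF w(3) D_deriv[OF \<gamma>(1), of w]] uv w by auto
        moreover have "dist w t < e t" using s12 w by (auto simp: dist_real_def)
        moreover have "dist \<gamma> \<gamma>0 < e t" using \<gamma> \<delta>e[of t] t unfolding F0_def by simp
        ultimately show False using e(2)[of t \<gamma> w] t F \<gamma> uv w unfolding F0_def by auto
      qed
      then show ?thesis using s by (metis linorder_neqE_linordered_idom)
    qed
    have le1: "finite (Z \<gamma> \<inter> ball t (e t)) \<and> card (Z \<gamma> \<inter> ball t (e t)) \<le> 1" if "t \<in> F0" for t
      using one[OF that] by (metis is_singletonI' is_singleton_altdef card.empty finite.emptyI card_eq_0_iff le_numeral_extra(4) zero_le_one card_ge_0_finite zero_less_one)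
    have finU: "finite (\<Union>t\<in>F0. Z \<gamma> \<inter> ball t (e t))" using fin le1 by blast
    then have "finite (Z \<gamma>)" using cover finite_subset by blast
    moreover have "card (Z \<gamma>) \<le> card (Z \<gamma>0)" if "finite (Z \<gamma>0)"
    proof -
      have "card (Z \<gamma>) \<le> card (\<Union>t\<in>F0. Z \<gamma> \<inter> ball t (e t))" using cover finU by (rule card_mono[rotated])
      also have "\<dots> \<le> (\<Sum>t\<in>F0. card (Z \<gamma> \<inter> ball t (e t)))" by (rule card_UN_le[OF fin])
      also have "\<dots> \<le> (\<Sum>t\<in>F0. 1)" using le1 by (intro sum_mono) auto
      also have "\<dots> = card F0" by simp
      also have "\<dots> \<le> card (Z \<gamma>0)" using F that unfolding F0_def Z_def by (intro card_mono) auto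
      finally show ?thesis .
    qed
    ultimately show "finite (Z \<gamma>) \<and> (finite (Z \<gamma>0) \<longrightarrow> card (Z \<gamma>) \<le> card (Z \<gamma>0))" by blast
  qed
qed

lemma finite_Z: "\<gamma> \<in> S \<Longrightarrow> finite (Z \<gamma>)"
  using zeros_upper[of \<gamma>] by (metis dist_self)

lemma zero_persists:
  assumes g0: "\<gamma>0 \<in> S" and z: "a < z" "z < b" "D \<gamma>0 z = 0" and r: "0 < r"
  shows "\<exists>\<delta>>0. \<forall>\<gamma>\<in>S. dist \<gamma> \<gamma>0 < \<delta> \<longrightarrow> (\<exists>t. a < t \<and> t < b \<and> dist t z < r \<and> D \<gamma> t = 0)"
proof -
  define d where "d = D1 \<gamma>0 z"
  have d: "(D \<gamma>0 has_real_derivative d) (at z)" "d \<noteq> 0"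
    unfolding d_def using D_deriv D_simple g0 z by auto
  obtain s t where st: "z - min r (min (z - a) (b - z)) < s" "s < z" "z < t"
      "t < z + min r (min (z - a) (b - z))" "D \<gamma>0 s * d < 0" "0 < D \<gamma>0 t * d"
    using simple_zero_sign_change[OF d z(3), of "min r (min (z - a) (b - z))"] r z by auto
  have sab: "s \<in> {a..b}" "t \<in> {a..b}" "a < s" "t < b" "z - r < s" "t < z + r" using st z by auto
  have nz: "D \<gamma>0 s \<noteq> 0" "D \<gamma>0 t \<noteq> 0" using st by auto
  obtain e1 where e1: "0 < e1" "\<And>\<gamma> u. \<gamma> \<in> S \<Longrightarrow> u \<in> {a..b} \<Longrightarrow> dist \<gamma> \<gamma>0 < e1 \<Longrightarrow> dist u s < e1 \<Longrightarrow>
      0 < D \<gamma> u * D \<gamma>0 s" using continuous_nonzero_nhd[OF D_cont g0 sab(1) nz(1)] by blast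
  obtain e2 where e2: "0 < e2" "\<And>\<gamma> u. \<gamma> \<in> S \<Longrightarrow> u \<in> {a..b} \<Longrightarrow> dist \<gamma> \<gamma>0 < e2 \<Longrightarrow> dist u t < e2 \<Longrightarrow>
      0 < D \<gamma> u * D \<gamma>0 t" using continuous_nonzero_nhd[OF D_cont g0 sab(2) nz(2)] by blast
  show ?thesis
  proof (rule exI[of _ "min e1 e2"], intro conjI ballI impI)
    fix \<gamma> assume \<gamma>: "\<gamma> \<in> S" "dist \<gamma> \<gamma>0 < min e1 e2"
    have "0 < D \<gamma> s * D \<gamma>0 s" "0 < D \<gamma> t * D \<gamma>0 t" using e1 e2 \<gamma> sab by auto
    then have "(D \<gamma> s < 0 \<and> 0 < D \<gamma> t) \<or> (0 < D \<gamma> s \<and> D \<gamma> t < 0)"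
      using st(5,6) by (auto simp: zero_less_mult_iff mult_less_0_iff)
    moreover have "continuous_on {s..t} (D \<gamma>)" using D_cont_t[OF \<gamma>(1)] sab by (auto intro: continuous_on_subset)
    ultimately obtain u where u: "s \<le> u" "u \<le> t" "D \<gamma> u = 0"
      using IVT'[of "D \<gamma>" s 0 t] IVT2'[of "D \<gamma>" t 0 s] st by force
    show "\<exists>t. a < t \<and> t < b \<and> dist t z < r \<and> D \<gamma> t = 0"
      by (rule exI[of _ u]) (use u st sab in \<open>auto simp: dist_real_def\<close>)
  qed (use e1 e2 in auto)
qed

text \<open>Only zeros in the open interval are sure to persist under small changes of \<gamma>; a
  zero at \<open>a\<close> may be lost.\<close>

definition Zi where "Zi \<gamma> = {t. a < t \<and> t < b \<and> D \<gamma> t = 0}"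

lemma Zi_subset: "Zi \<gamma> \<subseteq> Z \<gamma>" unfolding Zi_def Z_def by auto

lemma finite_Zi: "\<gamma> \<in> S \<Longrightarrow> finite (Zi \<gamma>)"
  using finite_Z Zi_subset finite_subset by blast

text \<open>With a radius of at most half the smallest distance between the zeros for
  \<open>\<gamma>0\<close>, the zeros that persist near different ones are different.\<close>

lemma zeros_lower:
  assumes g0: "\<gamma>0 \<in> S"
  obtains \<delta> where "0 < \<delta>" "\<And>\<gamma>. \<gamma> \<in> S \<Longrightarrow> dist \<gamma> \<gamma>0 < \<delta> \<Longrightarrow> card (Zi \<gamma>0) \<le> card (Zi \<gamma>)"
proof -
  define Z0 where "Z0 = Zi \<gamma>0"
  have fin: "finite Z0" unfolding Z0_def using finite_Zi g0 .
  define P where "P = {p \<in> Z0 \<times> Z0. fst p \<noteq> snd p}"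
  have finP: "finite P" unfolding P_def using fin by simp
  define r where "r = Min (insert 1 ((\<lambda>p. dist (fst p) (snd p)) ` P)) / 2"
  have "0 < Min (insert 1 ((\<lambda>p. dist (fst p) (snd p)) ` P))"
    using finP by (subst Min_gr_iff) (auto simp: P_def)
  then have r: "0 < r" unfolding r_def by simp
  have sep: "2 * r \<le> dist z1 z2" if "z1 \<in> Z0" "z2 \<in> Z0" "z1 \<noteq> z2" for z1 z2
  proof -
    have "Min (insert 1 ((\<lambda>p. dist (fst p) (snd p)) ` P)) \<le> dist (fst (z1, z2)) (snd (z1, z2))"
      using finP that by (intro Min_le) (auto simp: P_def intro!: image_eqI[of _ _ "(z1, z2)"])
    then show ?thesis unfolding r_def by simp
  qed
  have "\<forall>z\<in>Z0. \<exists>\<delta>>0. \<forall>\<gamma>\<in>S. dist \<gamma> \<gamma>0 < \<delta> \<longrightarrow> (\<exists>t. a < t \<and> t < b \<and> dist t z < r \<and> D \<gamma> t = 0)"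
    using zero_persists[OF g0 _ _ _ r] unfolding Z0_def Zi_def by auto
  then obtain dl where dl: "\<And>z. z \<in> Z0 \<Longrightarrow> 0 < dl z" "\<And>z \<gamma>. z \<in> Z0 \<Longrightarrow> \<gamma> \<in> S \<Longrightarrow> dist \<gamma> \<gamma>0 < dl z \<Longrightarrow>
      (\<exists>t. a < t \<and> t < b \<and> dist t z < r \<and> D \<gamma> t = 0)" by metis
  define \<delta> where "\<delta> = Min (insert 1 (dl ` Z0))"
  have \<delta>: "0 < \<delta>" unfolding \<delta>_def using fin dl(1) by (subst Min_gr_iff) auto
  show ?thesis
  proof (rule that[OF \<delta>])
    fix \<gamma> assume \<gamma>: "\<gamma> \<in> S" "dist \<gamma> \<gamma>0 < \<delta>"
    have "\<forall>z\<in>Z0. \<exists>t. t \<in> Zi \<gamma> \<and> dist t z < r"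
    proof
      fix z assume z: "z \<in> Z0"
      have "\<delta> \<le> dl z" unfolding \<delta>_def using fin z by auto
      then show "\<exists>t. t \<in> Zi \<gamma> \<and> dist t z < r" using dl(2)[OF z \<gamma>(1)] \<gamma>(2) unfolding Zi_def by fastforce
    qed
    then obtain pick where pick: "\<And>z. z \<in> Z0 \<Longrightarrow> pick z \<in> Zi \<gamma> \<and> dist (pick z) z < r" by metis
    have "inj_on pick Z0"
    proof (rule inj_onI, rule ccontr)
      fix z1 z2 assume z: "z1 \<in> Z0" "z2 \<in> Z0" "pick z1 = pick z2" "z1 \<noteq> z2"
      have "dist z1 z2 \<le> dist (pick z1) z1 + dist (pick z2) z2"
        using dist_triangle2[of z1 z2 "pick z1"] z(3) by (simp add: dist_commute)
      then show False using sep[OF z(1,2,4)] pick[OF z(1)] pick[OF z(2)] by linarith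
    qed
    then show "card (Zi \<gamma>0) \<le> card (Zi \<gamma>)"
      using pick finite_Zi[OF \<gamma>(1)] unfolding Z0_def[symmetric] by (intro card_inj_on_le) auto
  qed
qed

lemma Z_eq: "\<gamma> \<in> S \<Longrightarrow> Z \<gamma> = (if D \<gamma> a = 0 then insert a (Zi \<gamma>) else Zi \<gamma>)"
  unfolding Z_def Zi_def using ab D_b[of \<gamma>] by (auto simp: less_le)

text \<open>
  A zero can enter or leave \<open>{a..b}\<close> only through \<open>a\<close>, and at a value of \<open>\<gamma>\<close> where it does so the sign
  condition on \<open>D \<gamma> a\<close> keeps the number of zeros from crossing the threshold \<open>n\<close>.
\<close>

lemma many_zeros_locally_constant:
  assumes sgn: "\<And>\<gamma>. \<gamma> \<in> S \<Longrightarrow> D \<gamma> a = 0 \<or> (D \<gamma> a < 0 \<longleftrightarrow> even n)" and g0: "\<gamma>0 \<in> S"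
  shows "\<exists>\<delta>>0. \<forall>\<gamma>\<in>S. dist \<gamma> \<gamma>0 < \<delta> \<longrightarrow> (n \<le> card (Z \<gamma>) \<longleftrightarrow> n \<le> card (Z \<gamma>0))"
proof -
  obtain d1 where d1: "0 < d1" "\<And>\<gamma>. \<gamma> \<in> S \<Longrightarrow> dist \<gamma> \<gamma>0 < d1 \<Longrightarrow> card (Z \<gamma>) \<le> card (Z \<gamma>0)"
    using zeros_upper[OF g0] finite_Z[OF g0] by metis
  obtain d2 where d2: "0 < d2" "\<And>\<gamma>. \<gamma> \<in> S \<Longrightarrow> dist \<gamma> \<gamma>0 < d2 \<Longrightarrow> card (Zi \<gamma>0) \<le> card (Zi \<gamma>)"
    using zeros_lower[OF g0] by metis
  have Zcard: "card (Z \<gamma>) = (if D \<gamma> a = 0 then Suc (card (Zi \<gamma>)) else card (Zi \<gamma>))" if "\<gamma> \<in> S" for \<gamma>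
    using finite_Zi[OF that] unfolding Z_eq[OF that] Zi_def by simp
  show ?thesis
  proof (intro exI[of _ "min d1 d2"] conjI ballI impI)
    fix \<gamma> assume \<gamma>: "\<gamma> \<in> S" "dist \<gamma> \<gamma>0 < min d1 d2"
    have le: "card (Z \<gamma>) \<le> card (Z \<gamma>0)" "card (Zi \<gamma>0) \<le> card (Zi \<gamma>)" using d1 d2 \<gamma> by auto
    have "n \<le> card (Z \<gamma>)" if n: "n \<le> card (Z \<gamma>0)"
    proof (cases "D \<gamma> a = 0 \<or> D \<gamma>0 a \<noteq> 0")
      case True
      then show ?thesis using le n Zcard[OF g0] Zcard[OF \<gamma>(1)] by (auto split: if_splits)
    next
      case False
      \<comment> \<open>The critical case: the zero of \<open>D \<gamma>0\<close> at
        \<open>a\<close> has disappeared, so the count may have dropped by one. Dropping from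
        \<open>n\<close> to \<open>n - 1\<close> is excluded by parity, since the sign condition at
        \<open>a\<close> gives \<open>card (Z \<gamma>)\<close> the parity of
        \<open>n\<close>.\<close>
      have "even (card (Z \<gamma>)) \<longleftrightarrow> D \<gamma> a < 0"
        unfolding Z_def
      proof (rule even_card_zeros)
        show "finite {t \<in> {a..b}. D \<gamma> t = 0}" using finite_Z[OF \<gamma>(1)] unfolding Z_def .
        fix t assume "a < t" "t < b" "D \<gamma> t = 0"
        then show "\<exists>d. d \<noteq> 0 \<and> (D \<gamma> has_real_derivative d) (at t)"
          using D_deriv[OF \<gamma>(1)] D_simple[OF \<gamma>(1)] by (intro exI[of _ "D1 \<gamma> t"]) auto
      qed (use ab D_cont_t D_b \<gamma> False in auto)
      then have "even (card (Z \<gamma>)) \<longleftrightarrow> even n" using sgn[OF \<gamma>(1)] False by auto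
      moreover have "n \<le> Suc (card (Z \<gamma>))" using le n False Zcard[OF g0] Zcard[OF \<gamma>(1)] by auto
      ultimately show ?thesis by (metis even_Suc le_SucE)
    qed
    then show "n \<le> card (Z \<gamma>) \<longleftrightarrow> n \<le> card (Z \<gamma>0)" using le by auto
  qed (use d1 d2 in auto)
qed

lemma many_zeros_constant:
  assumes "\<And>\<gamma>. \<gamma> \<in> S \<Longrightarrow> D \<gamma> a = 0 \<or> (D \<gamma> a < 0 \<longleftrightarrow> even n)" "connected S" "\<gamma> \<in> S" "\<gamma>' \<in> S"
  shows "n \<le> card (Z \<gamma>) \<longleftrightarrow> n \<le> card (Z \<gamma>')"
proof (rule connected_local_const[OF assms(2,3,4), where f = "\<lambda>\<gamma>. n \<le> card (Z \<gamma>)"])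
  show "\<forall>\<gamma>\<in>S. \<forall>\<^sub>F \<gamma>' in at \<gamma> within S. (n \<le> card (Z \<gamma>)) = (n \<le> card (Z \<gamma>'))"
  proof
    fix \<gamma> assume "\<gamma> \<in> S"
    then obtain \<delta> where "0 < \<delta>" "\<forall>\<gamma>'\<in>S. dist \<gamma>' \<gamma> < \<delta> \<longrightarrow> (n \<le> card (Z \<gamma>') \<longleftrightarrow> n \<le> card (Z \<gamma>))"
      using many_zeros_locally_constant[OF assms(1)] by blast
    then show "\<forall>\<^sub>F \<gamma>' in at \<gamma> within S. (n \<le> card (Z \<gamma>)) = (n \<le> card (Z \<gamma>'))"
      unfolding eventually_at by blast
  qed
qed

end

text \<open>Gronwall's argument for the energy \<open>w\<^sup>2 + w1\<^sup>2\<close>.\<close>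

lemma second_order_unique:
  fixes w w1 w2 :: "real \<Rightarrow> real"
  assumes "continuous_on {a..b} w" "continuous_on {a..b} w1" "a \<le> b" "0 \<le> K"
    and "\<And>t. a < t \<Longrightarrow> t < b \<Longrightarrow> (w has_real_derivative w1 t) (at t)"
    and "\<And>t. a < t \<Longrightarrow> t < b \<Longrightarrow> (w1 has_real_derivative w2 t) (at t)"
    and "\<And>t. a < t \<Longrightarrow> t < b \<Longrightarrow> \<bar>w2 t\<bar> \<le> K * \<bar>w t\<bar>"
    and "w a = 0" "w1 a = 0"
  shows "w b = 0"
proof -
  define F where "F t = ((w t)\<^sup>2 + (w1 t)\<^sup>2) * exp (- (1 + K) * t)" for t
  define F' where "F' t = (2 * w t * w1 t + 2 * w1 t * w2 t) * exp (- (1 + K) * t)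
      + ((w t)\<^sup>2 + (w1 t)\<^sup>2) * (- (1 + K) * exp (- (1 + K) * t))" for t
  have "- F a \<le> - F b"
  proof (rule DERIV_nonneg_imp_le_open[OF assms(3), where f = "\<lambda>t. - F t" and f' = "\<lambda>t. - F' t"])
    show "continuous_on {a..b} (\<lambda>t. - F t)" unfolding F_def by (intro continuous_intros assms)
    fix t assume t: "a < t" "t < b"
    show "((\<lambda>t. - F t) has_real_derivative - F' t) (at t)"
      unfolding F_def F'_def by (auto intro!: derivative_eq_intros assms(5)[OF t] assms(6)[OF t])
    have "2 * w1 t * w2 t \<le> 2 * \<bar>w1 t\<bar> * (K * \<bar>w t\<bar>)"
    proof -
      have "2 * w1 t * w2 t \<le> 2 * (\<bar>w1 t\<bar> * \<bar>w2 t\<bar>)" by (simp add: abs_mult[symmetric])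
      also have "\<dots> \<le> 2 * (\<bar>w1 t\<bar> * (K * \<bar>w t\<bar>))"
        using assms(7)[OF t] by (intro mult_left_mono) auto
      finally show ?thesis by simp
    qed
    moreover have "K * (2 * \<bar>w1 t\<bar> * \<bar>w t\<bar>) \<le> K * ((w t)\<^sup>2 + (w1 t)\<^sup>2)"
      using assms(4) sum_squares_bound[of "\<bar>w1 t\<bar>" "\<bar>w t\<bar>"] by (intro mult_left_mono) auto
    moreover have "2 * w t * w1 t \<le> (w t)\<^sup>2 + (w1 t)\<^sup>2" by (rule sum_squares_bound)
    ultimately have "2 * w t * w1 t + 2 * w1 t * w2 t \<le> (1 + K) * ((w t)\<^sup>2 + (w1 t)\<^sup>2)"
      by (simp add: algebra_simps)
    then have "(2 * w t * w1 t + 2 * w1 t * w2 t) * exp (- (1 + K) * t)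
        \<le> ((1 + K) * ((w t)\<^sup>2 + (w1 t)\<^sup>2)) * exp (- (1 + K) * t)" by (intro mult_right_mono) auto
    then show "0 \<le> - F' t" unfolding F'_def by (simp add: algebra_simps)
  qed
  then have "((w b)\<^sup>2 + (w1 b)\<^sup>2) * exp (- (1 + K) * b) \<le> 0" unfolding F_def using assms(8,9) by simp
  then have "(w b)\<^sup>2 + (w1 b)\<^sup>2 \<le> 0" by (simp add: mult_le_0_iff)
  then show ?thesis by (simp add: sum_power2_le_zero_iff)
qed

section \<open>Sign changes of the boundary value\<close>

locale singular_family = singular +
  fixes y y1 :: "real \<Rightarrow> real \<Rightarrow> real"
  assumes f_lip: "\<And>m. \<exists>L\<ge>0. \<forall>u\<le>m. \<forall>v\<le>m. \<bar>f u - f v\<bar> \<le> L * \<bar>u - v\<bar>"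
    and reg: "\<And>\<gamma>. 0 < \<gamma> \<Longrightarrow> regular f T0 \<gamma> (y \<gamma>) (y1 \<gamma>)"
    and y_cont: "continuous_on ({0<..} \<times> {T0..}) (\<lambda>(\<gamma>, t). y \<gamma> t)"
    and y1_cont: "continuous_on ({0<..} \<times> {T0..}) (\<lambda>(\<gamma>, t). y1 \<gamma> t)"
    and U_cont: "continuous_on {T0..} U" and U1_cont: "continuous_on {T0..} U1"
begin

definition Z where "Z \<gamma> = {t. T0 \<le> t \<and> y \<gamma> t = U t}"

lemma y_le: "0 < \<gamma> \<Longrightarrow> T0 < t \<Longrightarrow> y \<gamma> t \<le> \<gamma>"
  using reg[of \<gamma>] solves_mono[of T0 "y \<gamma>" "y1 \<gamma>" t] nondecreasing_tendsto_le[of "y \<gamma>" \<gamma> t]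
  unfolding regular_def by blast

text \<open>\<open>b\<close> is chosen where \<open>U\<close> has passed \<gamma>1, hence exceeds
  every \<open>y \<gamma>\<close> of the family, so no zero lies beyond it. A double zero would
  spread to \<open>b\<close> by uniqueness for the linear equation satisfied by the
  difference.\<close>

lemma family:
  assumes "0 < \<gamma>0"
  obtains b where "simple_zero_family (\<lambda>\<gamma> t. y \<gamma> t - U t) (\<lambda>\<gamma> t. y1 \<gamma> t - U1 t) {\<gamma>0..\<gamma>1} T0 b"
    "\<And>\<gamma>. \<gamma> \<in> {\<gamma>0..\<gamma>1} \<Longrightarrow> Z \<gamma> = {t \<in> {T0..b}. y \<gamma> t - U t = 0}"
proof -
  have "\<forall>\<^sub>F t in at_top. \<gamma>1 < U t" using U_top unfolding filterlim_at_top_dense by blast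
  then obtain b' where b': "\<And>t. b' \<le> t \<Longrightarrow> \<gamma>1 < U t" unfolding eventually_at_top_linorder by blast
  define b where "b = max b' (T0 + 1)"
  have b: "\<And>t. b \<le> t \<Longrightarrow> \<gamma>1 < U t" "T0 < b" unfolding b_def using b' by auto
  have cont: "continuous_on ({\<gamma>0..\<gamma>1} \<times> {T0..R}) (\<lambda>(\<gamma>, t). y \<gamma> t - U t)"
    "continuous_on ({\<gamma>0..\<gamma>1} \<times> {T0..R}) (\<lambda>(\<gamma>, t). y1 \<gamma> t - U1 t)" for R
    using assms unfolding case_prod_unfold
    by (intro continuous_intros continuous_on_subset[OF y_cont[unfolded case_prod_unfold]]
          continuous_on_subset[OF y1_cont[unfolded case_prod_unfold]]
          continuous_on_compose2[OF U_cont] continuous_on_compose2[OF U1_cont]; force)+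
  have cont1: "continuous_on {t..R} (\<lambda>t. y \<gamma> t - U t)" "continuous_on {t..R} (\<lambda>t. y1 \<gamma> t - U1 t)"
    if "\<gamma> \<in> {\<gamma>0..\<gamma>1}" "T0 \<le> t" for \<gamma> t R
  proof -
    have p: "continuous_on {t..R} (Pair \<gamma>)" by (auto intro!: continuous_intros)
    have sub: "Pair \<gamma> ` {t..R} \<subseteq> {\<gamma>0..\<gamma>1} \<times> {T0..R}" using that by auto
    show "continuous_on {t..R} (\<lambda>t. y \<gamma> t - U t)" "continuous_on {t..R} (\<lambda>t. y1 \<gamma> t - U1 t)"
      using continuous_on_compose2[OF cont(1) p sub] continuous_on_compose2[OF cont(2) p sub] by simp_all
  qed
  have der: "((\<lambda>t. y \<gamma> t - U t) has_real_derivative y1 \<gamma> t - U1 t) (at t)"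
    "((\<lambda>t. y1 \<gamma> t - U1 t) has_real_derivative - exp (- 2 * t) * f (y \<gamma> t) - - exp (- 2 * t) * f (U t)) (at t)"
    if "0 < \<gamma>" "T0 < t" for \<gamma> t
  proof -
    have d: "(y \<gamma> has_real_derivative y1 \<gamma> t) (at t)" "(U has_real_derivative U1 t) (at t)"
      "(y1 \<gamma> has_real_derivative - exp (- 2 * t) * f (y \<gamma> t)) (at t)"
      "(U1 has_real_derivative - exp (- 2 * t) * f (U t)) (at t)"
      using reg[OF that(1)] U_sol that(2) unfolding regular_def solves_def by auto
    show "((\<lambda>t. y \<gamma> t - U t) has_real_derivative y1 \<gamma> t - U1 t) (at t)" by (rule DERIV_diff[OF d(1,2)])
    show "((\<lambda>t. y1 \<gamma> t - U1 t) has_real_derivative - exp (- 2 * t) * f (y \<gamma> t) - - exp (- 2 * t) * f (U t)) (at t)"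
      by (rule DERIV_diff[OF d(3,4)])
  qed
  have "simple_zero_family (\<lambda>\<gamma> t. y \<gamma> t - U t) (\<lambda>\<gamma> t. y1 \<gamma> t - U1 t) {\<gamma>0..\<gamma>1} T0 b"
  proof
    show "T0 < b" by (rule b)
    show "continuous_on ({\<gamma>0..\<gamma>1} \<times> {T0..b}) (\<lambda>(\<gamma>, t). y \<gamma> t - U t)"
      "continuous_on ({\<gamma>0..\<gamma>1} \<times> {T0..b}) (\<lambda>(\<gamma>, t). y1 \<gamma> t - U1 t)" by (rule cont)+
    show "((\<lambda>t. y \<gamma> t - U t) has_real_derivative y1 \<gamma> t - U1 t) (at t)"
      if "\<gamma> \<in> {\<gamma>0..\<gamma>1}" "T0 < t" "t < b" for \<gamma> t
      by (rule der) (use that assms in auto)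
    show "y \<gamma> b - U b < 0" if "\<gamma> \<in> {\<gamma>0..\<gamma>1}" for \<gamma>
      using y_le[of \<gamma> b] b(1)[of b] b(2) that assms by auto
    fix \<gamma> t assume \<gamma>: "\<gamma> \<in> {\<gamma>0..\<gamma>1}" and t: "T0 \<le> t" "t \<le> b" "y \<gamma> t - U t = 0"
    show "y1 \<gamma> t - U1 t \<noteq> 0"
    proof
      assume 1: "y1 \<gamma> t - U1 t = 0"
      obtain L where L: "0 \<le> L" "\<And>u v. u \<le> max \<gamma> (U b) \<Longrightarrow> v \<le> max \<gamma> (U b) \<Longrightarrow> \<bar>f u - f v\<bar> \<le> L * \<bar>u - v\<bar>"
        using f_lip[of "max \<gamma> (U b)"] by blast
      have "y \<gamma> b - U b = 0"
      proof (rule second_order_unique[OF cont1(1)[OF \<gamma> t(1)] cont1(2)[OF \<gamma> t(1)] t(2)])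
        show "0 \<le> exp (- 2 * T0) * L" using L by simp
        show "y \<gamma> t - U t = 0" "y1 \<gamma> t - U1 t = 0" by fact+
        fix s assume s: "t < s" "s < b"
        then have s': "0 < \<gamma>" "T0 < s" using \<gamma> assms t by auto
        show "((\<lambda>t. y \<gamma> t - U t) has_real_derivative y1 \<gamma> s - U1 s) (at s)"
          "((\<lambda>t. y1 \<gamma> t - U1 t) has_real_derivative - exp (- 2 * s) * f (y \<gamma> s) - - exp (- 2 * s) * f (U s)) (at s)"
          using der[OF s'] by auto
        have "- exp (- 2 * s) * f (y \<gamma> s) - - exp (- 2 * s) * f (U s) = - exp (- 2 * s) * (f (y \<gamma> s) - f (U s))"
          by (simp add: algebra_simps)
        then have "\<bar>- exp (- 2 * s) * f (y \<gamma> s) - - exp (- 2 * s) * f (U s)\<bar> = exp (- 2 * s) * \<bar>f (y \<gamma> s) - f (U s)\<bar>"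
          by (simp add: abs_mult)
        also have "\<dots> \<le> exp (- 2 * T0) * (L * \<bar>y \<gamma> s - U s\<bar>)"
        proof (intro mult_mono)
          show "\<bar>f (y \<gamma> s) - f (U s)\<bar> \<le> L * \<bar>y \<gamma> s - U s\<bar>"
            using y_le[OF s'] solves_mono[OF U_sol s'(2), of b] s by (intro L(2)) auto
        qed (use s' in auto)
        finally show "\<bar>- exp (- 2 * s) * f (y \<gamma> s) - - exp (- 2 * s) * f (U s)\<bar>
            \<le> exp (- 2 * T0) * L * \<bar>y \<gamma> s - U s\<bar>" by simp
      qed
      then show False using y_le[of \<gamma> b] b \<gamma> assms by force
    qed
  qed
  moreover have "Z \<gamma> = {t \<in> {T0..b}. y \<gamma> t - U t = 0}" if "\<gamma> \<in> {\<gamma>0..\<gamma>1}" for \<gamma>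
  proof -
    have "t \<le> b" if "T0 \<le> t" "y \<gamma> t = U t" for t
    proof (rule ccontr)
      assume "\<not> t \<le> b"
      then show False using b(1)[of t] y_le[of \<gamma> t] b(2) that \<open>\<gamma> \<in> {\<gamma>0..\<gamma>1}\<close> assms by force
    qed
    then show ?thesis unfolding Z_def by auto
  qed
  ultimately show ?thesis using that by blast
qed

text \<open>If the sign at \<open>T0\<close> were constant in the weak sense beyond \<Gamma>, a
  threshold \<open>n\<close> of matching parity above \<open>card (Z \<Gamma>)\<close> could never
  be reached as \<gamma> increases, contrary to \<open>many_zeros\<close>.\<close>

theorem sign_changes:
  assumes "0 < \<Gamma>"
  shows "(\<exists>\<gamma>\<ge>\<Gamma>. y \<gamma> T0 < U T0) \<and> (\<exists>\<gamma>\<ge>\<Gamma>. U T0 < y \<gamma> T0)"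
proof -
  have False if n: "\<And>\<gamma>. \<Gamma> \<le> \<gamma> \<Longrightarrow> y \<gamma> T0 - U T0 = 0 \<or> (y \<gamma> T0 - U T0 < 0 \<longleftrightarrow> even n)"
      "card (Z \<Gamma>) < n" for n
  proof -
    obtain G where G: "\<And>\<gamma> y y1. G \<le> \<gamma> \<Longrightarrow> regular f T0 \<gamma> y y1 \<Longrightarrow>
      (\<exists>Z. finite Z \<and> card Z = n \<and> Z \<subseteq> {T0<..} \<and> (\<forall>t\<in>Z. y t = U t))"
      using many_zeros[of n T0] by blast
    define \<gamma>1 where "\<gamma>1 = max \<Gamma> G"
    obtain b where fam: "simple_zero_family (\<lambda>\<gamma> t. y \<gamma> t - U t) (\<lambda>\<gamma> t. y1 \<gamma> t - U1 t) {\<Gamma>..\<gamma>1} T0 b"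
      and Z: "\<And>\<gamma>. \<gamma> \<in> {\<Gamma>..\<gamma>1} \<Longrightarrow> Z \<gamma> = {t \<in> {T0..b}. y \<gamma> t - U t = 0}"
      using family[OF assms] by blast
    interpret F: simple_zero_family "\<lambda>\<gamma> t. y \<gamma> t - U t" "\<lambda>\<gamma> t. y1 \<gamma> t - U1 t" "{\<Gamma>..\<gamma>1}" T0 b by fact
    have in1: "\<Gamma> \<in> {\<Gamma>..\<gamma>1}" "\<gamma>1 \<in> {\<Gamma>..\<gamma>1}" unfolding \<gamma>1_def by auto
    have ZF: "Z \<gamma> = F.Z \<gamma>" if "\<gamma> \<in> {\<Gamma>..\<gamma>1}" for \<gamma> using Z[OF that] unfolding F.Z_def .
    have "n \<le> card (F.Z \<Gamma>) \<longleftrightarrow> n \<le> card (F.Z \<gamma>1)"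
      by (rule F.many_zeros_constant) (use n(1) in1 in auto)
    moreover obtain Z0 where Z0: "finite Z0" "card Z0 = n" "Z0 \<subseteq> {T0<..}" "\<forall>t\<in>Z0. y \<gamma>1 t = U t"
      using G[OF _ reg[of \<gamma>1]] assms unfolding \<gamma>1_def by (metis less_le_trans max.cobounded1 max.cobounded2)
    have "Z0 \<subseteq> F.Z \<gamma>1" using Z0 unfolding ZF[OF in1(2), symmetric] Z_def by auto
    then have "n \<le> card (F.Z \<gamma>1)" using card_mono[OF F.finite_Z[OF in1(2)]] Z0 by auto
    ultimately show False using n(2) unfolding ZF[OF in1(1)] by simp
  qed note contra = this
  show ?thesis
  proof (intro conjI; rule ccontr)
    \<comment> \<open>If the difference at \<open>T0\<close> is never negative, an odd threshold
      meets the sign condition; if it is never positive, an even one does.\<close>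
    assume no: "\<not> (\<exists>\<gamma>\<ge>\<Gamma>. y \<gamma> T0 < U T0)"
    show False
      by (rule contra[of "2 * card (Z \<Gamma>) + 1"]) (use no in force)+
  next
    assume no: "\<not> (\<exists>\<gamma>\<ge>\<Gamma>. U T0 < y \<gamma> T0)"
    show False
      by (rule contra[of "2 * card (Z \<Gamma>) + 2"]) (use no in force)+
  qed
qed

end

section \<open>The radial initial value problem\<close>

text \<open>For a solution of \<open>(r u')' = - r F\<close> regular at the origin this is
  \<open>- r u'(r)\<close>.\<close>

definition flux :: "(real \<Rightarrow> real) \<Rightarrow> real \<Rightarrow> real" where
  "flux F s = integral {0..s} (\<lambda>\<tau>. \<tau> * F \<tau>)"

lemma flux_integrable:
  "continuous_on {0..R} F \<Longrightarrow> s \<le> R \<Longrightarrow> (\<lambda>\<tau>. \<tau> * F \<tau>) integrable_on {0..s}" for R :: real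
  by (intro integrable_continuous_real continuous_intros) (auto elim: continuous_on_subset)

lemma flux_deriv:
  assumes "continuous_on {0..R} F" "s \<in> {0..R}"
  shows "(flux F has_real_derivative s * F s) (at s within {0..R})"
  unfolding flux_def
  by (rule integral_has_real_derivative[where g = "\<lambda>\<tau>. \<tau> * F \<tau>"])
     (use assms in \<open>auto intro!: continuous_intros\<close>)

lemma flux_bound:
  assumes "continuous_on {0..R} F" "s \<in> {0..R}" "\<And>\<tau>. \<tau> \<in> {0..s} \<Longrightarrow> \<bar>F \<tau>\<bar> \<le> B"
  shows "\<bar>flux F s\<bar> \<le> B * s\<^sup>2 / 2"
proof -
  have i: "((\<lambda>\<tau>. B * \<tau>) has_integral B * s\<^sup>2 / 2 - B * 0\<^sup>2 / 2) {0..s}"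
    using assms by (intro fundamental_theorem_of_calculus)
      (auto intro!: derivative_eq_intros simp: has_real_derivative_iff_has_vector_derivative[symmetric])
  have "norm (integral {0..s} (\<lambda>\<tau>. \<tau> * F \<tau>)) \<le> integral {0..s} (\<lambda>\<tau>. B * \<tau>)"
  proof (rule integral_norm_bound_integral)
    fix \<tau> assume "\<tau> \<in> {0..s}"
    then show "norm (\<tau> * F \<tau>) \<le> B * \<tau>"
      using assms(3)[of \<tau>] by (simp add: abs_mult mult.commute[of B] mult_left_mono)
  qed (use i flux_integrable[OF assms(1)] assms(2) in auto)
  also have "\<dots> = B * s\<^sup>2 / 2" using integral_unique[OF i] by (simp del: integral_mult_right)
  finally show ?thesis unfolding flux_def by simp
qed

lemma flux_diff:
  assumes "continuous_on {0..R} F" "continuous_on {0..R} G" "s \<in> {0..R}"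
  shows "flux F s - flux G s = flux (\<lambda>\<tau>. F \<tau> - G \<tau>) s"
  unfolding flux_def
  using integral_diff[OF flux_integrable[OF assms(1), of s] flux_integrable[OF assms(2), of s]] assms(3)
  by (simp add: algebra_simps)

text \<open>Responsible for regularity at the centre: it shows that \<open>flux F s / s\<close>, the
  negative of the derivative of the solution, is differentiable at 0 with derivative
  \<open>F 0 / 2\<close>.\<close>

lemma flux_quadratic:
  assumes F: "continuous_on {0..R} F" and R: "0 < R"
  shows "((\<lambda>s. flux F s / s / s) \<longlongrightarrow> F 0 / 2) (at 0 within {0..R})"
proof (rule tendstoI)
  fix e :: real assume e: "0 < e"
  obtain d where d: "0 < d" "\<And>\<tau>. \<tau> \<in> {0..R} \<Longrightarrow> \<bar>\<tau>\<bar> < d \<Longrightarrow> \<bar>F \<tau> - F 0\<bar> < e"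
    using F R e unfolding continuous_on_iff dist_real_def by (metis atLeastAtMost_iff diff_zero less_eq_real_def)
  have c0: "flux (\<lambda>_. F 0) s = F 0 * s\<^sup>2 / 2" if "0 \<le> s" for s
  proof -
    have "((\<lambda>\<tau>. \<tau> * F 0) has_integral F 0 * s\<^sup>2 / 2 - F 0 * 0\<^sup>2 / 2) {0..s}"
      using that by (intro fundamental_theorem_of_calculus)
        (auto intro!: derivative_eq_intros simp: has_real_derivative_iff_has_vector_derivative[symmetric])
    then show ?thesis unfolding flux_def by (simp add: integral_unique del: integral_mult_left)
  qed
  have "dist (flux F s / s / s) (F 0 / 2) < e" if s: "s \<in> {0..R}" "s \<noteq> 0" "dist s 0 < d" for s
  proof -
    have "\<bar>flux (\<lambda>\<tau>. F \<tau> - F 0) s\<bar> \<le> e * s\<^sup>2 / 2"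
      by (rule flux_bound[of R]) (use s d(2) F in \<open>auto intro!: continuous_intros less_imp_le\<close>)
    then have le: "\<bar>flux F s - F 0 * s\<^sup>2 / 2\<bar> \<le> e * s\<^sup>2 / 2"
      using flux_diff[OF F continuous_on_const, of s "F 0"] c0[of s] s by simp
    have eq: "flux F s / s / s - F 0 / 2 = (flux F s - F 0 * s\<^sup>2 / 2) / s\<^sup>2"
      using s by (simp add: field_simps power2_eq_square)
    have "dist (flux F s / s / s) (F 0 / 2) = \<bar>flux F s - F 0 * s\<^sup>2 / 2\<bar> / s\<^sup>2"
      unfolding dist_real_def eq by (simp add: abs_divide)
    also have "\<dots> \<le> (e * s\<^sup>2 / 2) / s\<^sup>2" using le by (intro divide_right_mono) auto
    also have "\<dots> < e" using s e by simp
    finally show ?thesis .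
  qed
  then show "\<forall>\<^sub>F s in at 0 within {0..R}. dist (flux F s / s / s) (F 0 / 2) < e"
    using d(1) unfolding eventually_at by blast
qed

lemma flux_div_continuous:
  assumes F: "continuous_on {0..R} F" and R: "0 < R"
  shows "continuous_on {0..R} (\<lambda>s. flux F s / s)"
  unfolding continuous_on_eq_continuous_within
proof
  fix s assume s: "s \<in> {0..R}"
  have fc: "continuous (at s within {0..R}) (flux F)"
    using flux_deriv[OF F s] by (rule DERIV_continuous)
  show "continuous (at s within {0..R}) (\<lambda>s. flux F s / s)"
  proof (cases "s = 0")
    case False
    then show ?thesis using fc by (intro continuous_intros) auto
  next
    case True
    have "((\<lambda>s. s * (flux F s / s / s)) \<longlongrightarrow> 0 * (F 0 / 2)) (at 0 within {0..R})"
      by (intro tendsto_intros flux_quadratic assms)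
    then have "((\<lambda>s. flux F s / s) \<longlongrightarrow> 0 * (F 0 / 2)) (at 0 within {0..R})"
      by (rule Lim_transform_eventually) (auto simp: eventually_at_filter)
    then show ?thesis unfolding True continuous_within by simp
  qed
qed

lemma flux_div_deriv:
  assumes F: "continuous_on {0..R} F" and R: "0 < R" and s: "s \<in> {0..R}"
  shows "((\<lambda>s. flux F s / s) has_real_derivative (if s = 0 then F 0 / 2 else F s - flux F s / s / s))
      (at s within {0..R})"
proof (cases "s = 0")
  case False
  then show ?thesis using flux_deriv[OF F s]
    by (auto intro!: derivative_eq_intros simp: field_simps)
next
  case True
  show ?thesis unfolding True has_field_derivative_iff using flux_quadratic[OF F R] by simp
qed

lemma flux_div_deriv_continuous:
  assumes F: "continuous_on {0..R} F" and R: "0 < R"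
  shows "continuous_on {0..R} (\<lambda>s. if s = 0 then F 0 / 2 else F s - flux F s / s / s)"
  unfolding continuous_on_eq_continuous_within
proof
  fix s assume s: "s \<in> {0..R}"
  have lim: "(F \<longlongrightarrow> F s) (at s within {0..R})" "((\<lambda>s. flux F s / s) \<longlongrightarrow> flux F s / s) (at s within {0..R})"
    using F flux_div_continuous[OF F R] s unfolding continuous_on_def by auto
  have "((\<lambda>s. F s - flux F s / s / s) \<longlongrightarrow> (if s = 0 then F 0 / 2 else F s - flux F s / s / s)) (at s within {0..R})"
  proof (cases "s = 0")
    case True
    have "((\<lambda>s. F s - flux F s / s / s) \<longlongrightarrow> F 0 - F 0 / 2) (at 0 within {0..R})"
      using lim(1) True by (intro tendsto_diff flux_quadratic assms) auto
    then show ?thesis using True by simp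
  next
    case False
    have "((\<lambda>s. F s - flux F s / s / s) \<longlongrightarrow> F s - flux F s / s / s) (at s within {0..R})"
      by (rule tendsto_diff[OF lim(1) tendsto_divide[OF lim(2) tendsto_ident_at False]])
    then show ?thesis using False by simp
  qed
  moreover have "\<forall>\<^sub>F r in at s within {0..R}. F r - flux F r / r / r = (if r = 0 then F 0 / 2 else F r - flux F r / r / r)"
  proof (cases "s = 0")
    case False
    have "\<forall>\<^sub>F r in at s within {0..R}. r \<noteq> 0"
      using False tendsto_ident_at[of s "{0..R}"] by (intro tendsto_imp_eventually_ne) auto
    then show ?thesis by eventually_elim simp
  qed (auto simp: eventually_at_filter)
  ultimately show "continuous (at s within {0..R}) (\<lambda>s. if s = 0 then F 0 / 2 else F s - flux F s / s / s)"
    unfolding continuous_within by (rule Lim_transform_eventually)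
qed

text \<open>
  Integrating \<open>(r u')' = - r F\<close> twice from \<open>r = 0\<close>; the quotient is \<open>0\<close> at \<open>s = 0\<close>, which is also
  its limit there.
\<close>

definition potential :: "(real \<Rightarrow> real) \<Rightarrow> real \<Rightarrow> real" where
  "potential F x = integral {0..x} (\<lambda>s. flux F s / s)"

lemma potential_deriv:
  assumes "continuous_on {0..R} F" "0 < R" "x \<in> {0..R}"
  shows "(potential F has_real_derivative flux F x / x) (at x within {0..R})"
  unfolding potential_def
  by (rule integral_has_real_derivative[OF flux_div_continuous[OF assms(1,2)] assms(3)])

text \<open>In the norm weighted by \<open>exp (- k * x)\<close> an integration gains a factor
  \<open>1 / k\<close>. The division by \<open>s\<close> is compensated by the weight
  \<open>\<tau>\<close>, which is at most \<open>s\<close>.\<close>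

lemma flux_exp_bound:
  assumes F: "continuous_on {0..R} F" and s: "s \<in> {0..R}" and k: "0 < k" and B: "0 \<le> B"
    "\<And>\<tau>. \<tau> \<in> {0..R} \<Longrightarrow> \<bar>F \<tau>\<bar> \<le> B * exp (k * \<tau>)"
  shows "\<bar>flux F s / s\<bar> \<le> B * exp (k * s) / k"
proof (cases "s = 0")
  case False
  have i: "((\<lambda>\<tau>. s * (B * exp (k * \<tau>))) has_integral s * (B * exp (k * s) / k) - s * (B * exp (k * 0) / k)) {0..s}"
    using s k by (intro fundamental_theorem_of_calculus)
      (auto intro!: derivative_eq_intros simp: has_real_derivative_iff_has_vector_derivative[symmetric])
  have "norm (integral {0..s} (\<lambda>\<tau>. \<tau> * F \<tau>)) \<le> integral {0..s} (\<lambda>\<tau>. s * (B * exp (k * \<tau>)))"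
  proof (rule integral_norm_bound_integral)
    fix \<tau> assume "\<tau> \<in> {0..s}"
    then show "norm (\<tau> * F \<tau>) \<le> s * (B * exp (k * \<tau>))"
      using B(2)[of \<tau>] s unfolding real_norm_def abs_mult by (intro mult_mono) auto
  qed (use i flux_integrable[OF F] s in auto)
  also have "\<dots> \<le> s * (B * exp (k * s) / k)" using integral_unique[OF i] s k B by simp
  finally have "\<bar>flux F s\<bar> \<le> (B * exp (k * s) / k) * s" unfolding flux_def by (simp add: mult.commute)
  then show ?thesis using s False by (simp add: pos_divide_le_eq)
qed (use k B in simp)

lemma potential_exp_bound:
  assumes F: "continuous_on {0..R} F" and R: "0 < R" and x: "x \<in> {0..R}" and k: "0 < k" and B: "0 \<le> B"
    "\<And>\<tau>. \<tau> \<in> {0..R} \<Longrightarrow> \<bar>F \<tau>\<bar> \<le> B * exp (k * \<tau>)"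
  shows "\<bar>potential F x\<bar> \<le> B * exp (k * x) / k\<^sup>2"
proof -
  have i: "((\<lambda>\<tau>. B * exp (k * \<tau>) / k) has_integral B * exp (k * x) / k\<^sup>2 - B * exp (k * 0) / k\<^sup>2) {0..x}"
    using x k by (intro fundamental_theorem_of_calculus)
      (auto intro!: derivative_eq_intros simp: power2_eq_square has_real_derivative_iff_has_vector_derivative[symmetric])
  have "norm (integral {0..x} (\<lambda>s. flux F s / s)) \<le> integral {0..x} (\<lambda>\<tau>. B * exp (k * \<tau>) / k)"
  proof (rule integral_norm_bound_integral)
    show "(\<lambda>s. flux F s / s) integrable_on {0..x}"
      using flux_div_continuous[OF F R] x by (intro integrable_continuous_real) (auto elim: continuous_on_subset)
  qed (use i flux_exp_bound[OF F _ k B] x in auto)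
  also have "\<dots> \<le> B * exp (k * x) / k\<^sup>2" using integral_unique[OF i] k B by simp
  finally show ?thesis unfolding potential_def by simp
qed

lemma potential_diff:
  assumes F: "continuous_on {0..R} F" "continuous_on {0..R} G" and R: "0 < R" and x: "x \<in> {0..R}"
  shows "potential F x - potential G x = potential (\<lambda>\<tau>. F \<tau> - G \<tau>) x"
proof -
  have int: "(\<lambda>s. flux F s / s) integrable_on {0..x}" "(\<lambda>s. flux G s / s) integrable_on {0..x}"
    using flux_div_continuous[OF F(1) R] flux_div_continuous[OF F(2) R] x
    by (auto intro!: integrable_continuous_real elim: continuous_on_subset)
  show ?thesis unfolding potential_def integral_diff[OF int, symmetric]
    using flux_diff[OF F] x by (intro integral_cong) (auto simp: diff_divide_distrib[symmetric])
qed

section \<open>Existence and dependence on the initial value\<close>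

definition radial_ivp :: "(real \<Rightarrow> real) \<Rightarrow> real \<Rightarrow> real \<Rightarrow> (real \<Rightarrow> real) \<Rightarrow> bool" where
  "radial_ivp f R \<gamma> v \<longleftrightarrow> continuous_on {0..R} v \<and> (\<forall>x\<in>{0..R}. v x = \<gamma> - potential (\<lambda>\<tau>. f (v \<tau>)) x)"

text \<open>Banach's fixed point theorem for \<psi> with
  \<open>v x = exp (k * x) * \<psi> x\<close>. The exponential weight makes the integral operator a
  contraction on the whole of \<open>{0..R}\<close>, without continuation in steps.\<close>

lemma radial_ivp_lipschitz_exists:
  fixes f :: "real \<Rightarrow> real"
  assumes L: "0 \<le> L" "\<And>u v. \<bar>f u - f v\<bar> \<le> L * \<bar>u - v\<bar>" and R: "0 < R"
  shows "\<exists>v. radial_ivp f R \<gamma> v"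
proof -
  define k where "k = L + 1"
  have k: "0 < k" "L / k\<^sup>2 \<le> 1 / 2"
  proof -
    show "0 < k" unfolding k_def using L by simp
    have "2 * L \<le> k\<^sup>2" unfolding k_def power2_eq_square using L by (simp add: algebra_simps)
    then show "L / k\<^sup>2 \<le> 1 / 2" using \<open>0 < k\<close> by (simp add: field_simps)
  qed
  have fc: "continuous_on UNIV f"
  proof (rule lipschitz_on_continuous_on)
    show "L-lipschitz_on UNIV f" unfolding lipschitz_on_def dist_real_def using L by auto
  qed
  \<comment> \<open>Clamping to \<open>{0..R}\<close> turns functions on the interval into bounded
    continuous functions on the line, which form a complete space.\<close>
  define cl where "cl x = max 0 (min x R)" for x
  have cl: "cl x \<in> {0..R}" for x unfolding cl_def using R by auto
  have clc: "continuous_on UNIV cl" unfolding cl_def by (intro continuous_intros)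
  define F where "F \<psi> = (\<lambda>\<tau>. f (exp (k * \<tau>) * apply_bcontfun \<psi> \<tau>))" for \<psi> :: "real \<Rightarrow>\<^sub>C real"
  have Fc: "continuous_on {0..R} (F \<psi>)" for \<psi>
    unfolding F_def by (rule continuous_on_compose2[OF fc]) (auto intro!: continuous_intros)
  define H where "H \<psi> x = exp (- k * x) * (\<gamma> - potential (F \<psi>) x)" for \<psi> x
  have Hc: "continuous_on {0..R} (H \<psi>)" for \<psi>
    unfolding H_def using potential_deriv[OF Fc R]
    by (intro continuous_intros DERIV_continuous_on[where D = "\<lambda>x. flux (F \<psi>) x / x"]) auto
  have Hb: "(\<lambda>x. H \<psi> (cl x)) \<in> bcontfun" for \<psi>
  proof -
    have "compact (H \<psi> ` {0..R})" using Hc by (intro compact_continuous_image) auto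
    then have "bounded (H \<psi> ` {0..R})" by (rule compact_imp_bounded)
    then obtain b where b: "\<And>x. x \<in> {0..R} \<Longrightarrow> norm (H \<psi> x) \<le> b" unfolding bounded_iff by blast
    have "continuous_on UNIV (\<lambda>x. H \<psi> (cl x))"
      by (rule continuous_on_compose2[OF Hc clc]) (use cl in auto)
    then show ?thesis by (rule bcontfun_normI) (use b cl in blast)
  qed
  define \<Phi> where "\<Phi> \<psi> = Bcontfun (\<lambda>x. H \<psi> (cl x))" for \<psi>
  have \<Phi>: "apply_bcontfun (\<Phi> \<psi>) x = H \<psi> (cl x)" for \<psi> x
    unfolding \<Phi>_def using Bcontfun_inverse[OF Hb] by simp
  have "dist (\<Phi> \<psi>1) (\<Phi> \<psi>2) \<le> 1 / 2 * dist \<psi>1 \<psi>2" for \<psi>1 \<psi>2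
  proof (rule dist_bound)
    fix x
    define z where "z = cl x"
    have z: "z \<in> {0..R}" unfolding z_def by (rule cl)
    define d where "d = dist \<psi>1 \<psi>2"
    have d: "\<bar>apply_bcontfun \<psi>1 \<tau> - apply_bcontfun \<psi>2 \<tau>\<bar> \<le> d" for \<tau>
      unfolding d_def using dist_bounded[of \<psi>1 \<tau> \<psi>2] by (simp add: dist_real_def)
    have "0 \<le> d" unfolding d_def by simp
    have "\<bar>potential (\<lambda>\<tau>. F \<psi>1 \<tau> - F \<psi>2 \<tau>) z\<bar> \<le> (L * d) * exp (k * z) / k\<^sup>2"
    proof (rule potential_exp_bound[OF _ R z k(1)])
      show "continuous_on {0..R} (\<lambda>\<tau>. F \<psi>1 \<tau> - F \<psi>2 \<tau>)" by (intro continuous_intros Fc)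
      show "0 \<le> L * d" using L \<open>0 \<le> d\<close> by simp
      fix \<tau> :: real
      have "\<bar>F \<psi>1 \<tau> - F \<psi>2 \<tau>\<bar> \<le> L * \<bar>exp (k * \<tau>) * apply_bcontfun \<psi>1 \<tau> - exp (k * \<tau>) * apply_bcontfun \<psi>2 \<tau>\<bar>"
        unfolding F_def by (rule L(2))
      also have "\<dots> = L * (exp (k * \<tau>) * \<bar>apply_bcontfun \<psi>1 \<tau> - apply_bcontfun \<psi>2 \<tau>\<bar>)"
        by (simp add: right_diff_distrib[symmetric] abs_mult)
      also have "\<dots> \<le> L * (exp (k * \<tau>) * d)" using L d by (intro mult_left_mono) auto
      finally show "\<bar>F \<psi>1 \<tau> - F \<psi>2 \<tau>\<bar> \<le> L * d * exp (k * \<tau>)" by (simp add: mult_ac)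
    qed
    moreover have "H \<psi>1 z - H \<psi>2 z = - exp (- k * z) * potential (\<lambda>\<tau>. F \<psi>1 \<tau> - F \<psi>2 \<tau>) z"
      unfolding H_def potential_diff[OF Fc Fc R z, symmetric] by (simp add: algebra_simps)
    then have "\<bar>H \<psi>1 z - H \<psi>2 z\<bar> = exp (- k * z) * \<bar>potential (\<lambda>\<tau>. F \<psi>1 \<tau> - F \<psi>2 \<tau>) z\<bar>"
      by (simp add: abs_mult)
    ultimately have "\<bar>H \<psi>1 z - H \<psi>2 z\<bar> \<le> exp (- k * z) * ((L * d) * exp (k * z) / k\<^sup>2)"
      by (metis exp_ge_zero mult_left_mono)
    also have "\<dots> = (exp (- k * z) * exp (k * z)) * (L / k\<^sup>2 * d)" by simp
    also have "\<dots> = L / k\<^sup>2 * d" by (simp add: exp_minus)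
    also have "\<dots> \<le> 1 / 2 * d" using k(2) \<open>0 \<le> d\<close> by (intro mult_right_mono) auto
    finally show "dist (apply_bcontfun (\<Phi> \<psi>1) x) (apply_bcontfun (\<Phi> \<psi>2) x) \<le> 1 / 2 * dist \<psi>1 \<psi>2"
      unfolding \<Phi> d_def z_def dist_real_def .
  qed
  then obtain \<psi> where \<psi>: "\<Phi> \<psi> = \<psi>" using banach_fix_type[of "1 / 2" \<Phi>] by auto
  define v where "v x = exp (k * x) * apply_bcontfun \<psi> x" for x
  have "v x = \<gamma> - potential (\<lambda>\<tau>. f (v \<tau>)) x" if "x \<in> {0..R}" for x
  proof -
    have "cl x = x" using that unfolding cl_def by auto
    then have "apply_bcontfun \<psi> x = exp (- k * x) * (\<gamma> - potential (F \<psi>) x)"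
      using \<Phi>[of \<psi> x] unfolding \<psi> H_def by simp
    then have "v x = (exp (k * x) * exp (- k * x)) * (\<gamma> - potential (F \<psi>) x)" unfolding v_def by simp
    then show ?thesis unfolding F_def v_def by (simp add: exp_minus)
  qed
  moreover have "continuous_on {0..R} v" unfolding v_def by (intro continuous_intros) auto
  ultimately show ?thesis unfolding radial_ivp_def by blast
qed

lemma continuous_on_locally_lipschitz:
  fixes f :: "real \<Rightarrow> real"
  assumes "\<And>m. \<exists>L\<ge>0. \<forall>u\<le>m. \<forall>v\<le>m. \<bar>f u - f v\<bar> \<le> L * \<bar>u - v\<bar>"
  shows "continuous_on UNIV f"
  unfolding continuous_on_eq_continuous_at[OF open_UNIV]
proof
  fix u :: real
  obtain L where L: "0 \<le> L" "\<forall>a\<le>u + 1. \<forall>b\<le>u + 1. \<bar>f a - f b\<bar> \<le> L * \<bar>a - b\<bar>" using assms by blast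
  then have "L-lipschitz_on {..<u + 1} f" unfolding lipschitz_on_def dist_real_def by auto
  then have "continuous_on {..<u + 1} f" by (rule lipschitz_on_continuous_on)
  then show "isCont f u" by (simp add: continuous_on_eq_continuous_at)
qed

lemma continuous_on_lipschitz_family:
  fixes F :: "real \<Rightarrow> real \<Rightarrow> real"
  assumes "\<And>\<gamma>. continuous_on T (F \<gamma>)"
    and "\<And>m. \<exists>C\<ge>0. \<forall>\<gamma>\<le>m. \<forall>\<gamma>'\<le>m. \<forall>x\<in>T. \<bar>F \<gamma> x - F \<gamma>' x\<bar> \<le> C * \<bar>\<gamma> - \<gamma>'\<bar>"
  shows "continuous_on (UNIV \<times> T) (\<lambda>(\<gamma>, x). F \<gamma> x)"
  unfolding continuous_on_def
proof
  fix p assume "p \<in> (UNIV :: real set) \<times> T"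
  then obtain \<gamma> x where p: "p = (\<gamma>, x)" "x \<in> T" by auto
  obtain C where C: "0 \<le> C" "\<forall>a\<le>\<gamma> + 1. \<forall>b\<le>\<gamma> + 1. \<forall>x\<in>T. \<bar>F a x - F b x\<bar> \<le> C * \<bar>a - b\<bar>"
    using assms(2) by blast
  define Fi where "Fi = at p within (UNIV \<times> T)"
  have 1: "((\<lambda>q. F \<gamma> (snd q)) \<longlongrightarrow> F \<gamma> x) Fi"
  proof -
    have "continuous_on (UNIV \<times> T) (\<lambda>q :: real \<times> real. F \<gamma> (snd q))"
      by (rule continuous_on_compose2[OF assms(1) continuous_on_snd[OF continuous_on_id]]) auto
    then show ?thesis unfolding continuous_on_def Fi_def using p by force
  qed
  have fst: "(fst \<longlongrightarrow> \<gamma>) Fi" unfolding Fi_def using tendsto_fst[OF tendsto_ident_at[of p]] p by (simp add: id_def)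
  have "((\<lambda>q. F (fst q) (snd q) - F \<gamma> (snd q)) \<longlongrightarrow> 0) Fi"
  proof (rule Lim_null_comparison)
    show "((\<lambda>q. C * \<bar>fst q - \<gamma>\<bar>) \<longlongrightarrow> 0) Fi"
      using tendsto_mult[OF tendsto_const[of C] tendsto_rabs[OF tendsto_diff[OF fst tendsto_const[of \<gamma>]]]] by simp
    have "\<forall>\<^sub>F q in Fi. fst q < \<gamma> + 1" using order_tendstoD(2)[OF fst, of "\<gamma> + 1"] by simp
    moreover have "\<forall>\<^sub>F q in Fi. snd q \<in> T"
      unfolding Fi_def eventually_at_filter by (rule always_eventually) auto
    ultimately show "\<forall>\<^sub>F q in Fi. norm (F (fst q) (snd q) - F \<gamma> (snd q)) \<le> C * \<bar>fst q - \<gamma>\<bar>"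
      by eventually_elim (use C in auto)
  qed
  from tendsto_add[OF this 1] show "((\<lambda>(\<gamma>, x). F \<gamma> x) \<longlongrightarrow> (case p of (\<gamma>, x) \<Rightarrow> F \<gamma> x)) (at p within UNIV \<times> T)"
    unfolding Fi_def p by (simp add: case_prod_unfold)
qed

text \<open>The Lipschitz condition is on half-lines unbounded below: solutions lie below their
  initial value but may become arbitrarily negative.\<close>

locale radial =
  fixes f :: "real \<Rightarrow> real"
  assumes f_nonneg: "\<And>u. 0 \<le> f u"
    and f_pos: "\<And>u. 0 < u \<Longrightarrow> 0 < f u"
    and f_lip: "\<And>m. \<exists>L\<ge>0. \<forall>u\<le>m. \<forall>v\<le>m. \<bar>f u - f v\<bar> \<le> L * \<bar>u - v\<bar>"
begin

lemmas f_cont = continuous_on_locally_lipschitz[OF f_lip]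

lemma potential_nonneg:
  assumes "continuous_on {0..R} F" "0 < R" "x \<in> {0..R}" "\<And>\<tau>. 0 \<le> F \<tau>"
  shows "0 \<le> potential F x"
proof -
  have "0 \<le> flux F s" if "s \<in> {0..R}" for s
    unfolding flux_def using flux_integrable[OF assms(1)] that assms(4) by (intro integral_nonneg) auto
  then show ?thesis
    unfolding potential_def using flux_div_continuous[OF assms(1,2)] assms(3)
    by (intro integral_nonneg integrable_continuous_real) (auto elim: continuous_on_subset)
qed

lemma ivp_comp_continuous: "radial_ivp f R \<gamma> v \<Longrightarrow> continuous_on {0..R} (\<lambda>\<tau>. f (v \<tau>))"
  unfolding radial_ivp_def by (auto intro: continuous_on_compose2[OF f_cont])

lemma ivp_le: "radial_ivp f R \<gamma> v \<Longrightarrow> 0 < R \<Longrightarrow> x \<in> {0..R} \<Longrightarrow> v x \<le> \<gamma>"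
  using potential_nonneg[OF ivp_comp_continuous, of R \<gamma> v x] f_nonneg unfolding radial_ivp_def by fastforce

text \<open>Truncating \<open>f\<close> above \<gamma> makes it globally Lipschitz. As the truncated
  function is still nonnegative, the solution stays below \<gamma> and does not feel the
  truncation.\<close>

lemma ivp_exists:
  assumes R: "0 < R" shows "\<exists>v. radial_ivp f R \<gamma> v"
proof -
  define F where "F u = f (min u \<gamma>)" for u
  obtain L where L: "0 \<le> L" "\<forall>u\<le>\<gamma>. \<forall>v\<le>\<gamma>. \<bar>f u - f v\<bar> \<le> L * \<bar>u - v\<bar>" using f_lip by blast
  have "\<bar>F u - F v\<bar> \<le> L * \<bar>u - v\<bar>" for u v
  proof -
    have "\<bar>F u - F v\<bar> \<le> L * \<bar>min u \<gamma> - min v \<gamma>\<bar>" unfolding F_def using L by auto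
    also have "\<dots> \<le> L * \<bar>u - v\<bar>" using L by (intro mult_left_mono) auto
    finally show ?thesis .
  qed
  then obtain v where v: "radial_ivp F R \<gamma> v" using radial_ivp_lipschitz_exists[OF L(1) _ R] by blast
  have Fc: "continuous_on UNIV F" unfolding F_def
    by (rule continuous_on_compose2[OF f_cont]) (auto intro!: continuous_intros)
  have Fv: "continuous_on {0..R} (\<lambda>\<tau>. F (v \<tau>))"
    using v unfolding radial_ivp_def by (auto intro: continuous_on_compose2[OF Fc])
  have "0 \<le> potential (\<lambda>\<tau>. F (v \<tau>)) x" if "x \<in> {0..R}" for x
    by (rule potential_nonneg[OF Fv R that]) (simp add: F_def f_nonneg)
  then have le: "v x \<le> \<gamma>" if "x \<in> {0..R}" for x using v that unfolding radial_ivp_def by fastforce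
  have "potential (\<lambda>\<tau>. F (v \<tau>)) x = potential (\<lambda>\<tau>. f (v \<tau>)) x" if "x \<in> {0..R}" for x
    unfolding potential_def flux_def F_def using that le
    by (intro integral_cong arg_cong2[where f = "(/)"]) (auto simp: min_absorb1)
  then show ?thesis using v unfolding radial_ivp_def by auto
qed

definition sol :: "real \<Rightarrow> real \<Rightarrow> real \<Rightarrow> real" where
  "sol R \<gamma> = (SOME v. radial_ivp f R \<gamma> v)"

lemma sol: "0 < R \<Longrightarrow> radial_ivp f R \<gamma> (sol R \<gamma>)"
  unfolding sol_def using someI_ex[OF ivp_exists] .

text \<open>At a maximum point \<open>z\<close> of the weighted difference the integral term
  accounts for at most half of \<open>\<bar>v z - w z\<bar>\<close>, so the initial values account
  for the other half.\<close>

lemma sol_lipschitz: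
  assumes R: "0 < R"
  shows "\<exists>C\<ge>0. \<forall>\<gamma>\<le>m. \<forall>\<gamma>'\<le>m. \<forall>x\<in>{0..R}. \<bar>sol R \<gamma> x - sol R \<gamma>' x\<bar> \<le> C * \<bar>\<gamma> - \<gamma>'\<bar>"
proof -
  obtain L where L: "0 \<le> L" "\<forall>u\<le>m. \<forall>v\<le>m. \<bar>f u - f v\<bar> \<le> L * \<bar>u - v\<bar>" using f_lip by blast
  define k where "k = L + 1"
  have k: "0 < k" "L / k\<^sup>2 \<le> 1 / 2"
  proof -
    show "0 < k" unfolding k_def using L by simp
    have "2 * L \<le> k\<^sup>2" unfolding k_def power2_eq_square using L by (simp add: algebra_simps)
    then show "L / k\<^sup>2 \<le> 1 / 2" using \<open>0 < k\<close> by (simp add: field_simps)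
  qed
  have "\<bar>sol R \<gamma> x - sol R \<gamma>' x\<bar> \<le> (2 * exp (k * R)) * \<bar>\<gamma> - \<gamma>'\<bar>"
    if \<gamma>: "\<gamma> \<le> m" "\<gamma>' \<le> m" and x: "x \<in> {0..R}" for \<gamma> \<gamma>' x
  proof -
    define v where "v = sol R \<gamma>"
    define w where "w = sol R \<gamma>'"
    have v: "radial_ivp f R \<gamma> v" and w: "radial_ivp f R \<gamma>' w" unfolding v_def w_def using sol[OF R] by auto
    have vc: "continuous_on {0..R} v" "continuous_on {0..R} w" using v w unfolding radial_ivp_def by auto
    have "continuous_on {0..R} (\<lambda>x. exp (- k * x) * \<bar>v x - w x\<bar>)" by (intro continuous_intros vc)
    then obtain z where z: "z \<in> {0..R}" "\<And>x. x \<in> {0..R} \<Longrightarrow> exp (- k * x) * \<bar>v x - w x\<bar> \<le> exp (- k * z) * \<bar>v z - w z\<bar>"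
      using continuous_attains_sup[of "{0..R}" "\<lambda>x. exp (- k * x) * \<bar>v x - w x\<bar>"] R by auto
    define d where "d = exp (- k * z) * \<bar>v z - w z\<bar>"
    have d0: "0 \<le> d" unfolding d_def by simp
    have dle: "\<bar>v x - w x\<bar> \<le> d * exp (k * x)" if "x \<in> {0..R}" for x
      using z(2)[OF that] unfolding d_def[symmetric] by (simp add: exp_minus field_simps)
    have fc: "continuous_on {0..R} (\<lambda>\<tau>. f (v \<tau>))" "continuous_on {0..R} (\<lambda>\<tau>. f (w \<tau>))"
      using ivp_comp_continuous v w by auto
    have "\<bar>potential (\<lambda>\<tau>. f (v \<tau>) - f (w \<tau>)) z\<bar> \<le> (L * d) * exp (k * z) / k\<^sup>2"
    proof (rule potential_exp_bound[OF _ R z(1) k(1)])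
      show "continuous_on {0..R} (\<lambda>\<tau>. f (v \<tau>) - f (w \<tau>))" by (intro continuous_intros fc)
      show "0 \<le> L * d" using L d0 by simp
      fix \<tau> assume t: "\<tau> \<in> {0..R}"
      have "\<bar>f (v \<tau>) - f (w \<tau>)\<bar> \<le> L * \<bar>v \<tau> - w \<tau>\<bar>"
        using L(2) ivp_le[OF v R t] ivp_le[OF w R t] \<gamma> by auto
      also have "\<dots> \<le> L * (d * exp (k * \<tau>))" using L dle[OF t] by (intro mult_left_mono) auto
      finally show "\<bar>f (v \<tau>) - f (w \<tau>)\<bar> \<le> L * d * exp (k * \<tau>)" by simp
    qed
    also have "\<dots> = (L / k\<^sup>2) * (d * exp (k * z))" by simp
    also have "\<dots> \<le> 1 / 2 * (d * exp (k * z))" using k d0 by (intro mult_right_mono) auto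
    finally have pot: "\<bar>potential (\<lambda>\<tau>. f (v \<tau>) - f (w \<tau>)) z\<bar> \<le> 1 / 2 * (d * exp (k * z))" .
    have "v z - w z = (\<gamma> - \<gamma>') - potential (\<lambda>\<tau>. f (v \<tau>) - f (w \<tau>)) z"
    proof -
      have "v z = \<gamma> - potential (\<lambda>\<tau>. f (v \<tau>)) z" "w z = \<gamma>' - potential (\<lambda>\<tau>. f (w \<tau>)) z"
        using v w z(1) unfolding radial_ivp_def by blast+
      then show ?thesis using potential_diff[OF fc R z(1)] by linarith
    qed
    then have "\<bar>v z - w z\<bar> \<le> \<bar>\<gamma> - \<gamma>'\<bar> + 1 / 2 * (d * exp (k * z))" using pot by linarith
    moreover have "\<bar>v z - w z\<bar> = d * exp (k * z)" unfolding d_def by (simp add: exp_minus field_simps)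
    ultimately have "d * exp (k * z) \<le> 2 * \<bar>\<gamma> - \<gamma>'\<bar>" by simp
    moreover have "d * 1 \<le> d * exp (k * z)" using d0 k z(1) by (intro mult_left_mono) auto
    ultimately have "d \<le> 2 * \<bar>\<gamma> - \<gamma>'\<bar>" by linarith
    have "\<bar>v x - w x\<bar> \<le> d * exp (k * x)" using dle x by blast
    also have "\<dots> \<le> (2 * \<bar>\<gamma> - \<gamma>'\<bar>) * exp (k * R)" using \<open>d \<le> 2 * \<bar>\<gamma> - \<gamma>'\<bar>\<close> x k
      by (intro mult_mono) auto
    finally show ?thesis unfolding v_def w_def by (simp add: mult_ac)
  qed
  then show ?thesis by (intro exI[of _ "2 * exp (k * R)"]) auto
qed

lemma sol_continuous: "0 < R \<Longrightarrow> continuous_on (UNIV \<times> {0..R}) (\<lambda>(\<gamma>, x). sol R \<gamma> x)"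
  using sol sol_lipschitz unfolding radial_ivp_def
  by (intro continuous_on_lipschitz_family) blast+

text \<open>This is \<open>- x\<close> times the derivative of the solution, that is, the derivative
  with respect to \<open>t = - ln x\<close>.\<close>

definition sflux where "sflux R \<gamma> = flux (\<lambda>\<tau>. f (sol R \<gamma> \<tau>))"

lemma sflux_deriv:
  "0 < R \<Longrightarrow> s \<in> {0..R} \<Longrightarrow> (sflux R \<gamma> has_real_derivative s * f (sol R \<gamma> s)) (at s within {0..R})"
  unfolding sflux_def by (rule flux_deriv[OF ivp_comp_continuous[OF sol]])

lemma sflux_continuous:
  assumes R: "0 < R" shows "continuous_on (UNIV \<times> {0..R}) (\<lambda>(\<gamma>, x). sflux R \<gamma> x)"
proof (rule continuous_on_lipschitz_family)
  show "continuous_on {0..R} (sflux R \<gamma>)" for \<gamma>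
    by (rule DERIV_continuous_on[OF sflux_deriv[OF R]])
  fix m
  obtain C where C: "0 \<le> C" "\<forall>\<gamma>\<le>m. \<forall>\<gamma>'\<le>m. \<forall>x\<in>{0..R}. \<bar>sol R \<gamma> x - sol R \<gamma>' x\<bar> \<le> C * \<bar>\<gamma> - \<gamma>'\<bar>"
    using sol_lipschitz[OF R] by blast
  obtain L where L: "0 \<le> L" "\<forall>u\<le>m. \<forall>v\<le>m. \<bar>f u - f v\<bar> \<le> L * \<bar>u - v\<bar>" using f_lip by blast
  have "\<bar>sflux R \<gamma> x - sflux R \<gamma>' x\<bar> \<le> L * C * R\<^sup>2 / 2 * \<bar>\<gamma> - \<gamma>'\<bar>"
    if g: "\<gamma> \<le> m" "\<gamma>' \<le> m" and x: "x \<in> {0..R}" for \<gamma> \<gamma>' x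
  proof -
    note fc = ivp_comp_continuous[OF sol[OF R]]
    have "\<bar>flux (\<lambda>\<tau>. f (sol R \<gamma> \<tau>) - f (sol R \<gamma>' \<tau>)) x\<bar> \<le> (L * (C * \<bar>\<gamma> - \<gamma>'\<bar>)) * x\<^sup>2 / 2"
    proof (rule flux_bound[OF _ x])
      show "continuous_on {0..R} (\<lambda>\<tau>. f (sol R \<gamma> \<tau>) - f (sol R \<gamma>' \<tau>))" by (intro continuous_intros fc)
      fix \<tau> assume "\<tau> \<in> {0..x}"
      then have t: "\<tau> \<in> {0..R}" using x by auto
      have "\<bar>f (sol R \<gamma> \<tau>) - f (sol R \<gamma>' \<tau>)\<bar> \<le> L * \<bar>sol R \<gamma> \<tau> - sol R \<gamma>' \<tau>\<bar>"
        using L(2) ivp_le[OF sol[OF R] R t, of \<gamma>] ivp_le[OF sol[OF R] R t, of \<gamma>'] g by auto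
      also have "\<dots> \<le> L * (C * \<bar>\<gamma> - \<gamma>'\<bar>)" using L C(2) g t by (intro mult_left_mono) auto
      finally show "\<bar>f (sol R \<gamma> \<tau>) - f (sol R \<gamma>' \<tau>)\<bar> \<le> L * (C * \<bar>\<gamma> - \<gamma>'\<bar>)" .
    qed
    also have "\<dots> \<le> (L * (C * \<bar>\<gamma> - \<gamma>'\<bar>)) * R\<^sup>2 / 2"
      using x L C by (intro divide_right_mono mult_left_mono power_mono) auto
    finally show ?thesis unfolding sflux_def flux_diff[OF fc fc x] by (simp add: mult_ac)
  qed
  then show "\<exists>C\<ge>0. \<forall>\<gamma>\<le>m. \<forall>\<gamma>'\<le>m. \<forall>x\<in>{0..R}. \<bar>sflux R \<gamma> x - sflux R \<gamma>' x\<bar> \<le> C * \<bar>\<gamma> - \<gamma>'\<bar>"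
    using L C by (intro exI[of _ "L * C * R\<^sup>2 / 2"]) auto
qed

lemma sol_deriv:
  assumes R: "0 < R" and x: "x \<in> {0..R}"
  shows "(sol R \<gamma> has_real_derivative - (sflux R \<gamma> x / x)) (at x within {0..R})"
proof -
  note s = sol[OF R, of \<gamma>]
  have "((\<lambda>x. \<gamma> - potential (\<lambda>\<tau>. f (sol R \<gamma> \<tau>)) x) has_real_derivative - (sflux R \<gamma> x / x)) (at x within {0..R})"
    unfolding sflux_def using potential_deriv[OF ivp_comp_continuous[OF s] R x]
    by (auto intro!: derivative_eq_intros)
  then show ?thesis
    by (rule has_field_derivative_transform_within[OF _ zero_less_one x])
       (use s in \<open>auto simp: radial_ivp_def\<close>)
qed

lemma sol_0: "0 < R \<Longrightarrow> sol R \<gamma> 0 = \<gamma>"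
  using sol[of R \<gamma>] unfolding radial_ivp_def potential_def by auto

text \<open>\<open>f\<close> may vanish at arguments that are not positive. Near the centre,
  however, the solution is close to \<gamma> and \<open>f\<close> is positive, and what the flux
  gains there is never lost.\<close>

lemma sflux_pos:
  assumes R: "0 < R" and g: "0 < \<gamma>" and x: "0 < x" "x \<le> R"
  shows "0 < sflux R \<gamma> x"
proof -
  have "continuous_on {0..R} (sol R \<gamma>)" using sol[OF R] unfolding radial_ivp_def by blast
  then obtain d where d: "0 < d" "\<And>s. s \<in> {0..R} \<Longrightarrow> \<bar>s\<bar> < d \<Longrightarrow> \<bar>sol R \<gamma> s - \<gamma>\<bar> < \<gamma>"
    using R g sol_0[OF R, of \<gamma>] unfolding continuous_on_iff dist_real_def
    by (metis atLeastAtMost_iff diff_zero less_eq_real_def)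
  define z where "z = min (d / 2) x"
  have z: "0 < z" "z < d" "z \<le> x" unfolding z_def using d x by auto
  have der: "(sflux R \<gamma> has_real_derivative s * f (sol R \<gamma> s)) (at s)" if "0 < s" "s < R" for s
    using sflux_deriv[OF R, of s \<gamma>] that by (simp add: at_within_Icc_at)
  have cont: "continuous_on {a..b} (sflux R \<gamma>)" if "0 \<le> a" "b \<le> R" for a b
    using continuous_on_subset[OF DERIV_continuous_on[OF sflux_deriv[OF R, of _ \<gamma>]], of "{a..b}"] that by auto
  have "sflux R \<gamma> 0 < sflux R \<gamma> z"
  proof (rule DERIV_pos_imp_increasing_open[OF z(1)])
    fix s assume s: "0 < s" "s < z"
    then have "0 < sol R \<gamma> s" using d(2)[of s] z x by auto
    then show "\<exists>l. (sflux R \<gamma> has_real_derivative l) (at s) \<and> 0 < l"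
      using der[of s] s z x f_pos by (intro exI[of _ "s * f (sol R \<gamma> s)"]) auto
  qed (use cont z x in auto)
  moreover have "sflux R \<gamma> 0 = 0" unfolding sflux_def flux_def by simp
  moreover have "sflux R \<gamma> z \<le> sflux R \<gamma> x"
    by (rule DERIV_nonneg_imp_le_open[OF z(3) cont der]) (use z x f_nonneg in auto)
  ultimately show ?thesis by simp
qed

end

section \<open>Transfer to the original problem\<close>

lemma deriv_on_works:
  "h differentiable (at t within I) \<Longrightarrow> (h has_real_derivative deriv_on I h t) (at t within I)"
  unfolding deriv_on_def has_real_derivative_iff_has_vector_derivative vector_derivative_works .

lemma deriv_on_eq:
  "(h has_real_derivative d) (at t within I) \<Longrightarrow> at t within I \<noteq> bot \<Longrightarrow> deriv_on I h t = d"
  unfolding deriv_on_def has_real_derivative_iff_has_vector_derivative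
  by (rule vector_derivative_within)

lemma deriv_on_interior:
  assumes "t \<in> interior I"
  shows "h differentiable (at t within I) \<Longrightarrow> (h has_real_derivative deriv_on I h t) (at t)"
    and "(h has_real_derivative d) (at t) \<Longrightarrow> deriv_on I h t = d"
  using deriv_on_works[of h t I] deriv_on_eq[of h d t I] at_within_interior[OF assms] by auto

lemma Ck_on_2:
  "Ck_on 2 I h \<longleftrightarrow> (\<forall>t\<in>I. h differentiable (at t within I)) \<and>
     (\<forall>t\<in>I. deriv_on I h differentiable (at t within I)) \<and> continuous_on I (deriv_on I (deriv_on I h))"
  by (simp add: numeral_2_eq_2)

lemma Ck_on_2_I:
  assumes "\<And>t. t \<in> {a..b} \<Longrightarrow> (h has_real_derivative h1 t) (at t within {a..b})"
    and "\<And>t. t \<in> {a..b} \<Longrightarrow> (h1 has_real_derivative h2 t) (at t within {a..b})"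
    and "continuous_on {a..b} h2" and "a < b"
  shows "Ck_on 2 {a..b} h" "\<And>t. t \<in> {a..b} \<Longrightarrow> deriv_on {a..b} h t = h1 t"
    "\<And>t. t \<in> {a..b} \<Longrightarrow> deriv_on {a..b} (deriv_on {a..b} h) t = h2 t"
proof -
  have nb: "at t within {a..b} \<noteq> bot" if "t \<in> {a..b}" for t :: real
    using that \<open>a < b\<close> by (auto simp: trivial_limit_within islimpt_Icc)
  show 1: "deriv_on {a..b} h t = h1 t" if "t \<in> {a..b}" for t
    by (rule deriv_on_eq[OF assms(1)[OF that] nb[OF that]])
  have d2: "(deriv_on {a..b} h has_real_derivative h2 t) (at t within {a..b})" if "t \<in> {a..b}" for t
    by (rule has_field_derivative_transform_within[OF assms(2)[OF that] zero_less_one that]) (use 1 in auto)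
  show 2: "deriv_on {a..b} (deriv_on {a..b} h) t = h2 t" if "t \<in> {a..b}" for t
    by (rule deriv_on_eq[OF d2[OF that] nb[OF that]])
  show "Ck_on 2 {a..b} h"
    unfolding Ck_on_2 using assms(1) d2 assms(3) 2 real_differentiable_def
    by (metis (no_types, lifting) continuous_on_cong)
qed

section \<open>From the initial value problem to solutions of the boundary value problem\<close>

context radial
begin

lemma regular_sol:
  assumes R: "0 < R" "exp (- T0) \<le> R" and g: "0 < \<gamma>"
  shows "regular f T0 \<gamma> (\<lambda>t. sol R \<gamma> (exp (- t))) (\<lambda>t. sflux R \<gamma> (exp (- t)))"
proof -
  have fl: "filterlim (\<lambda>t :: real. exp (- t)) (at 0 within {0..R}) at_top"
    unfolding filterlim_at
  proof
    have "((\<lambda>t :: real. exp (- t)) \<longlongrightarrow> 0) at_top" by real_asymp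
    then show "((\<lambda>t :: real. exp (- t)) \<longlongrightarrow> 0) at_top" .
    show "\<forall>\<^sub>F t :: real in at_top. exp (- t) \<in> {0..R} \<and> exp (- t) \<noteq> 0"
      by (rule eventually_at_top_linorderI[of T0]) (use R in \<open>auto intro: order_trans[of _ "exp (- T0)"]\<close>)
  qed
  have z: "0 \<in> {0..R}" using R by simp
  have "(sol R \<gamma> \<longlongrightarrow> sol R \<gamma> 0) (at 0 within {0..R})" "(sflux R \<gamma> \<longlongrightarrow> sflux R \<gamma> 0) (at 0 within {0..R})"
    using DERIV_continuous[OF sol_deriv[OF R(1) z]] DERIV_continuous[OF sflux_deriv[OF R(1) z]]
    unfolding continuous_within by auto
  then have lim: "((\<lambda>t. sol R \<gamma> (exp (- t))) \<longlongrightarrow> \<gamma>) at_top" "((\<lambda>t. sflux R \<gamma> (exp (- t))) \<longlongrightarrow> 0) at_top"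
    using filterlim_compose[OF _ fl] sol_0[OF R(1)] by (force simp: sflux_def flux_def)+
  have "solves f T0 (\<lambda>t. sol R \<gamma> (exp (- t))) (\<lambda>t. sflux R \<gamma> (exp (- t)))"
    unfolding solves_def
  proof (intro allI impI conjI)
    fix t assume "T0 < t"
    then have "exp (- t) < exp (- T0)" by simp
    then have e: "0 < exp (- t)" "exp (- t) < R" using R by (simp, linarith)
    have d: "(sol R \<gamma> has_real_derivative - (sflux R \<gamma> (exp (- t)) / exp (- t))) (at (exp (- t)))"
      "(sflux R \<gamma> has_real_derivative exp (- t) * f (sol R \<gamma> (exp (- t)))) (at (exp (- t)))"
      using sol_deriv[OF R(1), of "exp (- t)" \<gamma>] sflux_deriv[OF R(1), of "exp (- t)" \<gamma>] e
      by (auto simp: at_within_Icc_at)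
    have de: "((\<lambda>t. exp (- t)) has_real_derivative - exp (- t)) (at t)" by (auto intro!: derivative_eq_intros)
    show "((\<lambda>t. sol R \<gamma> (exp (- t))) has_real_derivative sflux R \<gamma> (exp (- t))) (at t)"
      using DERIV_chain2[OF d(1) de] by simp
    show "((\<lambda>t. sflux R \<gamma> (exp (- t))) has_real_derivative - exp (- 2 * t) * f (sol R \<gamma> (exp (- t)))) (at t)"
    proof (rule DERIV_cong[OF DERIV_chain2[OF d(2) de]])
      have "exp (- 2 * t) = exp (- t) * exp (- t)" by (simp add: exp_add[symmetric])
      then show "exp (- t) * f (sol R \<gamma> (exp (- t))) * - exp (- t) = - exp (- 2 * t) * f (sol R \<gamma> (exp (- t)))"
        by simp
    qed
    show "0 < sflux R \<gamma> (exp (- t))" using sflux_pos[OF R(1) g] e by simp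
  qed
  then show ?thesis unfolding regular_def using lim by blast
qed

lemma sol_strict_decreasing:
  assumes R: "0 < R" and g: "0 < \<gamma>" and xz: "0 \<le> x" "x < z" "z \<le> R"
  shows "sol R \<gamma> z < sol R \<gamma> x"
proof (rule DERIV_neg_imp_decreasing_open[OF xz(2)])
  fix s assume s: "x < s" "s < z"
  then have "(sol R \<gamma> has_real_derivative - (sflux R \<gamma> s / s)) (at s)"
    using sol_deriv[OF R, of s \<gamma>] xz by (simp add: at_within_Icc_at)
  then show "\<exists>l. (sol R \<gamma> has_real_derivative l) (at s) \<and> l < 0"
    using sflux_pos[OF R g, of s] s xz by (intro exI[of _ "- (sflux R \<gamma> s / s)"]) auto
next
  show "continuous_on {x..z} (sol R \<gamma>)"
    using continuous_on_subset[OF DERIV_continuous_on[OF sol_deriv[OF R, of _ \<gamma>]], of "{x..z}"] xz by auto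
qed

text \<open>The scaling \<open>x = sqrt lam * r\<close> restores the parameter. By strict
  monotonicity the solution is positive before its zero at \<open>sqrt lam\<close>, so only the
  values of \<open>f\<close> at nonnegative arguments enter.\<close>

lemma regular_solution_sol:
  assumes R: "0 < R" and g: "0 < \<gamma>" and lam: "0 < lam" "sqrt lam \<le> R" and z: "sol R \<gamma> (sqrt lam) = 0"
    and F: "\<And>u. 0 \<le> u \<Longrightarrow> F u = f u"
  shows "regular_solution F lam (\<lambda>r. sol R \<gamma> (sqrt lam * r))"
proof -
  define k where "k = sqrt lam"
  have k: "0 < k" "k \<le> R" "k * k = lam" unfolding k_def using lam by auto
  have kr: "k * r \<in> {0..R}" if "r \<in> {0..1}" for r
    using that k mult_left_le[of r k] by (auto intro: order_trans[of _ k])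
  define J where "J s = sflux R \<gamma> s / s" for s
  \<comment> \<open>The derivative of \<open>J\<close>; the value at 0 is the one dictated by
    \<open>flux_quadratic\<close>, and it makes \<open>J'\<close> continuous up to the
    centre.\<close>
  define J' where "J' s = (if s = 0 then f (sol R \<gamma> 0) / 2 else f (sol R \<gamma> s) - sflux R \<gamma> s / s / s)" for s
  note ivp = ivp_comp_continuous[OF sol[OF R, of \<gamma>]]
  have dJ: "(J has_real_derivative J' s) (at s within {0..R})" if "s \<in> {0..R}" for s
    using flux_div_deriv[OF ivp R that] unfolding J_def J'_def sflux_def .
  have cJ': "continuous_on {0..R} J'"
    using flux_div_deriv_continuous[OF ivp R] unfolding J'_def sflux_def .
  have dk: "((\<lambda>r. k * r) has_real_derivative k) (at r within {0..1})" for r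
    by (auto intro!: derivative_eq_intros)
  have im: "(\<lambda>r. k * r) ` {0..1} \<subseteq> {0..R}" using kr by auto
  have d1: "((\<lambda>r. sol R \<gamma> (k * r)) has_real_derivative - k * J (k * r)) (at r within {0..1})" if "r \<in> {0..1}" for r
    using DERIV_image_chain[OF DERIV_subset[OF sol_deriv[OF R kr[OF that], of \<gamma>] im] dk]
    unfolding J_def o_def by (simp add: mult.commute)
  have d2: "((\<lambda>r. - k * J (k * r)) has_real_derivative - lam * J' (k * r)) (at r within {0..1})" if "r \<in> {0..1}" for r
  proof -
    have "((\<lambda>r. J (k * r)) has_real_derivative J' (k * r) * k) (at r within {0..1})"
      using DERIV_image_chain[OF DERIV_subset[OF dJ[OF kr[OF that]] im] dk] unfolding o_def .
    then have "((\<lambda>r. - k * J (k * r)) has_real_derivative - k * (J' (k * r) * k)) (at r within {0..1})"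
      by (rule DERIV_cmult)
    then show ?thesis by (rule DERIV_cong) (simp add: k(3)[symmetric])
  qed
  have c2: "continuous_on {0..1} (\<lambda>r. - lam * J' (k * r))"
    by (intro continuous_intros continuous_on_compose2[OF cJ']) (use kr in auto)
  have C: "Ck_on 2 {0..1} (\<lambda>r. sol R \<gamma> (k * r))"
    "\<And>r. r \<in> {0..1} \<Longrightarrow> deriv_on {0..1} (\<lambda>r. sol R \<gamma> (k * r)) r = - k * J (k * r)"
    "\<And>r. r \<in> {0..1} \<Longrightarrow> deriv_on {0..1} (deriv_on {0..1} (\<lambda>r. sol R \<gamma> (k * r))) r = - lam * J' (k * r)"
    by (rule Ck_on_2_I[OF d1 d2 c2 zero_less_one]; assumption)+
  have pos: "0 < sol R \<gamma> (k * r)" if "0 \<le> r" "r < 1" for r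
    using sol_strict_decreasing[OF R g, of "k * r" k] z that k unfolding k_def[symmetric] by simp
  have "radial_eq {0..1} F lam (\<lambda>r. sol R \<gamma> (k * r))"
    unfolding radial_eq_def
  proof
    fix r :: real assume r: "r \<in> {0<..<1}"
    then have r': "r \<in> {0..1}" by auto
    have "f (sol R \<gamma> (k * r)) = F (sol R \<gamma> (k * r))" using F pos[of r] r by simp
    moreover have "lam * (J (k * r) / (k * r)) = 1 / r * (k * J (k * r))"
      using r k by (simp add: k(3)[symmetric] field_simps)
    ultimately show "- deriv_on {0..1} (deriv_on {0..1} (\<lambda>r. sol R \<gamma> (k * r))) r
        - 1 / r * deriv_on {0..1} (\<lambda>r. sol R \<gamma> (k * r)) r = lam * F (sol R \<gamma> (k * r))"
      using r k unfolding C(2)[OF r'] C(3)[OF r'] J'_def J_def by (simp add: right_diff_distrib)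
  qed
  moreover have "deriv_on {0..1} (\<lambda>r. sol R \<gamma> (k * r)) 0 = 0"
    using C(2)[of 0] unfolding J_def by simp
  ultimately show ?thesis
    unfolding regular_solution_def k_def[symmetric] using C(1) pos z unfolding k_def[symmetric] by simp
qed

text \<open>A sequence \<open>a\<close> along which the boundary value alternates in sign gives a
  zero in each gap. Finitely many of these strict signs survive a small change of
  \<open>lam\<close>; at \<open>lam0\<close> all of them are available. \<open>R\<close> exceeds
  \<open>sqrt lam0\<close> strictly to leave room for larger \<open>lam\<close>.\<close>

theorem solutions_from_sign_changes:
  assumes R: "sqrt lam0 < R" and lam0: "0 < lam0" and F: "\<And>u. 0 \<le> u \<Longrightarrow> F u = f u"
    and sgn: "\<And>\<Gamma>. 0 < \<Gamma> \<Longrightarrow> (\<exists>\<gamma>\<ge>\<Gamma>. sol R \<gamma> (sqrt lam0) < 0) \<and> (\<exists>\<gamma>\<ge>\<Gamma>. 0 < sol R \<gamma> (sqrt lam0))"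
  shows "(\<forall>N. \<exists>\<epsilon>>0. \<forall>lam. lam0 - \<epsilon> < lam \<and> lam < lam0 + \<epsilon> \<longrightarrow> at_least_regular_solutions N F lam) \<and>
         (\<exists>u. (\<forall>n. regular_solution F lam0 (u n)) \<and> filterlim (\<lambda>n. u n 0) at_top sequentially)"
proof -
  have R0: "0 < R" using R lam0 real_sqrt_ge_zero[of lam0] by linarith
  define P where "P n \<gamma> lam \<longleftrightarrow> (if even n then sol R \<gamma> (sqrt lam) < 0 else 0 < sol R \<gamma> (sqrt lam))" for n :: nat and \<gamma> lam
  have "\<exists>a. \<forall>n. (1 \<le> a n \<and> P n (a n) lam0) \<and> a n + 1 \<le> a (Suc n)"
  proof (rule dependent_nat_choice)
    show "\<exists>\<gamma>. 1 \<le> \<gamma> \<and> P 0 \<gamma> lam0" using sgn[of 1] unfolding P_def by simp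
    fix \<gamma> n assume "1 \<le> \<gamma> \<and> P n \<gamma> lam0"
    then have "0 < \<gamma> + 1" "1 \<le> \<gamma>" by auto
    then show "\<exists>\<gamma>'. (1 \<le> \<gamma>' \<and> P (Suc n) \<gamma>' lam0) \<and> \<gamma> + 1 \<le> \<gamma>'"
      using sgn[of "\<gamma> + 1"] unfolding P_def by (smt (verit))
  qed
  then obtain a where a: "\<And>n. 1 \<le> a n" "\<And>n. P n (a n) lam0" "\<And>n. a n + 1 \<le> a (Suc n)" by blast
  have a_mono: "a i \<le> a j" if "i \<le> j" for i j
    using lift_Suc_mono_le[of a i j] a(3) that by (meson add_increasing2 le_add_same_cancel1 order_trans zero_le_one)
  have a_ge: "real n \<le> a n" for n
  proof (induction n)
    case (Suc n)
    then show ?case using a(3)[of n] by simp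
  qed (use a(1)[of 0] in simp)
  have between: "\<exists>\<gamma>. a i < \<gamma> \<and> \<gamma> < a (Suc i) \<and> sol R \<gamma> (sqrt lam) = 0"
    if P: "P i (a i) lam" "P (Suc i) (a (Suc i)) lam" and lam: "0 < lam" "sqrt lam < R" for i lam
  proof -
    have sub: "(\<lambda>\<gamma>. (\<gamma>, sqrt lam)) ` {a i..a (Suc i)} \<subseteq> UNIV \<times> {0..R}" using lam by auto
    have c: "continuous_on {a i..a (Suc i)} (\<lambda>\<gamma>. sol R \<gamma> (sqrt lam))"
      using continuous_on_compose2[OF sol_continuous[OF R0] _ sub] by (simp add: continuous_on_Pair)
    have ai: "a i \<le> a (Suc i)" using a(3)[of i] by simp
    obtain \<gamma> where \<gamma>: "a i \<le> \<gamma>" "\<gamma> \<le> a (Suc i)" "sol R \<gamma> (sqrt lam) = 0"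
    proof (cases "even i")
      case True
      then show ?thesis using IVT'[of "\<lambda>\<gamma>. sol R \<gamma> (sqrt lam)" "a i" 0 "a (Suc i)"] P c ai that
        unfolding P_def by auto
    next
      case False
      then show ?thesis using IVT2'[of "\<lambda>\<gamma>. sol R \<gamma> (sqrt lam)" "a (Suc i)" 0 "a i"] P c ai that
        unfolding P_def by auto
    qed
    moreover have "\<gamma> \<noteq> a i" "\<gamma> \<noteq> a (Suc i)" using \<gamma>(3) P unfolding P_def by (auto split: if_splits)
    ultimately show ?thesis by (intro exI[of _ \<gamma>]) auto
  qed
  have reg: "regular_solution F lam (\<lambda>r. sol R \<gamma> (sqrt lam * r))"
    if "0 < lam" "sqrt lam < R" "a i < \<gamma>" "sol R \<gamma> (sqrt lam) = 0" for lam \<gamma> i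
    by (rule regular_solution_sol[OF R0 _ that(1) _ that(4) F]) (use that a(1)[of i] in auto)
  have evP: "\<forall>\<^sub>F lam in nhds lam0. P i (a i) lam" for i
  proof -
    have "isCont (sol R (a i)) (sqrt lam0)"
      using DERIV_continuous[OF sol_deriv[OF R0, of "sqrt lam0" "a i"]] lam0 R by (simp add: at_within_Icc_at)
    then have "isCont (\<lambda>lam. sol R (a i) (sqrt lam)) lam0"
      by (rule isCont_o2[OF isCont_real_sqrt])
    then have "((\<lambda>lam. sol R (a i) (sqrt lam)) \<longlongrightarrow> sol R (a i) (sqrt lam0)) (nhds lam0)"
      unfolding continuous_at using tendsto_at_iff_tendsto_nhds[of "\<lambda>lam. sol R (a i) (sqrt lam)" lam0] by simp
    then show ?thesis using a(2)[of i] unfolding P_def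
      by (cases "even i") (auto intro: order_tendstoD)
  qed
  have evR: "\<forall>\<^sub>F lam in nhds lam0. 0 < lam \<and> sqrt lam < R"
  proof (rule eventually_conj)
    show "\<forall>\<^sub>F lam in nhds lam0. 0 < lam"
      using eventually_nhds_in_open[of "{0<..}" lam0] lam0 by simp
    have "(sqrt \<longlongrightarrow> sqrt lam0) (nhds lam0)"
      using isCont_real_sqrt[of lam0] tendsto_at_iff_tendsto_nhds[of sqrt lam0] unfolding continuous_at by simp
    then show "\<forall>\<^sub>F lam in nhds lam0. sqrt lam < R" using R by (rule order_tendstoD)
  qed
  have "\<exists>\<epsilon>>0. \<forall>lam. lam0 - \<epsilon> < lam \<and> lam < lam0 + \<epsilon> \<longrightarrow> at_least_regular_solutions N F lam" for N
  proof -
    \<comment> \<open>\<open>N\<close> gaps have \<open>N + 1\<close> end points, hence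
      \<open>{..N}\<close>.\<close>
    have "\<forall>\<^sub>F lam in nhds lam0. (\<forall>i\<in>{..N}. P i (a i) lam) \<and> 0 < lam \<and> sqrt lam < R"
      by (rule eventually_conj[OF _ evR]) (use evP in \<open>simp add: eventually_ball_finite\<close>)
    then obtain \<epsilon> where \<epsilon>: "0 < \<epsilon>" "\<And>lam. dist lam lam0 < \<epsilon> \<Longrightarrow> (\<forall>i\<in>{..N}. P i (a i) lam) \<and> 0 < lam \<and> sqrt lam < R"
      unfolding eventually_nhds_metric by blast
    have "at_least_regular_solutions N F lam" if lam: "lam0 - \<epsilon> < lam" "lam < lam0 + \<epsilon>" for lam
    proof -
      have l: "\<forall>i\<in>{..N}. P i (a i) lam" "0 < lam" "sqrt lam < R"
        using \<epsilon>(2)[of lam] lam by (auto simp: dist_real_def)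
      have "\<forall>i. \<exists>\<gamma>. i < N \<longrightarrow> a i < \<gamma> \<and> \<gamma> < a (Suc i) \<and> sol R \<gamma> (sqrt lam) = 0"
        using between[OF _ _ l(2,3)] l(1) by (metis Suc_leI atMost_iff less_imp_le_nat)
      then obtain G where G: "\<And>i. i < N \<Longrightarrow> a i < G i \<and> G i < a (Suc i) \<and> sol R (G i) (sqrt lam) = 0"
        by metis
      \<comment> \<open>The zeros lie in disjoint gaps, so the values at the centre differ, which
        separates the solutions.\<close>
      have G_less: "G i < G j" if "i < j" "j < N" for i j
        using G[of i] G[of j] a_mono[of "Suc i" j] that by fastforce
      show ?thesis
        unfolding at_least_regular_solutions_def
      proof (intro exI[of _ "\<lambda>i r. sol R (G i) (sqrt lam * r)"] conjI allI impI)
        fix i assume "i < N"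
        then show "regular_solution F lam (\<lambda>r. sol R (G i) (sqrt lam * r))" using reg[OF l(2,3)] G by blast
      next
        fix i j assume ij: "i < N" "j < N" "i \<noteq> j"
        then have "G i \<noteq> G j" using G_less[of i j] G_less[of j i] by (cases "i < j") auto
        then show "\<exists>r\<in>{0..1}. sol R (G i) (sqrt lam * r) \<noteq> sol R (G j) (sqrt lam * r)"
          using sol_0[OF R0] by (intro bexI[of _ 0]) auto
      qed
    qed
    then show ?thesis using \<epsilon>(1) by blast
  qed
  moreover have "\<exists>u. (\<forall>n. regular_solution F lam0 (u n)) \<and> filterlim (\<lambda>n. u n 0) at_top sequentially"
  proof -
    obtain G where G: "\<And>i. a i < G i" "\<And>i. sol R (G i) (sqrt lam0) = 0"
      using between[OF a(2) a(2) lam0 R] by metis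
    show ?thesis
    proof (intro exI[of _ "\<lambda>n r. sol R (G n) (sqrt lam0 * r)"] conjI allI)
      show "regular_solution F lam0 (\<lambda>r. sol R (G n) (sqrt lam0 * r))" for n using reg[OF lam0 R] G by blast
      have "filterlim G at_top sequentially"
      proof (rule filterlim_at_top_mono[OF filterlim_real_sequentially])
        show "\<forall>\<^sub>F n in sequentially. real n \<le> G n"
          using a_ge G(1) by (intro always_eventually allI) (meson less_imp_le order_trans)
      qed
      then show "filterlim (\<lambda>n. sol R (G n) (sqrt lam0 * 0)) at_top sequentially" using sol_0[OF R0] by simp
    qed
  qed
  ultimately show ?thesis by blast
qed

end

section \<open>The given nonlinearity and singular solution\<close>

lemma Ck_on_lipschitz:
  fixes f :: "real \<Rightarrow> real"
  assumes "Ck_on 2 {0..} f"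
  shows "\<exists>L\<ge>0. \<forall>u\<le>m. \<forall>v\<le>m. \<bar>f (max u 0) - f (max v 0)\<bar> \<le> L * \<bar>u - v\<bar>"
proof -
  define n where "n = max m 0"
  have d: "(f has_real_derivative deriv_on {0..} f t) (at t within {0..})" if "0 \<le> t" for t
    using assms that unfolding Ck_on_2 by (auto intro: deriv_on_works)
  have c: "continuous_on {0..n} (deriv_on {0..} f)"
  proof (rule continuous_on_subset)
    show "continuous_on {0..} (deriv_on {0..} f)"
      using assms unfolding Ck_on_2
      by (intro differentiable_imp_continuous_on) (auto simp: differentiable_on_def)
  qed auto
  obtain L where L: "\<And>t. t \<in> {0..n} \<Longrightarrow> norm (deriv_on {0..} f t) \<le> L"
    using compact_imp_bounded[OF compact_continuous_image[OF c compact_Icc]] unfolding bounded_iff by blast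
  have "0 \<le> L" using L[of 0] norm_ge_zero[of "deriv_on {0..} f 0"] unfolding n_def by (auto intro: order_trans)
  have "\<bar>f (max u 0) - f (max v 0)\<bar> \<le> L * \<bar>u - v\<bar>" if "u \<le> m" "v \<le> m" for u v
  proof -
    have "norm (f (max u 0) - f (max v 0)) \<le> L * norm (max u 0 - max v 0)"
    proof (rule field_differentiable_bound[of "{0..n}" f "deriv_on {0..} f"])
      fix z assume "z \<in> {0..n}"
      then show "(f has_field_derivative deriv_on {0..} f z) (at z within {0..n})"
        using d[of z] by (auto intro: DERIV_subset)
    qed (use L that in \<open>auto simp: n_def\<close>)
    also have "\<dots> \<le> L * \<bar>u - v\<bar>" using \<open>0 \<le> L\<close> by (intro mult_left_mono) auto
    finally show ?thesis by simp
  qed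
  then show ?thesis using \<open>0 \<le> L\<close> by blast
qed

lemma log_nl_derivs:
  assumes "Ck_on 2 {t0..} f" "\<And>t. t0 \<le> t \<Longrightarrow> 0 < f t" "t0 < t"
  shows "(log_nl f has_real_derivative deriv_on {t0..} (log_nl f) t) (at t)"
    and "(deriv_on {t0..} (log_nl f) has_real_derivative
            deriv_on {t0..} (deriv_on {t0..} (log_nl f)) t) (at t)"
proof -
  define f1 where "f1 = deriv_on {t0..} f"
  have int: "s \<in> interior {t0..}" if "t0 < s" for s using that by simp
  have d1: "(f has_real_derivative f1 s) (at s)" if "t0 < s" for s
    using deriv_on_interior(1)[OF int[OF that]] assms(1) that unfolding Ck_on_2 f1_def by auto
  have d2: "(f1 has_real_derivative deriv_on {t0..} f1 s) (at s)" if "t0 < s" for s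
    using deriv_on_interior(1)[OF int[OF that]] assms(1) that unfolding Ck_on_2 f1_def by auto
  have dl: "(log_nl f has_real_derivative f1 s / f s) (at s)" if "t0 < s" for s
    unfolding log_nl_def[abs_def] using assms(2)[of s] d1[OF that] that
    by (auto intro!: derivative_eq_intros)
  have eq: "deriv_on {t0..} (log_nl f) s = f1 s / f s" if "t0 < s" for s
    by (rule deriv_on_interior(2)[OF int[OF that] dl[OF that]])
  show "(log_nl f has_real_derivative deriv_on {t0..} (log_nl f) t) (at t)"
    using dl eq assms(3) by simp
  have "((\<lambda>s. f1 s / f s) has_real_derivative
      (deriv_on {t0..} f1 t * f t - f1 t * f1 t) / (f t * f t)) (at t)"
    using DERIV_quotient[OF d2[OF assms(3)] d1[OF assms(3)]] assms(2)[of t] assms(3)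
    by (simp add: power2_eq_square mult.commute)
  then have "(deriv_on {t0..} (log_nl f) has_real_derivative
      (deriv_on {t0..} f1 t * f t - f1 t * f1 t) / (f t * f t)) (at t)"
    by (rule has_field_derivative_transform_within_open[where S = "{t0<..}"]) (use eq assms(3) in auto)
  then show "(deriv_on {t0..} (log_nl f) has_real_derivative
            deriv_on {t0..} (deriv_on {t0..} (log_nl f)) t) (at t)"
    using deriv_on_interior(2)[OF int[OF assms(3)]] by simp
qed

text \<open>The cases \<open>q = 1\<close> and \<open>1 < q < 2\<close> are treated alike:
  \<open>g * g2 / g1^2\<close> tends to \<open>1 / q\<close>, which lies in
  \<open>(1/2, 1]\<close>.\<close>

lemma growth_of_gen_exp_growth:
  assumes nl: "nonlinearity f t0" and gg: "gen_exp_growth f t0 q p" and q: "1 \<le> q" "q < 2"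
    and C2: "Ck_on 2 {0..} f"
  obtains M \<theta> x c where "t0 < M" "growth (\<lambda>u. f (max u 0)) (log_nl f) (deriv_on {t0..} (log_nl f))
      (deriv_on {t0..} (deriv_on {t0..} (log_nl f))) M \<theta> x c"
proof -
  define g where "g = log_nl f"
  define g1 where "g1 = deriv_on {t0..} g"
  define g2 where "g2 = deriv_on {t0..} g1"
  define F where "F u = f (max u 0)" for u
  have nl': "\<And>t. 0 \<le> t \<Longrightarrow> 0 \<le> f t" "0 \<le> t0" "\<And>t. t0 \<le> t \<Longrightarrow> 0 < f t" "Ck_on 2 {t0..} f"
    using nl unfolding nonlinearity_def by auto
  have gg': "\<And>t. t0 \<le> t \<Longrightarrow> 0 < g1 t \<and> 0 < g2 t" "((\<lambda>t. (g1 t)\<^sup>2 / (g t * g2 t)) \<longlongrightarrow> q) at_top"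
    using gg unfolding gen_exp_growth_def Let_def g_def g1_def g2_def by auto
  have d: "(g has_real_derivative g1 t) (at t)" "(g1 has_real_derivative g2 t) (at t)" if "t0 < t" for t
    using log_nl_derivs[OF nl'(4,3) that] unfolding g_def g1_def g2_def by auto
  have gtop: "filterlim g at_top at_top"
  proof (rule filterlim_at_top_mono)
    define a where "a = t0 + 1"
    show "filterlim (\<lambda>s. g a + g1 a * (s - a)) at_top at_top"
      using gg'(1)[of a] unfolding a_def by real_asymp
    show "\<forall>\<^sub>F s in at_top. g a + g1 a * (s - a) \<le> g s"
    proof (rule eventually_at_top_linorderI[of a])
      fix s assume s: "a \<le> s"
      have mono: "g1 a \<le> g1 t" if "a \<le> t" for t
        by (rule DERIV_nonneg_imp_le[OF that, where f' = g2]) (use d gg' in \<open>auto simp: a_def less_imp_le\<close>)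
      have "g a - g1 a * a \<le> g s - g1 a * s"
        by (rule DERIV_nonneg_imp_le[OF s, where f = "\<lambda>t. g t - g1 a * t" and f' = "\<lambda>t. g1 t - g1 a"])
           (use d mono in \<open>auto simp: a_def intro!: derivative_eq_intros\<close>)
      then show "g a + g1 a * (s - a) \<le> g s" by (simp add: algebra_simps)
    qed
  qed
  \<comment> \<open>Midpoint of \<open>1 - 1 / q\<close> and \<open>1/2\<close>. It is at least
    \<open>1/4\<close> even for \<open>q = 1\<close>, so \<open>1 / \<theta>\<close> makes sense and
    is at most 4; \<open>x\<close> is the midpoint of 2 and \<open>1 / \<theta>\<close>.\<close>
  define \<theta> where "\<theta> = (1 - 1 / q + 1 / 2) / 2"
  define x where "x = (2 + 1 / \<theta>) / 2"
  \<comment> \<open>The solution of \<open>4 + 2 * c = x * (2 - c)\<close>.\<close>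
  define c where "c = (2 * x - 4) / (2 + x)"
  have qi: "1 / 2 < 1 / q" "1 / q \<le> 1" using q by (auto simp: field_simps)
  define z where "z = 1 / q"
  have "\<theta> = 3 / 4 - z / 2" unfolding \<theta>_def z_def by simp
  moreover have "1 / 2 < z" "z \<le> 1" using qi unfolding z_def by auto
  ultimately have "1 / 4 \<le> \<theta> \<and> \<theta> < 1 / 2 \<and> 1 - \<theta> < 1 / q" unfolding z_def[symmetric] by (intro conjI) linarith+
  then have th: "1 / 4 \<le> \<theta>" "\<theta> < 1 / 2" "1 - \<theta> < 1 / q" by auto
  have "2 < 1 / \<theta>" "1 / \<theta> \<le> 4" using th by (auto simp: field_simps)
  then have x: "2 < x" "x \<le> 3" unfolding x_def by auto
  have thx: "\<theta> * x < 1" unfolding x_def using th by (simp add: field_simps)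
  have c: "0 < c" "c \<le> 1 / 2" "4 + 2 * c \<le> x * (2 - c)"
    unfolding c_def using x by (auto simp: field_simps)
  have qth: "q < 1 / (1 - \<theta>)" using th q by (simp add: field_simps)
  have ev1: "\<forall>\<^sub>F t in at_top. 1 / 2 < (g1 t)\<^sup>2 / (g t * g2 t)" using gg'(2) q by (intro order_tendstoD) auto
  have ev2: "\<forall>\<^sub>F t in at_top. (g1 t)\<^sup>2 / (g t * g2 t) < 1 / (1 - \<theta>)" using gg'(2) qth by (rule order_tendstoD)
  \<comment> \<open>With \<open>g\<close> this large, \<open>g * g2 \<le> 2 * g1^2\<close> implies
    \<open>g2_small\<close>.\<close>
  have ev3: "\<forall>\<^sub>F t in at_top. max 1 (2 * (4 + c) / c) < g t" using gtop unfolding filterlim_at_top_dense by blast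
  obtain M' where M': "\<And>t. M' \<le> t \<Longrightarrow> 1 / 2 < (g1 t)\<^sup>2 / (g t * g2 t) \<and> (g1 t)\<^sup>2 / (g t * g2 t) < 1 / (1 - \<theta>)
      \<and> max 1 (2 * (4 + c) / c) < g t"
    using eventually_conj[OF ev1 eventually_conj[OF ev2 ev3]] unfolding eventually_at_top_linorder by blast
  define M where "M = max M' (t0 + 1)"
  have facts: "t0 < s" "0 < g1 s" "0 < g2 s" "1 \<le> g s" "2 * (4 + c) / c < g s"
      "(1 - \<theta>) * (g1 s)\<^sup>2 \<le> g s * g2 s" "g s * g2 s \<le> 2 * (g1 s)\<^sup>2" if "M \<le> s" for s
  proof -
    have s: "M' \<le> s" "t0 < s" using that unfolding M_def by auto
    show "t0 < s" "0 < g1 s" "0 < g2 s" "1 \<le> g s" "2 * (4 + c) / c < g s" using M'[OF s(1)] s(2) gg'(1)[of s] by auto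
    then have pos: "0 < g s * g2 s" by simp
    show "(1 - \<theta>) * (g1 s)\<^sup>2 \<le> g s * g2 s" "g s * g2 s \<le> 2 * (g1 s)\<^sup>2"
      using M'[OF s(1)] pos th by (auto simp: field_simps)
  qed
  have lip: "\<exists>L\<ge>0. \<forall>u\<le>m. \<forall>v\<le>m. \<bar>F u - F v\<bar> \<le> L * \<bar>u - v\<bar>" for m
    using Ck_on_lipschitz[OF C2] unfolding F_def by blast
  have "growth F g g1 g2 M \<theta> x c"
  proof
    show "0 \<le> F u" for u unfolding F_def using nl'(1) by simp
    show "\<exists>B. \<forall>u\<le>m. F u \<le> B" for m
    proof -
      define n where "n = max m 0"
      obtain L where L: "0 \<le> L" "\<forall>u\<le>n. \<forall>v\<le>n. \<bar>F u - F v\<bar> \<le> L * \<bar>u - v\<bar>" using lip by blast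
      have "F u \<le> F 0 + L * n" if "u \<le> m" for u
      proof -
        have "\<bar>F (max u 0) - F 0\<bar> \<le> L * \<bar>max u 0 - 0\<bar>" using L(2)[rule_format, of "max u 0" 0] that unfolding n_def by auto
        also have "\<dots> \<le> L * n" using L(1) that unfolding n_def by (intro mult_left_mono) auto
        finally show ?thesis unfolding F_def by simp
      qed
      then show ?thesis by blast
    qed
    show "continuous_on UNIV F" by (rule continuous_on_locally_lipschitz[OF lip])
    fix s assume s: "M \<le> s"
    note facts = facts[OF s]
    show "F s = exp (g s)" unfolding F_def g_def log_nl_def using facts(1) nl'(2) nl'(3)[of s] by simp
    show "(g has_real_derivative g1 s) (at s)" "(g1 has_real_derivative g2 s) (at s)" using d facts(1) by auto
    show "0 < g1 s" "1 \<le> g s" "(1 - \<theta>) * (g1 s)\<^sup>2 \<le> g s * g2 s" "g s * g2 s \<le> 2 * (g1 s)\<^sup>2" using facts by auto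
    have "2 * (4 + c) / c * g2 s \<le> 2 * (g1 s)\<^sup>2"
      using facts(3,5,7) mult_right_mono[of "2 * (4 + c) / c" "g s" "g2 s"] by linarith
    then show "g2 s \<le> c / (4 + c) * (g1 s)\<^sup>2" using c by (simp add: field_simps)
  qed (use th x thx c in auto)
  moreover have "t0 < M" unfolding M_def by simp
  ultimately show ?thesis using that[of M \<theta> x c] unfolding F_def g_def g1_def g2_def by blast
qed

lemma eventually_log_scale:
  fixes rbar S :: real
  assumes "0 < rbar" "0 < S"
  shows "\<forall>\<^sub>F t in at_top. exp (- t) / S \<in> {0<..<rbar}"
proof -
  have "((\<lambda>t :: real. exp (- t)) \<longlongrightarrow> 0) at_top" by real_asymp
  then have "((\<lambda>t. exp (- t) / S) \<longlongrightarrow> 0) at_top" by (rule tendsto_divide_zero)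
  then have "\<forall>\<^sub>F t in at_top. exp (- t) / S < rbar" using assms(1) by (rule order_tendstoD)
  then show ?thesis by eventually_elim (use assms in simp)
qed

theorem corollary2p8:
  fixes f :: "real \<Rightarrow> real" and t0 q :: real and p :: ereal
    and lamstar :: real and Ustar :: "real \<Rightarrow> real"
  assumes "nonlinearity f t0"
    and "gen_exp_growth f t0 q p"
    and "1 \<le> q" and "q < 2"
    and "Ck_on 2 {0..} f"
    and "\<forall>t>0. f t > 0"
    and "q = 1 \<longrightarrow> (INF t\<in>{0<..}. f t / t) > 0"
    and "lamstar > 0"
    and "singular_solution f lamstar Ustar"
    and "condition_C f t0 Ustar"
  shows "(\<forall>N::nat. \<exists>\<epsilon>>0. \<forall>lam. lamstar - \<epsilon> < lam \<and> lam < lamstar + \<epsilon> \<longrightarrow>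
            at_least_regular_solutions N f lam) \<and>
         (\<exists>u :: nat \<Rightarrow> real \<Rightarrow> real. (\<forall>n. regular_solution f lamstar (u n)) \<and>
            filterlim (\<lambda>n. u n 0) at_top sequentially)"
proof -
  define g where "g = log_nl f"
  define g1 where "g1 = deriv_on {t0..} g"
  define g2 where "g2 = deriv_on {t0..} g1"
  define F where "F u = f (max u 0)" for u
  obtain M \<theta> x c where M: "t0 < M" and gr: "growth F g g1 g2 M \<theta> x c"
    using growth_of_gen_exp_growth[OF assms(1-5)] unfolding F_def g_def g1_def g2_def by blast
  have nl: "\<And>t. 0 \<le> t \<Longrightarrow> 0 \<le> f t" "0 \<le> t0" "\<And>t. t0 \<le> t \<Longrightarrow> 0 < f t"
    using assms(1) unfolding nonlinearity_def by auto
  have g1_pos_t0: "0 < g1 t" if "t0 \<le> t" for t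
    using assms(2) that unfolding gen_exp_growth_def Let_def g_def g1_def by auto
  interpret growth F g g1 g2 M \<theta> x c by (rule gr)
  have lip: "\<exists>L\<ge>0. \<forall>u\<le>m. \<forall>v\<le>m. \<bar>F u - F v\<bar> \<le> L * \<bar>u - v\<bar>" for m
    using Ck_on_lipschitz[OF assms(5)] unfolding F_def by blast
  interpret rad: radial F
    by standard (use f_nonneg lip assms(6) in \<open>auto simp: F_def\<close>)
  define S where "S = sqrt lamstar"
  have S: "0 < S" "S\<^sup>2 = lamstar" unfolding S_def using assms(8) by auto
  define T0 where "T0 = - ln S"
  have eT0: "exp (- T0) = S" unfolding T0_def using S by simp
  define \<rho> where "\<rho> t = exp (- t) / S" for t
  have rho: "0 < \<rho> t" for t unfolding \<rho>_def using S by simp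
  have rho1: "\<rho> T0 = 1" unfolding \<rho>_def eT0 using S by simp
  have rho_lt: "\<rho> t < 1" if "T0 < t" for t
  proof -
    have "exp (- t) < exp (- T0)" using that by simp
    then show ?thesis unfolding \<rho>_def eT0 using S by simp
  qed
  have rho_mem: "\<rho> t \<in> {0<..1}" if "T0 \<le> t" for t
    using rho[of t] rho1 rho_lt[of t] that by (cases "t = T0") auto
  have rho_d: "(\<rho> has_real_derivative - \<rho> t) (at t)" for t
    unfolding \<rho>_def using S by (auto intro!: derivative_eq_intros)
  have rho_c: "continuous_on A \<rho>" for A unfolding \<rho>_def using S by (intro continuous_intros) auto
  have ln_rho: "ln (1 / \<rho> t) = t + ln S" for t
    unfolding \<rho>_def using S by (simp add: ln_div)
  define V1 where "V1 = deriv_on {0<..1} Ustar"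
  define V2 where "V2 = deriv_on {0<..1} V1"
  have sing: "Ck_on 2 {0<..1} Ustar" "radial_eq {0<..1} f lamstar Ustar" "\<And>r. r \<in> {0<..<1} \<Longrightarrow> 0 < Ustar r"
    "filterlim Ustar at_top (at_right 0)" "Ustar 1 = 0"
    using assms(9) unfolding singular_solution_def by auto
  have V: "(Ustar has_real_derivative V1 r) (at r)" "(V1 has_real_derivative V2 r) (at r)"
    if "0 < r" "r < 1" for r
  proof -
    have int: "r \<in> interior {0<..1}" using that by (auto intro!: interiorI[of "{0<..<1}"])
    show "(Ustar has_real_derivative V1 r) (at r)" "(V1 has_real_derivative V2 r) (at r)"
      using deriv_on_interior(1)[OF int] sing(1) that unfolding Ck_on_2 V1_def V2_def by auto
  qed
  have Vc: "continuous_on {0<..1} Ustar" "continuous_on {0<..1} V1"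
    using sing(1) unfolding Ck_on_2 V1_def
    by (auto intro!: differentiable_imp_continuous_on simp: differentiable_on_def)
  define U where "U t = Ustar (\<rho> t)" for t
  define U1 where "U1 t = - \<rho> t * V1 (\<rho> t)" for t
  have Uc: "continuous_on {T0..} U" "continuous_on {T0..} U1"
    unfolding U_def U1_def using rho_mem
    by (auto intro!: continuous_intros continuous_on_compose2[OF Vc(1)] continuous_on_compose2[OF Vc(2)] rho_c)
  have Ud: "(U has_real_derivative U1 t) (at t)"
    "(U1 has_real_derivative - exp (- 2 * t) * F (U t)) (at t)" if t: "T0 < t" for t
  proof -
    note Vr = V[OF rho rho_lt[OF t]]
    show "(U has_real_derivative U1 t) (at t)"
      unfolding U_def U1_def using DERIV_chain2[OF Vr(1) rho_d] by (simp add: mult.commute)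
    have "((\<lambda>t. V1 (\<rho> t)) has_real_derivative V2 (\<rho> t) * - \<rho> t) (at t)"
      by (rule DERIV_chain2[OF Vr(2) rho_d])
    from DERIV_mult[OF DERIV_minus[OF rho_d] this]
    have dU1: "(U1 has_real_derivative \<rho> t * V1 (\<rho> t) + (\<rho> t)\<^sup>2 * V2 (\<rho> t)) (at t)"
      unfolding U1_def by (simp add: power2_eq_square algebra_simps)
    have "- V2 (\<rho> t) - 1 / \<rho> t * V1 (\<rho> t) = lamstar * f (U t)"
      using sing(2) rho[of t] rho_lt[OF t] unfolding radial_eq_def V1_def V2_def U_def by auto
    then have "(\<rho> t)\<^sup>2 * (- V2 (\<rho> t) - 1 / \<rho> t * V1 (\<rho> t)) = (\<rho> t)\<^sup>2 * (lamstar * f (U t))" by simp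
    moreover have "(\<rho> t)\<^sup>2 * (- V2 (\<rho> t) - 1 / \<rho> t * V1 (\<rho> t)) = - ((\<rho> t)\<^sup>2 * V2 (\<rho> t)) - \<rho> t * V1 (\<rho> t)"
      using rho[of t] by (simp add: power2_eq_square right_diff_distrib)
    ultimately have "(\<rho> t)\<^sup>2 * V2 (\<rho> t) = - (\<rho> t * V1 (\<rho> t)) - (\<rho> t)\<^sup>2 * lamstar * f (U t)"
      unfolding mult.assoc by linarith
    moreover have "(\<rho> t)\<^sup>2 * lamstar = exp (- 2 * t)"
      unfolding \<rho>_def using S assms(8) by (simp add: power_divide exp_double[symmetric])
    moreover have "F (U t) = f (U t)"
      unfolding F_def U_def using sing(3)[of "\<rho> t"] rho[of t] rho_lt[OF t] by simp
    ultimately show "(U1 has_real_derivative - exp (- 2 * t) * F (U t)) (at t)" using dU1 by simp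
  qed
  have rho0: "filterlim \<rho> (at_right 0) at_top"
    unfolding filterlim_at
  proof
    have "((\<lambda>t :: real. exp (- t)) \<longlongrightarrow> 0) at_top" by real_asymp
    then show "(\<rho> \<longlongrightarrow> 0) at_top" unfolding \<rho>_def by (rule tendsto_divide_zero)
    show "\<forall>\<^sub>F t in at_top. \<rho> t \<in> {0<..} \<and> \<rho> t \<noteq> 0" using rho by (auto simp: less_imp_neq[symmetric])
  qed
  have U_top: "filterlim U at_top at_top"
    unfolding U_def by (rule filterlim_compose[OF sing(4) rho0])
  \<comment> \<open>\<open>U1\<close> is nonincreasing, so once it is not positive \<open>U\<close>
    can no longer increase, which contradicts the blow-up at the origin.\<close>
  have U1_pos: "0 < U1 a" if a: "T0 < a" for a
  proof (rule ccontr)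
    assume neg: "\<not> 0 < U1 a"
    have "U1 t \<le> U1 a" if "a \<le> t" for t
      by (rule DERIV_nonpos_imp_ge[OF that, where f' = "\<lambda>t. - exp (- 2 * t) * F (U t)"])
         (use Ud a f_nonneg in auto)
    then have "U t \<le> U a" if "a \<le> t" for t
      by (intro DERIV_nonpos_imp_ge[OF that, where f' = U1]) (use Ud a neg in fastforce)+
    moreover have "\<forall>\<^sub>F t in at_top. U a < U t \<and> a \<le> t"
      using U_top unfolding filterlim_at_top_dense by (intro eventually_conj eventually_ge_at_top) blast
    then obtain t where "U a < U t" "a \<le> t" using eventually_happens' trivial_limit_at_top_linorder by blast
    ultimately show False by (simp add: not_le[symmetric])
  qed
  have CC: "\<forall>\<^sub>F t in at_top. t0 \<le> U t \<and> \<alpha> * (t + ln S) \<le> g (U t) \<and> g (U t) + ln (g1 (U t)) \<le> 2 * (t + ln S) + \<beta>"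
    if \<alpha>: "0 < \<alpha>" "\<alpha> < 2" for \<alpha> \<beta>
  proof -
    have "\<exists>rbar>0. \<forall>r\<in>{0<..<rbar}. t0 \<le> Ustar r \<and> \<alpha> * ln (1 / r) \<le> g (Ustar r) \<and>
          g (Ustar r) + ln (g1 (Ustar r)) \<le> 2 * ln (1 / r) + \<beta>"
      using assms(10) \<alpha> unfolding condition_C_def Let_def g1_def g_def by auto
    then obtain rbar where r: "0 < rbar" "\<And>r. r \<in> {0<..<rbar} \<Longrightarrow> t0 \<le> Ustar r \<and> \<alpha> * ln (1 / r) \<le> g (Ustar r) \<and>
          g (Ustar r) + ln (g1 (Ustar r)) \<le> 2 * ln (1 / r) + \<beta>" by blast
    from eventually_log_scale[OF r(1) S(1)] show ?thesis
    proof eventually_elim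
      case (elim t)
      then show ?case using r(2)[of "\<rho> t"] ln_rho[of t] unfolding U_def \<rho>_def by auto
    qed
  qed
  define y where "y \<gamma> t = rad.sol (2 * S) \<gamma> (exp (- t))" for \<gamma> t
  define y1 where "y1 \<gamma> t = rad.sflux (2 * S) \<gamma> (exp (- t))" for \<gamma> t
  \<comment> \<open>The radius \<open>2 * S\<close> is a choice strictly larger than
    \<open>S\<close>, so that the boundary radius is interior to the interval of existence.\<close>
  have S2: "0 < 2 * S" using S by simp
  have exp_cont: "continuous_on ({0<..} \<times> {T0..}) (\<lambda>(\<gamma> :: real, t). (\<gamma>, exp (- t)))"
    unfolding case_prod_unfold by (intro continuous_intros)
  have exp_sub: "(\<lambda>(\<gamma> :: real, t). (\<gamma>, exp (- t))) ` ({0<..} \<times> {T0..}) \<subseteq> UNIV \<times> {0..2 * S}"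
  proof -
    have "exp (- t) \<le> 2 * S" if "T0 \<le> t" for t
    proof -
      have "exp (- t) \<le> exp (- T0)" using that by simp
      then show ?thesis unfolding eT0 using S by simp
    qed
    then show ?thesis by auto
  qed
  interpret fam: singular_family F g g1 g2 M \<theta> x c U U1 T0 y y1
  proof
    show "solves F T0 U U1" unfolding solves_def using Ud U1_pos by blast
    show "filterlim U at_top at_top" by (rule U_top)
    show "\<forall>\<^sub>F t in at_top. \<alpha> * t \<le> g (U t)" if \<alpha>: "0 < \<alpha>" "\<alpha> < 2" for \<alpha>
    proof -
      \<comment> \<open>The gap between \<alpha> and \<open>\<alpha>'\<close> absorbs the shift
        \<open>ln S\<close> caused by the rescaling.\<close>
      define \<alpha>' where "\<alpha>' = (\<alpha> + 2) / 2"
      have a': "0 < \<alpha>'" "\<alpha>' < 2" "\<alpha> < \<alpha>'" unfolding \<alpha>'_def using \<alpha> by auto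
      have "filterlim (\<lambda>t. (\<alpha>' - \<alpha>) * t + \<alpha>' * ln S) at_top at_top" using a' by real_asymp
      then have "\<forall>\<^sub>F t in at_top. 0 < (\<alpha>' - \<alpha>) * t + \<alpha>' * ln S" unfolding filterlim_at_top_dense by blast
      with CC[OF a'(1,2), of 0] show ?thesis by eventually_elim (simp add: algebra_simps)
    qed
    show "((\<lambda>t. exp (- 2 * t) * F (U t) * g1 (U t)) \<longlongrightarrow> 0) at_top"
    proof (rule tendstoI)
      fix e :: real assume e: "0 < e"
      \<comment> \<open>In \<beta>, the term \<open>- 2 * ln S\<close> undoes the shift of the
        variable, and the \<open>- 1\<close> makes the final inequality strict.\<close>
      from CC[of 1 "ln e - 2 * ln S - 1"]
      have "\<forall>\<^sub>F t in at_top. t0 \<le> U t \<and> 1 * (t + ln S) \<le> g (U t) \<and>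
          g (U t) + ln (g1 (U t)) \<le> 2 * (t + ln S) + (ln e - 2 * ln S - 1)" by simp
      then show "\<forall>\<^sub>F t in at_top. dist (exp (- 2 * t) * F (U t) * g1 (U t)) 0 < e"
      proof eventually_elim
        case (elim t)
        have F: "F (U t) = exp (g (U t))"
          unfolding F_def g_def log_nl_def using elim nl by (simp add: max_absorb1)
        have p: "0 < g1 (U t)" using g1_pos_t0 elim by simp
        have "exp (- 2 * t) * F (U t) * g1 (U t) = exp (- 2 * t + g (U t) + ln (g1 (U t)))"
          unfolding F exp_add using p by simp
        also have "\<dots> \<le> exp (ln e - 1)" using elim by simp
        also have "\<dots> < exp (ln e)" by simp
        also have "\<dots> = e" using e by simp
        finally show ?case using p F by (simp add: abs_mult)
      qed
    qed
    show "\<exists>L\<ge>0. \<forall>u\<le>m. \<forall>v\<le>m. \<bar>F u - F v\<bar> \<le> L * \<bar>u - v\<bar>" for m by (rule lip)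
    show "regular F T0 \<gamma> (y \<gamma>) (y1 \<gamma>)" if "0 < \<gamma>" for \<gamma>
      unfolding y_def y1_def by (rule rad.regular_sol[OF S2 _ that]) (use eT0 S in simp)
    show "continuous_on ({0<..} \<times> {T0..}) (\<lambda>(\<gamma>, t). y \<gamma> t)"
      using continuous_on_compose2[OF rad.sol_continuous[OF S2] exp_cont exp_sub]
      unfolding y_def case_prod_unfold by simp
    show "continuous_on ({0<..} \<times> {T0..}) (\<lambda>(\<gamma>, t). y1 \<gamma> t)"
      using continuous_on_compose2[OF rad.sflux_continuous[OF S2] exp_cont exp_sub]
      unfolding y1_def case_prod_unfold by simp
    show "continuous_on {T0..} U" "continuous_on {T0..} U1" by (rule Uc)+
  qed
  show ?thesis
  proof (rule rad.solutions_from_sign_changes[of lamstar "2 * S"])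
    show "sqrt lamstar < 2 * S" using S unfolding S_def[symmetric] by simp
    show "f u = F u" if "0 \<le> u" for u using that unfolding F_def by simp
    \<comment> \<open>So comparing \<open>y \<gamma>\<close> with \<open>U\<close> at
      \<open>T0\<close> is reading off the sign of the boundary value.\<close>
    have "U T0 = 0" unfolding U_def rho1 by (rule sing(5))
    then show "(\<exists>\<gamma>\<ge>\<Gamma>. rad.sol (2 * S) \<gamma> (sqrt lamstar) < 0) \<and> (\<exists>\<gamma>\<ge>\<Gamma>. 0 < rad.sol (2 * S) \<gamma> (sqrt lamstar))"
      if "0 < \<Gamma>" for \<Gamma>
      using fam.sign_changes[OF that] unfolding y_def eT0 S_def[symmetric] by simp
  qed (rule assms(8))
qed

end
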